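(* Let $p$, $q$ and $n_1,\ldots,n_q$ be positive integers with total sample size $n=\sum_{j=1}^qn_j$, where $p$, $q$ and the $n_j$ may depend on $n$ and all limits are taken as $n\to\infty$. Let $X_{ji}$, $1\le i\le n_j$, $1\le j\le q$, be independent random vectors with $X_{ji}\sim\mathcal{N}(\mu_j,\Sigma_j)$, where $\mu_j\in\mathbb{R}^p$ and $\Sigma_j\in\mathbb{R}^{p\times p}$ is positive definite (these parameters may depend on $n$). Let $\tilde\Lambda_{n,1}$ be the modified likelihood ratio statistic (defined in the context) for the null hypothesis $$H_0:\ \Sigma_1=\ldots=\Sigma_q .$$ Assume that $n_j+1>p$ for all $1\le j\le q$, $p\to\infty$, $q=o(\sqrt{p(n-q)})$, $p=o(n-q)$, that $$\limsup_{n\to\infty}\ \sup_{1\le j\le q}\frac{p}{n_j-1}<1,$$ and that $$\sigma_n^2=\frac12\sum_{j=1}^q\frac{(n_j-1)^2}{p(n-q)}\log\Big(\frac{n_j-1}{n_j-p-1}\Big)-\frac12$$ converges to a positive limit $\sigma^2>0$. Then, under the null hypothesis $H_0$, $$\frac{\log\tilde\Lambda_{n,1}-\tilde s_n}{\sqrt{p(n-q)}}\ \xrightarrow{\mathcal{D}}\ \mathcal{N}(0,\sigma^2),$$ where $$\tilde s_n=\sum_{j=1}^q\frac{n_j-1}{2}\Big\{\Big(n_j-\frac32\Big)\log\Big(\frac{n_j-2}{n_j-p-2}\Big)-p\log\Big(\frac{n_j-1}{n_j-p-2}\Big)\Big\}-\frac{n-q}{2}(n-q-p)\log\Big(\fr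ac{n-q}{n-q-p}\Big).$$
   Context: $\mathcal{N}(\mu,\Sigma)$ denotes the multivariate normal distribution, $|\cdot|$ the determinant, and $\xrightarrow{\mathcal{D}}$ weak convergence (convergence in distribution). With $\bar X_j=\frac1{n_j}\sum_{k=1}^{n_j}X_{jk}$ define the $p\times p$ matrices $$A_j=\sum_{k=1}^{n_j}(X_{jk}-\bar X_j)(X_{jk}-\bar X_j)^\top,\qquad A=\sum_{j=1}^qA_j .$$ The modified likelihood ratio statistic is $$\tilde\Lambda_{n,1}=\frac{\prod_{j=1}^q|A_j/(n_j-1)|^{\frac12(n_j-1)}}{|A/(n-q)|^{\frac12(n-q)}} .$$ Under the stated assumptions all expressions are (almost surely) well defined for all sufficiently large $n$, which is all that is needed for the asymptotic statement. *)

theory Defs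
  imports "HOL-Probability.Probability" "Jordan_Normal_Form.Determinant"
    "Jordan_Normal_Form.Gauss_Jordan_Elimination"
begin

no_notation inner (infix "\<bullet>" 70)

text \<open>
  A random vector in \<open>\<real>\<^sup>p\<close> takes values in the functions \<open>nat \<Rightarrow> real\<close> forming the
  product space \<open>\<Pi>\<^sub>M r\<in>{..<p}. lborel\<close> (so they are \<open>undefined\<close> outside \<open>{..<p}\<close>); deterministic
  vectors and all matrices are those of \<open>Jordan_Normal_Form\<close>, since the dimension \<open>p\<close> varies.
  Several constant and type names below also exist in \<open>HOL-Analysis\<close> and are therefore qualified.
\<close>

definition positive_definite :: "nat \<Rightarrow> real Matrix.mat \<Rightarrow> bool" where
  "positive_definite p S \<longleftrightarrow>
     S \<in> carrier_mat p p \<and> Matrix.transpose_mat S = S \<and>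
     (\<forall>v \<in> carrier_vec p. v \<noteq> 0\<^sub>v p \<longrightarrow> v \<bullet> (S *\<^sub>v v) > 0)"

definition mvn_density :: "nat \<Rightarrow> real Matrix.vec \<Rightarrow> real Matrix.mat \<Rightarrow> (nat \<Rightarrow> real) \<Rightarrow> real" where
  "mvn_density p \<mu> S x =
     (let d = Matrix.vec p x - \<mu>
      in exp (- (d \<bullet> (the (mat_inverse S) *\<^sub>v d)) / 2)
           / sqrt ((2 * pi) ^ p * Determinant.det S))"

definition mvn_distributed ::
  "'a measure \<Rightarrow> nat \<Rightarrow> ('a \<Rightarrow> nat \<Rightarrow> real) \<Rightarrow> real Matrix.vec \<Rightarrow> real Matrix.mat \<Rightarrow> bool" where
  "mvn_distributed M p X \<mu> S \<longleftrightarrow>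
     distributed M (\<Pi>\<^sub>M r\<in>{..<p}. lborel) X (\<lambda>x. ennreal (mvn_density p \<mu> S x))"

definition sample_mean :: "nat \<Rightarrow> (nat \<Rightarrow> nat \<Rightarrow> real) \<Rightarrow> nat \<Rightarrow> real" where
  "sample_mean m x r = (\<Sum>k=1..m. x k r) / real m"

text \<open>The scatter matrix \<open>\<Sum>\<^sub>k (x\<^sub>k - mean) (x\<^sub>k - mean)\<^sup>T\<close> of \<open>m\<close> observations, written entrywise.\<close>

definition scatter_mat :: "nat \<Rightarrow> nat \<Rightarrow> (nat \<Rightarrow> nat \<Rightarrow> real) \<Rightarrow> real Matrix.mat" where
  "scatter_mat p m x = Matrix.mat p p (\<lambda>(r, s).
     \<Sum>k=1..m. (x k r - sample_mean m x r) * (x k s - sample_mean m x s))"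

text \<open>Groups are numbered \<open>1..q\<close>, with sizes \<open>N j\<close>; \<open>x j k\<close> is the \<open>k\<close>-th observation in group \<open>j\<close>.\<close>

definition pooled_scatter_mat ::
  "nat \<Rightarrow> nat \<Rightarrow> (nat \<Rightarrow> nat) \<Rightarrow> (nat \<Rightarrow> nat \<Rightarrow> nat \<Rightarrow> real) \<Rightarrow> real Matrix.mat" where
  "pooled_scatter_mat p q N x = Matrix.mat p p (\<lambda>(r, s).
     \<Sum>j=1..q. scatter_mat p (N j) (x j) $$ (r, s))"

text \<open>
  The determinants are almost surely positive, and the denominators and logarithm arguments
  below are positive, once \<open>N j > p + 2\<close> for all \<open>j\<close> (and \<open>q \<ge> 1\<close>); otherwise the usual
  conventions for \<open>/\<close>, \<open>powr\<close> and \<open>ln\<close> give irrelevant values.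
\<close>

definition modified_LR ::
  "nat \<Rightarrow> nat \<Rightarrow> (nat \<Rightarrow> nat) \<Rightarrow> (nat \<Rightarrow> nat \<Rightarrow> nat \<Rightarrow> real) \<Rightarrow> real" where
  "modified_LR p q N x =
     (let n = (\<Sum>j=1..q. N j) in
      (\<Prod>j=1..q. Determinant.det ((1 / (real (N j) - 1)) \<cdot>\<^sub>m scatter_mat p (N j) (x j))
                  powr ((real (N j) - 1) / 2))
      / Determinant.det ((1 / (real n - real q)) \<cdot>\<^sub>m pooled_scatter_mat p q N x)
                  powr ((real n - real q) / 2))"

definition LR_variance :: "nat \<Rightarrow> nat \<Rightarrow> (nat \<Rightarrow> nat) \<Rightarrow> real" where
  "LR_variance p q N =
     (let n = (\<Sum>j=1..q. N j) in
      1/2 * (\<Sum>j=1..q. (real (N j) - 1)\<^sup>2 / (real p * (real n - real q))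
               * ln ((real (N j) - 1) / (real (N j) - real p - 1))) - 1/2)"

definition LR_centering :: "nat \<Rightarrow> nat \<Rightarrow> (nat \<Rightarrow> nat) \<Rightarrow> real" where
  "LR_centering p q N =
     (let n = (\<Sum>j=1..q. N j) in
      (\<Sum>j=1..q. (real (N j) - 1) / 2 *
         ((real (N j) - 3/2) * ln ((real (N j) - 2) / (real (N j) - real p - 2))
          - real p * ln ((real (N j) - 1) / (real (N j) - real p - 2))))
      - (real n - real q) / 2 * (real n - real q - real p)
          * ln ((real n - real q) / (real n - real q - real p)))"

end

theory Submission
  imports Defs "HOL-Real_Asymp.Real_Asymp"
begin

text \<open>
  Gaussian elimination on the rows of the data factors the determinants of the scatter matrices into
  pivots. A pivot is a squared distance of a Gaussian row to the span of its predecessors, hence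
  chi-square distributed and, in the spirit of Basu's theorem, independent of every statistic that is
  invariant under scaling the row and adding combinations of its predecessors. Under the null hypothesis the log-likelihood ratio
  is a weighted sum of logarithms of the within-group pivots minus such a sum for the pooled pivots;
  it is invariant, hence independent of the pooled pivots. Its characteristic function is
  therefore a quotient of products of characteristic functions of log-chi-square variables, that is,
  of values of the complex Gamma function. Second-order expansions of \<open>ln \<Gamma>\<close>, with bounds for the
  polygamma functions, show that the quotient converges to \<open>exp (- t\<^sup>2 \<sigma>\<^sup>2 / 2)\<close>, and Levy's
  continuity theorem concludes.
\<close>

section \<open>Affine substitutions in products of Lebesgue measure\<close>

text \<open>Dimension and sample size vary with n, so matrices are replaced by positive semidefinite
  forms on functions of the observation index. Degenerate forms are kept: their null spaces absorb
  group means and rows already eliminated. Completeness of a sufficient statistic, the usual input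
  to Basu's theorem, is replaced by the homogeneity of Lebesgue measure, one row at a time.

  The accuracy of the expansions is dictated by the scale w = sqrt (p (n - q)). A group with m
  degrees of freedom has weight m/2, and its mean log-determinant must be known up to O(p / m^2), so
  that all groups together err by O(q) = o(w); the unsymmetric shifts n_j - 3/2, n_j - 2 and n_j - p
  - 2 in the centering achieve this. The single pooled matrix may err by O(p), which is o(w) because
  p = o(n - q), so a plain Stirling term is enough there. The -1/2 in the variance is the limit of
  the pooled contribution. Passing to a quotient of characteristic functions is legitimate because
  the Gamma function has no zeros.\<close>

interpretation lborel_product: product_sigma_finite "\<lambda>_. lborel :: real measure" ..

text \<open>Fubini over one coordinate at a time makes the Jacobian of a diagonal map a product of
  one-dimensional factors. The factor stands beside the transformed integral, which keeps the
  equation free of division in the extended reals.\<close>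

lemma nn_integral_PiM_affine:
  fixes a c :: "'k \<Rightarrow> real" and F :: "('k \<Rightarrow> real) \<Rightarrow> ennreal"
  assumes "finite J" and "\<And>j. j \<in> J \<Longrightarrow> c j \<noteq> 0"
    and F: "F \<in> borel_measurable (PiM J (\<lambda>_. lborel))"
  shows "(\<Prod>j\<in>J. ennreal \<bar>c j\<bar>) * (\<integral>\<^sup>+z. F (\<lambda>j\<in>J. a j + c j * z j) \<partial>PiM J (\<lambda>_. lborel))
    = (\<integral>\<^sup>+z. F z \<partial>PiM J (\<lambda>_. lborel))"
  using assms
proof (induction J arbitrary: F rule: finite_induct)
  case empty
  then show ?case
    by (simp add: lborel_product.nn_integral_empty restrict_def space_PiM)
next
  case (insert i J)
  note [measurable] = insert.prems(2)
  let ?T = "\<lambda>z. \<lambda>j\<in>J. a j + c j * z j"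
  let ?T' = "\<lambda>z. \<lambda>j\<in>insert i J. a j + c j * z j"
  have T'[measurable]: "?T' \<in> PiM (insert i J) (\<lambda>_. lborel) \<rightarrow>\<^sub>M PiM (insert i J) (\<lambda>_. lborel)"
    by (intro measurable_restrict) measurable
  have T[measurable]: "?T \<in> PiM J (\<lambda>_. lborel) \<rightarrow>\<^sub>M PiM J (\<lambda>_. lborel)"
    by (intro measurable_restrict) measurable
  have upd: "?T' (z(i := t)) = (?T z)(i := a i + c i * t)" for z t
    using insert.hyps by (auto simp: fun_eq_iff)
  have m: "(\<lambda>t. F (y(i := t))) \<in> borel_measurable borel" if "y \<in> space (PiM J (\<lambda>_. lborel))" for y
    using measurable_comp[OF measurable_component_update[OF that insert.hyps(2)] insert.prems(2)]
    by (simp add: comp_def)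
  have F'[measurable]: "(\<lambda>z. F (?T' z)) \<in> borel_measurable (PiM (insert i J) (\<lambda>_. lborel))"
    by measurable
  have m2: "(\<lambda>z. \<integral>\<^sup>+t. F (?T' (z(i := t))) \<partial>lborel) \<in> borel_measurable (PiM J (\<lambda>_. lborel))"
    by measurable
  have m3: "(\<lambda>z. \<integral>\<^sup>+t. F (z(i := t)) \<partial>lborel) \<in> borel_measurable (PiM J (\<lambda>_. lborel))"
    by measurable
  have "(\<Prod>j\<in>insert i J. ennreal \<bar>c j\<bar>) * (\<integral>\<^sup>+z. F (?T' z) \<partial>PiM (insert i J) (\<lambda>_. lborel))
      = (\<Prod>j\<in>J. ennreal \<bar>c j\<bar>) * (ennreal \<bar>c i\<bar> *
        (\<integral>\<^sup>+z. (\<integral>\<^sup>+t. F (?T' (z(i := t))) \<partial>lborel) \<partial>PiM J (\<lambda>_. lborel)))"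
    unfolding prod.insert[OF insert.hyps]
    by (subst lborel_product.product_nn_integral_insert[OF insert.hyps F']) (simp only: ac_simps)
  also have "ennreal \<bar>c i\<bar> * (\<integral>\<^sup>+z. (\<integral>\<^sup>+t. F (?T' (z(i := t))) \<partial>lborel) \<partial>PiM J (\<lambda>_. lborel))
      = (\<integral>\<^sup>+z. ennreal \<bar>c i\<bar> * (\<integral>\<^sup>+t. F (?T' (z(i := t))) \<partial>lborel) \<partial>PiM J (\<lambda>_. lborel))"
    by (subst nn_integral_cmult[OF m2]) simp
  also have "(\<integral>\<^sup>+z. ennreal \<bar>c i\<bar> * (\<integral>\<^sup>+t. F (?T' (z(i := t))) \<partial>lborel) \<partial>PiM J (\<lambda>_. lborel))
      = (\<integral>\<^sup>+z. ennreal \<bar>c i\<bar> * (\<integral>\<^sup>+t. F ((?T z)(i := a i + c i * t)) \<partial>lborel) \<partial>PiM J (\<lambda>_. lborel))"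
    unfolding upd ..
  also have "(\<integral>\<^sup>+z. ennreal \<bar>c i\<bar> * (\<integral>\<^sup>+t. F ((?T z)(i := a i + c i * t)) \<partial>lborel) \<partial>PiM J (\<lambda>_. lborel))
      = (\<integral>\<^sup>+z. (\<integral>\<^sup>+t. F ((?T z)(i := t)) \<partial>lborel) \<partial>PiM J (\<lambda>_. lborel))"
    using insert.prems(1)
    by (intro nn_integral_cong) (subst nn_integral_real_affine[where c="c i" and t="a i", OF m],
        auto simp: space_PiM)
  also have "(\<Prod>j\<in>J. ennreal \<bar>c j\<bar>) * \<dots> = (\<integral>\<^sup>+z. (\<integral>\<^sup>+t. F (z(i := t)) \<partial>lborel) \<partial>PiM J (\<lambda>_. lborel))"
    using insert.prems(1) by (intro insert.IH m3) auto
  also have "\<dots> = (\<integral>\<^sup>+z. F z \<partial>PiM (insert i J) (\<lambda>_. lborel))"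
    using insert.hyps by (subst lborel_product.product_nn_integral_insert) auto
  finally show ?case .
qed

lemma nn_integral_PiM_translate:
  fixes a :: "'k \<Rightarrow> real" and F :: "('k \<Rightarrow> real) \<Rightarrow> ennreal"
  assumes "finite J" and "F \<in> borel_measurable (PiM J (\<lambda>_. lborel))"
  shows "(\<integral>\<^sup>+z. F (\<lambda>j\<in>J. z j + a j) \<partial>PiM J (\<lambda>_. lborel)) = (\<integral>\<^sup>+z. F z \<partial>PiM J (\<lambda>_. lborel))"
  using nn_integral_PiM_affine[of J "\<lambda>_. 1" F a] assms by (simp add: add.commute)

lemma nn_integral_PiM_scale:
  fixes c :: real and F :: "('k \<Rightarrow> real) \<Rightarrow> ennreal"
  assumes "finite J" and "F \<in> borel_measurable (PiM J (\<lambda>_. lborel))" and "c > 0"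
  shows "ennreal (c ^ card J) * (\<integral>\<^sup>+z. F (\<lambda>j\<in>J. c * z j) \<partial>PiM J (\<lambda>_. lborel))
    = (\<integral>\<^sup>+z. F z \<partial>PiM J (\<lambda>_. lborel))"
  using nn_integral_PiM_affine[of J "\<lambda>_. c" F "\<lambda>_. 0"] assms by (simp add: ennreal_power)

text \<open>With the earlier coordinates fixed, the last one undergoes a one-dimensional affine map,
  so only the diagonal enters the Jacobian. The whitening map has this shape. Each
  \<open>s r\<close> receives a restricted argument because its measurability is stated on the
  product over \<open>{..<r}\<close>.\<close>

lemma nn_integral_PiM_triangular:
  fixes b :: "nat \<Rightarrow> real" and s :: "nat \<Rightarrow> (nat \<Rightarrow> real) \<Rightarrow> real" and F :: "(nat \<Rightarrow> real) \<Rightarrow> ennreal"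
  assumes "\<And>r. r < p \<Longrightarrow> b r \<noteq> 0"
    and "\<And>r. r < p \<Longrightarrow> s r \<in> borel_measurable (PiM {..<r} (\<lambda>_. lborel))"
    and F: "F \<in> borel_measurable (PiM {..<p} (\<lambda>_. lborel))"
  shows "(\<Prod>r<p. ennreal \<bar>b r\<bar>) *
      (\<integral>\<^sup>+z. F (\<lambda>r\<in>{..<p}. s r (restrict z {..<r}) + b r * z r) \<partial>PiM {..<p} (\<lambda>_. lborel))
    = (\<integral>\<^sup>+z. F z \<partial>PiM {..<p} (\<lambda>_. lborel))"
  using assms
proof (induction p arbitrary: F)
  case 0
  then show ?case
    by (simp add: lborel_product.nn_integral_empty restrict_def space_PiM)
next
  case (Suc p)
  note [measurable] = Suc.prems(3)
  let ?T = "\<lambda>z. \<lambda>r\<in>{..<p}. s r (restrict z {..<r}) + b r * z r"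
  let ?T' = "\<lambda>z. \<lambda>r\<in>{..<Suc p}. s r (restrict z {..<r}) + b r * z r"
  have res: "(\<lambda>z. s r (restrict z {..<r})) \<in> borel_measurable (PiM {..<n} (\<lambda>_. lborel))"
    if "r < Suc p" "r \<le> n" for r n
    using that by (intro measurable_compose[OF _ Suc.prems(2)[OF that(1)]] measurable_restrict_subset) auto
  have T'[measurable]: "?T' \<in> PiM {..<Suc p} (\<lambda>_. lborel) \<rightarrow>\<^sub>M PiM {..<Suc p} (\<lambda>_. lborel)"
    by (intro measurable_restrict) (auto intro!: borel_measurable_add res)
  have T[measurable]: "?T \<in> PiM {..<p} (\<lambda>_. lborel) \<rightarrow>\<^sub>M PiM {..<p} (\<lambda>_. lborel)"
    by (intro measurable_restrict) (auto intro!: borel_measurable_add res)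
  have ins: "{..<Suc p} = insert p {..<p}" by auto
  \<comment> \<open>The shifts of all coordinates up to \<open>p\<close> look strictly below their
    own index, so an update at \<open>p\<close> is invisible to them.\<close>
  have upd: "?T' (z(p := t)) = (?T z)(p := s p (restrict z {..<p}) + b p * t)" for z t
  proof -
    have "restrict (z(p := t)) {..<r} = restrict z {..<r}" if "r \<le> p" for r
      using that by (auto simp: fun_eq_iff restrict_def)
    then show ?thesis by (auto simp: fun_eq_iff less_Suc_eq)
  qed
  have m: "(\<lambda>t. F (y(p := t))) \<in> borel_measurable borel" if "y \<in> space (PiM {..<p} (\<lambda>_. lborel))" for y
    using measurable_comp[OF measurable_component_update[OF that] Suc.prems(3)[unfolded ins]]
    by (simp add: comp_def)
  have F'[measurable]: "(\<lambda>z. F (?T' z)) \<in> borel_measurable (PiM (insert p {..<p}) (\<lambda>_. lborel))"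
    unfolding ins[symmetric] by measurable
  have F''[measurable]: "F \<in> borel_measurable (PiM (insert p {..<p}) (\<lambda>_. lborel))"
    unfolding ins[symmetric] by measurable
  have m2: "(\<lambda>z. \<integral>\<^sup>+t. F (?T' (z(p := t))) \<partial>lborel) \<in> borel_measurable (PiM {..<p} (\<lambda>_. lborel))"
    by measurable
  have m3: "(\<lambda>z. \<integral>\<^sup>+t. F (z(p := t)) \<partial>lborel) \<in> borel_measurable (PiM {..<p} (\<lambda>_. lborel))"
    by measurable
  have "(\<Prod>r<Suc p. ennreal \<bar>b r\<bar>) * (\<integral>\<^sup>+z. F (?T' z) \<partial>PiM {..<Suc p} (\<lambda>_. lborel))
      = (\<Prod>r<p. ennreal \<bar>b r\<bar>) * (ennreal \<bar>b p\<bar> *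
        (\<integral>\<^sup>+z. (\<integral>\<^sup>+t. F (?T' (z(p := t))) \<partial>lborel) \<partial>PiM {..<p} (\<lambda>_. lborel)))"
    unfolding ins
    by (subst lborel_product.product_nn_integral_insert, simp, simp, rule F'[unfolded ins])
       (simp add: ac_simps)
  also have "ennreal \<bar>b p\<bar> * (\<integral>\<^sup>+z. (\<integral>\<^sup>+t. F (?T' (z(p := t))) \<partial>lborel) \<partial>PiM {..<p} (\<lambda>_. lborel))
      = (\<integral>\<^sup>+z. ennreal \<bar>b p\<bar> * (\<integral>\<^sup>+t. F (?T' (z(p := t))) \<partial>lborel) \<partial>PiM {..<p} (\<lambda>_. lborel))"
    by (subst nn_integral_cmult[OF m2]) simp
  also have "\<dots> = (\<integral>\<^sup>+z. (\<integral>\<^sup>+t. F ((?T z)(p := t)) \<partial>lborel) \<partial>PiM {..<p} (\<lambda>_. lborel))"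
    unfolding upd using Suc.prems(1)
    by (intro nn_integral_cong)
       (subst nn_integral_real_affine[where c="b p", OF m], auto simp: space_PiM)
  also have "(\<Prod>r<p. ennreal \<bar>b r\<bar>) * \<dots> = (\<integral>\<^sup>+z. (\<integral>\<^sup>+t. F (z(p := t)) \<partial>lborel) \<partial>PiM {..<p} (\<lambda>_. lborel))"
    using Suc.prems(1,2) by (intro Suc.IH m3) auto
  also have "\<dots> = (\<integral>\<^sup>+z. F z \<partial>PiM {..<Suc p} (\<lambda>_. lborel))"
    unfolding ins by (subst lborel_product.product_nn_integral_insert) auto
  finally show ?case .
qed

section \<open>Semidefinite forms and Gaussian measures\<close>

text \<open>Vectors are total functions, so no extensionality condition disturbs the linear algebra;
  \<open>local\<close> says that only coordinates in \<open>K\<close> count. Degeneracy is wanted: a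
  within-group form kills group means, and an eliminated row becomes a null vector.\<close>

locale psd_form =
  fixes K :: "'k set" and \<beta> :: "('k \<Rightarrow> real) \<Rightarrow> ('k \<Rightarrow> real) \<Rightarrow> real"
  assumes finite_K: "finite K"
    and sym: "\<beta> u v = \<beta> v u"
    and lin: "\<beta> (\<lambda>k. c * u k + v k) w = c * \<beta> u w + \<beta> v w"
    and nonneg: "\<beta> u u \<ge> 0"
    and local: "(\<And>k. k \<in> K \<Longrightarrow> u k = v k) \<Longrightarrow> \<beta> u w = \<beta> v w"
begin

lemma zero_left: "\<beta> (\<lambda>k. 0) w = 0"
  using lin[of 1 "\<lambda>k. 0" "\<lambda>k. 0" w] by simp

lemma scale_left: "\<beta> (\<lambda>k. c * u k) w = c * \<beta> u w"
  using lin[of c u "\<lambda>k. 0" w] zero_left by simp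

lemma diff_left: "\<beta> (\<lambda>k. u k - v k) w = \<beta> u w - \<beta> v w"
  using lin[of "-1" v u w] by simp

lemma lin_right: "\<beta> w (\<lambda>k. c * u k + v k) = c * \<beta> w u + \<beta> w v"
  using lin sym by simp

lemma scale_right: "\<beta> w (\<lambda>k. c * u k) = c * \<beta> w u"
  using scale_left sym by simp

lemma diff_right: "\<beta> w (\<lambda>k. u k - v k) = \<beta> w u - \<beta> w v"
  using diff_left sym by simp

lemma local_right: "(\<And>k. k \<in> K \<Longrightarrow> u k = v k) \<Longrightarrow> \<beta> w u = \<beta> w v"
  using local sym by metis

lemma local_both: "(\<And>k. k \<in> K \<Longrightarrow> u k = v k) \<Longrightarrow> \<beta> u u = \<beta> v v"
  using local local_right by metis

text \<open>Degenerate Cauchy-Schwarz: along \<open>t * w + v\<close> the form is affine in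
  \<open>t\<close>, and if it were not constant, the chosen \<open>t\<close> would give it the value
  -1.\<close>

lemma null_right:
  assumes "\<beta> w w = 0"
  shows "\<beta> v w = 0"
proof (rule ccontr)
  assume b: "\<beta> v w \<noteq> 0"
  let ?t = "- (\<beta> v v + 1) / (2 * \<beta> v w)"
  have "0 \<le> \<beta> (\<lambda>k. ?t * w k + v k) (\<lambda>k. ?t * w k + v k)" by (rule nonneg)
  also have "\<dots> = \<beta> v v + 2 * ?t * \<beta> v w"
    unfolding lin lin_right assms sym[of w v] by simp
  also have "\<dots> = -1" using b by (simp add: field_simps)
  finally show False by simp
qed

lemma null_left: "\<beta> w w = 0 \<Longrightarrow> \<beta> w v = 0"
  using null_right sym by metis

lemma null_add: "\<beta> u u = 0 \<Longrightarrow> \<beta> v v = 0 \<Longrightarrow> \<beta> (\<lambda>k. c * u k + v k) (\<lambda>k. c * u k + v k) = 0"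
  by (simp add: lin lin_right null_left)

lemma expand: "\<beta> u w = (\<Sum>k\<in>K. u k * \<beta> (\<lambda>i. if i = k then 1 else 0) w)"
proof -
  have "\<beta> (\<lambda>i. if i \<in> A then u i else 0) w = (\<Sum>k\<in>A. u k * \<beta> (\<lambda>i. if i = k then 1 else 0) w)"
    if "finite A" for A
    using that
  proof (induction A)
    case empty then show ?case using zero_left by simp
  next
    case (insert a A)
    have "(\<lambda>i. if i \<in> insert a A then u i else 0)
        = (\<lambda>i. u a * (if i = a then 1 else 0) + (if i \<in> A then u i else 0))"
      using insert.hyps by (auto simp: fun_eq_iff)
    then show ?case using insert by (simp add: lin)
  qed
  moreover have "\<beta> u w = \<beta> (\<lambda>i. if i \<in> K then u i else 0) w"
    by (rule local) simp
  ultimately show ?thesis using finite_K by simp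
qed

text \<open>The form as a finite polynomial in coordinates, from which its measurability
  follows.\<close>

lemma expand_both: "\<beta> u v = (\<Sum>k\<in>K. \<Sum>l\<in>K. u k * v l *
    \<beta> (\<lambda>i. if i = k then 1 else 0) (\<lambda>i. if i = l then 1 else 0))"
  by (subst expand, rule sum.cong[OF refl], subst sym, subst expand)
     (simp add: sum_distrib_left sym mult.assoc)

lemma borel_measurable_form:
  assumes "\<And>k. k \<in> K \<Longrightarrow> (\<lambda>x. u x k) \<in> borel_measurable M"
    and "\<And>k. k \<in> K \<Longrightarrow> (\<lambda>x. v x k) \<in> borel_measurable M"
  shows "(\<lambda>x. \<beta> (u x) (v x)) \<in> borel_measurable M"
  by (subst expand_both) (intro borel_measurable_sum borel_measurable_times assms borel_measurable_const)

end

section \<open>Schur complements\<close>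

definition schur :: "(('k \<Rightarrow> real) \<Rightarrow> ('k \<Rightarrow> real) \<Rightarrow> real) \<Rightarrow> ('k \<Rightarrow> real) \<Rightarrow> ('k \<Rightarrow> real) \<Rightarrow> ('k \<Rightarrow> real) \<Rightarrow> real"
  where "schur \<beta> w u v = \<beta> u v - \<beta> u w * \<beta> v w / \<beta> w w"

text \<open>For a null vector \<open>w\<close> division by zero makes the correction vanish:
  \<open>schur \<beta> w\<close> is then \<open>\<beta>\<close> itself, for which \<open>w\<close>
  is null already. This makes elimination a total operation.\<close>

lemma (in psd_form) schur_self: "schur \<beta> w w v = 0"
  using null_left[of w v] sym[of v w] by (cases "\<beta> w w = 0") (auto simp: schur_def)

lemma (in psd_form) schur_complete_square:
  assumes "\<beta> w w \<noteq> 0"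
  shows "\<beta> (\<lambda>k. t * w k + u k) (\<lambda>k. t * w k + u k)
    = schur \<beta> w u u + \<beta> w w * (t + \<beta> u w / \<beta> w w)\<^sup>2"
  using assms unfolding schur_def lin lin_right sym[of w u]
  by (simp add: power2_eq_square field_simps)

lemma (in psd_form) schur_le: "schur \<beta> w u u \<le> \<beta> u u"
  using nonneg[of w] by (auto simp: schur_def)

text \<open>Nonnegativity is read off at the minimising \<open>t\<close> of the completed square,
  that is, from the residual of \<open>u\<close> after projection along \<open>w\<close>.\<close>

lemma (in psd_form) psd_form_schur: "psd_form K (schur \<beta> w)"
proof
  show "finite K" by (rule finite_K)
  show "schur \<beta> w u v = schur \<beta> w v u" for u v
    using sym[of u v] by (simp add: schur_def)
  show "schur \<beta> w (\<lambda>k. c * u k + v k) x = c * schur \<beta> w u x + schur \<beta> w v x" for c u v x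
    unfolding schur_def lin by (simp add: algebra_simps add_divide_distrib)
  show "schur \<beta> w u u \<ge> 0" for u
  proof (cases "\<beta> w w = 0")
    case True
    then show ?thesis using nonneg[of u] by (simp add: schur_def)
  next
    case False
    have "0 \<le> \<beta> (\<lambda>k. - (\<beta> u w / \<beta> w w) * w k + u k) (\<lambda>k. - (\<beta> u w / \<beta> w w) * w k + u k)"
      by (rule nonneg)
    then show ?thesis unfolding schur_complete_square[OF False] by simp
  qed
  show "schur \<beta> w u x = schur \<beta> w v x" if "\<And>k. k \<in> K \<Longrightarrow> u k = v k" for u v x
    using local[of u v, OF that] by (simp add: schur_def)
qed

lemma (in psd_form) schur_null: "\<beta> u u = 0 \<Longrightarrow> schur \<beta> w u u = 0"
  using psd_form.nonneg[OF psd_form_schur, of w u] schur_le[of w u] by simp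

section \<open>Gaussian measures modulo the null space of a form\<close>

definition ext0 :: "'k set \<Rightarrow> ('k \<Rightarrow> real) \<Rightarrow> 'k \<Rightarrow> real" where
  "ext0 J z = (\<lambda>k. if k \<in> J then z k else 0)"

text \<open>\<open>F\<close> factors through the quotient by the null space of
  \<open>\<beta>\<close>; the quotient itself is never formed.\<close>

definition null_inv :: "(('k \<Rightarrow> real) \<Rightarrow> ('k \<Rightarrow> real) \<Rightarrow> real) \<Rightarrow> (('k \<Rightarrow> real) \<Rightarrow> 'b) \<Rightarrow> bool" where
  "null_inv \<beta> F \<longleftrightarrow> (\<forall>u v. \<beta> (\<lambda>k. u k - v k) (\<lambda>k. u k - v k) = 0 \<longrightarrow> F u = F v)"

text \<open>
  The form \<open>\<beta>\<close> has rank \<open>card J\<close>, the coordinate subspace of \<open>J\<close> is a complement of its null space,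
  and the image of \<open>\<gamma>\<close> modulo that null space has a Lebesgue density proportional to
  \<open>exp (- \<beta> z z / 2)\<close> on \<open>J\<close>.
\<close>

definition gauss_rep ::
  "'k set \<Rightarrow> ('k \<Rightarrow> real) measure \<Rightarrow> (('k \<Rightarrow> real) \<Rightarrow> ('k \<Rightarrow> real) \<Rightarrow> real) \<Rightarrow> 'k set \<Rightarrow> bool" where
  "gauss_rep K \<gamma> \<beta> J \<longleftrightarrow> J \<subseteq> K \<and>
    (\<forall>u. \<exists>z. (\<forall>k. k \<notin> J \<longrightarrow> z k = 0) \<and> \<beta> (\<lambda>k. u k - z k) (\<lambda>k. u k - z k) = 0) \<and>
    (\<exists>c>0. \<forall>F\<in>borel_measurable (PiM K (\<lambda>_. lborel)). null_inv \<beta> F \<longrightarrow>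
      (\<integral>\<^sup>+u. F u \<partial>\<gamma>) = ennreal c *
        (\<integral>\<^sup>+z. F (ext0 J z) * ennreal (exp (- \<beta> (ext0 J z) (ext0 J z) / 2)) \<partial>PiM J (\<lambda>_. lborel)))"

lemma gauss_repI:
  assumes "J \<subseteq> K"
    and "\<And>u. \<exists>z. (\<forall>k. k \<notin> J \<longrightarrow> z k = 0) \<and> \<beta> (\<lambda>k. u k - z k) (\<lambda>k. u k - z k) = 0"
    and "c > 0"
    and "\<And>F. F \<in> borel_measurable (PiM K (\<lambda>_. lborel)) \<Longrightarrow> null_inv \<beta> F \<Longrightarrow> (\<integral>\<^sup>+u. F u \<partial>\<gamma>) = ennreal c *
        (\<integral>\<^sup>+z. F (ext0 J z) * ennreal (exp (- \<beta> (ext0 J z) (ext0 J z) / 2)) \<partial>PiM J (\<lambda>_. lborel))"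
  shows "gauss_rep K \<gamma> \<beta> J"
  unfolding gauss_rep_def
proof (intro conjI)
  show "\<forall>u. \<exists>z. (\<forall>k. k \<notin> J \<longrightarrow> z k = 0) \<and> \<beta> (\<lambda>k. u k - z k) (\<lambda>k. u k - z k) = 0"
    using assms(2) by (rule allI)
qed (use assms(1,3,4) in \<open>auto intro!: exI[of _ c]\<close>)

lemma nn_integral_gauss:
  assumes "A > 0"
  shows "(\<integral>\<^sup>+t. ennreal (exp (- (A * (t + b)\<^sup>2) / 2)) \<partial>lborel) = ennreal (sqrt (2 * pi / A))"
proof -
  have s: "1 / sqrt A > 0" using assms by simp
  have "(\<integral>\<^sup>+t. ennreal (exp (- (A * (t + b)\<^sup>2) / 2)) \<partial>lborel)
      = (\<integral>\<^sup>+t. ennreal (sqrt (2 * pi / A)) * ennreal (normal_density (-b) (1 / sqrt A) t) \<partial>lborel)"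
    using assms
    by (intro nn_integral_cong)
       (auto simp: normal_density_def ennreal_mult[symmetric] power_divide real_sqrt_divide field_simps)
  also have "\<dots> = ennreal (sqrt (2 * pi / A)) * (\<integral>\<^sup>+t. ennreal (normal_density (-b) (1 / sqrt A) t) \<partial>lborel)"
    by (intro nn_integral_cmult) auto
  also have "(\<integral>\<^sup>+t. ennreal (normal_density (-b) (1 / sqrt A) t) \<partial>lborel) = 1"
    using s by (subst nn_integral_eq_integral) (auto simp: integral_normal_density)
  finally show ?thesis by simp
qed

lemma measurable_ext0_component [measurable]:
  "(\<lambda>z. ext0 J z k) \<in> borel_measurable (PiM J (\<lambda>_. lborel))"
  by (cases "k \<in> J") (simp_all add: ext0_def)

text \<open>\<open>ext0 J z\<close> is zero rather than \<open>undefined\<close> outside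
  \<open>J\<close>, so in general it is no point of the product space over \<open>K\<close>.
  Invariance permits replacing it by its restriction to \<open>K\<close>, which differs only where
  the form is blind.\<close>

lemma measurable_ext0:
  assumes "null_inv \<beta> F" and "psd_form K \<beta>" and "J \<subseteq> K"
    and F: "F \<in> PiM K (\<lambda>_. lborel) \<rightarrow>\<^sub>M N"
  shows "(\<lambda>z. F (ext0 J z)) \<in> PiM J (\<lambda>_. lborel) \<rightarrow>\<^sub>M N"
proof -
  interpret psd_form K \<beta> by fact
  have "F (ext0 J z) = F (restrict (ext0 J z) K)" for z
  proof -
    have "\<beta> (\<lambda>k. ext0 J z k - restrict (ext0 J z) K k) (\<lambda>k. ext0 J z k - restrict (ext0 J z) K k)
        = \<beta> (\<lambda>k. 0) (\<lambda>k. 0)"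
      by (rule local_both) simp
    then show ?thesis using assms(1) zero_left by (simp add: null_inv_def)
  qed
  then have eq: "(\<lambda>z. F (ext0 J z)) = (\<lambda>z. F (restrict (ext0 J z) K))" by (rule ext)
  have "(\<lambda>z. restrict (ext0 J z) K) \<in> PiM J (\<lambda>_. lborel) \<rightarrow>\<^sub>M PiM K (\<lambda>_. lborel)"
    by (intro measurable_restrict) simp
  then show ?thesis
    unfolding eq by (rule measurable_compose[OF _ F])
qed

lemma null_inv_cong: "null_inv \<beta> F \<Longrightarrow> \<beta> (\<lambda>k. u k - v k) (\<lambda>k. u k - v k) = 0 \<Longrightarrow> F u = F v"
  by (simp add: null_inv_def)

text \<open>Integrating out the direction \<open>w\<close>: a shear in a coordinate on which \<open>w\<close> does not vanish.\<close>

lemma gauss_rep_schur: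
  assumes psd: "psd_form K \<beta>" and rep: "gauss_rep K \<gamma> \<beta> J" and w: "\<beta> w w > 0"
  obtains i where "i \<in> J" "gauss_rep K \<gamma> (schur \<beta> w) (J - {i})"
proof -
  interpret psd_form K \<beta> by fact
  have JK: "J \<subseteq> K" using rep unfolding gauss_rep_def by (rule conjunct1)
  have dec: "\<exists>z. (\<forall>k. k \<notin> J \<longrightarrow> z k = 0) \<and> \<beta> (\<lambda>k. u k - z k) (\<lambda>k. u k - z k) = 0" for u
    using rep[unfolded gauss_rep_def, THEN conjunct2, THEN conjunct1] by (rule spec)
  from rep obtain c where c: "c > 0" and rep': "\<And>F. F \<in> borel_measurable (PiM K (\<lambda>_. lborel)) \<Longrightarrow>
      null_inv \<beta> F \<Longrightarrow> (\<integral>\<^sup>+u. F u \<partial>\<gamma>) = ennreal c *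
        (\<integral>\<^sup>+z. F (ext0 J z) * ennreal (exp (- \<beta> (ext0 J z) (ext0 J z) / 2)) \<partial>PiM J (\<lambda>_. lborel))"
    using rep[unfolded gauss_rep_def, THEN conjunct2, THEN conjunct2] by blast
  \<comment> \<open>\<open>a\<close> is the representative of \<open>w\<close> supported on
    \<open>J\<close>. It has the same Schur complement, and since its form value is positive, some
    coordinate \<open>i\<close> of it is nonzero; that coordinate is given up.\<close>
  from dec[of w] obtain a where a0: "\<And>k. k \<notin> J \<Longrightarrow> a k = 0"
    and a: "\<beta> (\<lambda>k. w k - a k) (\<lambda>k. w k - a k) = 0" by blast
  have wa: "\<beta> v w = \<beta> v a" for v
    using null_right[OF a, of v] by (simp add: diff_right)
  have waa: "\<beta> w w = \<beta> a a" using wa[of w] wa[of a] sym[of a w] by simp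
  have aa: "\<beta> a a > 0" using w waa by simp
  have sch: "schur \<beta> w = schur \<beta> a"
    by (simp add: schur_def fun_eq_iff wa waa[symmetric])
  obtain i where i: "i \<in> J" "a i \<noteq> 0"
  proof (rule ccontr)
    assume "\<not> thesis"
    with that a0 have "a k = 0" for k by blast
    then have "a = (\<lambda>k. 0)" by auto
    then show False using aa zero_left by simp
  qed
  let ?J = "J - {i}" and ?b = "schur \<beta> a"
  have finJ: "finite ?J" using finite_subset[OF JK finite_K] by simp
  interpret S: psd_form K ?b by (rule psd_form_schur)
  have J: "J = insert i ?J" and iJ: "i \<notin> ?J" using i by auto
  have dec': "\<exists>z. (\<forall>k. k \<notin> ?J \<longrightarrow> z k = 0) \<and> ?b (\<lambda>k. u k - z k) (\<lambda>k. u k - z k) = 0" for u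
  proof -
    from dec[of u] obtain z where z0: "\<And>k. k \<notin> J \<Longrightarrow> z k = 0"
      and z: "\<beta> (\<lambda>k. u k - z k) (\<lambda>k. u k - z k) = 0" by blast
    \<comment> \<open>Subtracting the multiple of \<open>a\<close> that clears coordinate
      \<open>i\<close> changes \<open>z\<close> only by a null vector of the Schur
      complement.\<close>
    let ?z = "\<lambda>k. z k - z i / a i * a k"
    have eq: "(\<lambda>k. u k - ?z k) = (\<lambda>k. z i / a i * a k + (u k - z k))" by auto
    have "?b (\<lambda>k. u k - ?z k) (\<lambda>k. u k - ?z k) = 0"
      unfolding eq by (rule S.null_add[OF schur_self schur_null[OF z]])
    moreover have "\<forall>k. k \<notin> ?J \<longrightarrow> ?z k = 0"
      using i z0 a0 by auto
    ultimately show ?thesis by (intro exI[of _ ?z] conjI)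
  qed
  \<comment> \<open>The Gaussian integral along \<open>a\<close>, with the factor
    \<open>\<bar>a i\<bar>\<close> from passing to the parameter \<open>t / a i\<close>.\<close>
  let ?C = "\<bar>a i\<bar> * sqrt (2 * pi / \<beta> a a)"
  have C: "?C > 0" using i aa by simp
  have int: "(\<integral>\<^sup>+u. F u \<partial>\<gamma>) = ennreal (c * ?C) *
        (\<integral>\<^sup>+z. F (ext0 ?J z) * ennreal (exp (- ?b (ext0 ?J z) (ext0 ?J z) / 2)) \<partial>PiM ?J (\<lambda>_. lborel))"
    if F[measurable]: "F \<in> borel_measurable (PiM K (\<lambda>_. lborel))" and inv': "null_inv ?b F" for F
  proof -
    have inv: "null_inv \<beta> F" using inv' schur_null by (auto simp: null_inv_def)
    have Fe[measurable]: "(\<lambda>z. F (ext0 J z)) \<in> borel_measurable (PiM J (\<lambda>_. lborel))"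
      by (rule measurable_ext0[OF inv psd JK F])
    have Fe'[measurable]: "(\<lambda>z. F (ext0 ?J z)) \<in> borel_measurable (PiM ?J (\<lambda>_. lborel))"
      by (rule measurable_ext0[OF inv psd _ F]) (use JK in auto)
    let ?G = "\<lambda>z. F (ext0 J z) * ennreal (exp (- \<beta> (ext0 J z) (ext0 J z) / 2))"
    have be: "(\<lambda>z. \<beta> (ext0 A z) (ext0 A z)) \<in> borel_measurable (PiM A (\<lambda>_. lborel))"
      if "A \<subseteq> K" for A
      by (rule borel_measurable_form) (rule measurable_ext0_component)+
    have be'[measurable]: "(\<lambda>z. ?b (ext0 ?J z) (ext0 ?J z)) \<in> borel_measurable (PiM ?J (\<lambda>_. lborel))"
      by (rule S.borel_measurable_form) (rule measurable_ext0_component)+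
    have bw[measurable]: "(\<lambda>z. \<beta> (ext0 ?J z) a) \<in> borel_measurable (PiM ?J (\<lambda>_. lborel))"
      by (rule borel_measurable_form) (rule measurable_ext0_component borel_measurable_const)+
    have G: "?G \<in> borel_measurable (PiM J (\<lambda>_. lborel))"
      using be[OF JK] by measurable
    have G'[measurable]: "?G \<in> borel_measurable (PiM (insert i ?J) (\<lambda>_. lborel))"
      using G unfolding J[symmetric] .
    \<comment> \<open>After the shear the argument is \<open>t / a i\<close> times \<open>a\<close>
      plus a vector supported off \<open>i\<close>. \<open>F\<close> ignores the first summand, and
      the form splits into the Schur complement and a square in \<open>t\<close>.\<close>
    have sh: "ext0 J ((\<lambda>k\<in>?J. z k + t / a i * a k)(i := t)) = (\<lambda>k. t / a i * a k + ext0 ?J z k)" for z t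
      using i a0 by (auto simp: ext0_def fun_eq_iff)
    have val: "?G ((\<lambda>k\<in>?J. z k + t / a i * a k)(i := t))
        = F (ext0 ?J z) * ennreal (exp (- ?b (ext0 ?J z) (ext0 ?J z) / 2)) *
          ennreal (exp (- (\<beta> a a * (t / a i + \<beta> (ext0 ?J z) a / \<beta> a a)\<^sup>2) / 2))" for z t
    proof -
      have "F (\<lambda>k. t / a i * a k + ext0 ?J z k) = F (ext0 ?J z)"
        by (rule null_inv_cong[OF inv']) (simp only: add_diff_cancel_right' S.scale_left schur_self mult_zero_right)
      then show ?thesis
        unfolding sh schur_complete_square[OF less_imp_neq[OF aa, symmetric]]
        by (simp add: mult.assoc ennreal_mult[symmetric] exp_add[symmetric] add_divide_distrib diff_divide_distrib)
    qed
    have "(\<integral>\<^sup>+z. ?G z \<partial>PiM J (\<lambda>_. lborel))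
        = (\<integral>\<^sup>+t. (\<integral>\<^sup>+z. ?G (z(i := t)) \<partial>PiM ?J (\<lambda>_. lborel)) \<partial>lborel)"
      by (subst J, subst lborel_product.product_nn_integral_insert_rev[OF finJ iJ G']) simp
    also have "\<dots> = (\<integral>\<^sup>+t. (\<integral>\<^sup>+z. ?G ((\<lambda>k\<in>?J. z k + t / a i * a k)(i := t)) \<partial>PiM ?J (\<lambda>_. lborel)) \<partial>lborel)"
    proof (rule nn_integral_cong)
      fix t :: real
      have "(\<lambda>z. z(i := t)) \<in> PiM ?J (\<lambda>_. lborel) \<rightarrow>\<^sub>M PiM (insert i ?J) (\<lambda>_. lborel :: real measure)"
        by measurable
      from measurable_compose[OF this G']
      show "(\<integral>\<^sup>+z. ?G (z(i := t)) \<partial>PiM ?J (\<lambda>_. lborel))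
          = (\<integral>\<^sup>+z. ?G ((\<lambda>k\<in>?J. z k + t / a i * a k)(i := t)) \<partial>PiM ?J (\<lambda>_. lborel))"
        by (rule nn_integral_PiM_translate[OF finJ, symmetric])
    qed
    also have "\<dots> = (\<integral>\<^sup>+z. (\<integral>\<^sup>+t. ?G ((\<lambda>k\<in>?J. z k + t / a i * a k)(i := t)) \<partial>lborel) \<partial>PiM ?J (\<lambda>_. lborel))"
      unfolding val
      by (rule pair_sigma_finite.Fubini')
         (auto intro!: pair_sigma_finite.intro lborel_product.sigma_finite finJ sigma_finite_lborel)
    also have "\<dots> = (\<integral>\<^sup>+z. F (ext0 ?J z) * ennreal (exp (- ?b (ext0 ?J z) (ext0 ?J z) / 2)) * ennreal ?C
        \<partial>PiM ?J (\<lambda>_. lborel))"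
    proof (rule nn_integral_cong)
      fix z
      have "(\<integral>\<^sup>+t. ennreal (exp (- (\<beta> a a * (t / a i + \<beta> (ext0 ?J z) a / \<beta> a a)\<^sup>2) / 2)) \<partial>lborel)
        = ennreal \<bar>a i\<bar> * (\<integral>\<^sup>+t. ennreal (exp (- (\<beta> a a * (t + \<beta> (ext0 ?J z) a / \<beta> a a)\<^sup>2) / 2)) \<partial>lborel)"
        using i(2) by (subst nn_integral_real_affine[where t=0 and c="a i"]) auto
      also have "\<dots> = ennreal ?C"
        using aa by (subst nn_integral_gauss) (auto simp: ennreal_mult)
      finally show "(\<integral>\<^sup>+t. ?G ((\<lambda>k\<in>?J. z k + t / a i * a k)(i := t)) \<partial>lborel)
          = F (ext0 ?J z) * ennreal (exp (- ?b (ext0 ?J z) (ext0 ?J z) / 2)) * ennreal ?C"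
        unfolding val by (subst nn_integral_cmult) auto
    qed
    also have "\<dots> = (\<integral>\<^sup>+z. F (ext0 ?J z) * ennreal (exp (- ?b (ext0 ?J z) (ext0 ?J z) / 2))
        \<partial>PiM ?J (\<lambda>_. lborel)) * ennreal ?C"
      by (rule nn_integral_multc) measurable
    finally show ?thesis
      using rep'[OF F inv] c C by (simp add: ennreal_mult ac_simps)
  qed
  have "gauss_rep K \<gamma> (schur \<beta> w) (J - {i})"
    unfolding sch using JK c C by (intro gauss_repI[where \<beta>="schur \<beta> a" and c="c * ?C", OF _ dec' _ int]) auto
  then show thesis using that i(1) by simp
qed

section \<open>The standard Gaussian product measure\<close>

definition std_gauss :: "'k set \<Rightarrow> ('k \<Rightarrow> real) measure" where
  "std_gauss K = PiM K (\<lambda>_. density lborel (\<lambda>x. ennreal (std_normal_density x)))"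

lemma prob_space_std_gauss: "prob_space (std_gauss K)"
  unfolding std_gauss_def by (intro prob_space_PiM prob_space_normal_density) simp

lemma sets_std_gauss [measurable_cong]: "sets (std_gauss K) = sets (PiM K (\<lambda>_. lborel))"
  unfolding std_gauss_def by (intro sets_PiM_cong) auto

lemma space_std_gauss: "space (std_gauss K) = space (PiM K (\<lambda>_. lborel))"
  by (rule sets_eq_imp_space_eq[OF sets_std_gauss])

lemma std_gauss_eq_density:
  assumes "finite K"
  shows "std_gauss K = density (PiM K (\<lambda>_. lborel)) (\<lambda>x. \<Prod>k\<in>K. ennreal (std_normal_density (x k)))"
proof -
  interpret N: prob_space "density lborel (\<lambda>x. ennreal (std_normal_density x))"
    by (rule prob_space_normal_density) simp
  interpret P: product_sigma_finite "\<lambda>_. density lborel (\<lambda>x. ennreal (std_normal_density x))"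
    by standard
  show ?thesis
    unfolding std_gauss_def
  proof (rule P.PiM_eqI[symmetric])
    show "finite K" by fact
    show "sets (density (PiM K (\<lambda>_. lborel)) (\<lambda>x. \<Prod>k\<in>K. ennreal (std_normal_density (x k))))
        = sets (PiM K (\<lambda>_. density lborel (\<lambda>x. ennreal (std_normal_density x))))"
      by (subst sets_density) (intro sets_PiM_cong, auto)
    fix A :: "'a \<Rightarrow> real set"
    assume A: "\<And>i. i \<in> K \<Longrightarrow> A i \<in> sets (density lborel (\<lambda>x. ennreal (std_normal_density x)))"
    then have A'[measurable]: "\<And>i. i \<in> K \<Longrightarrow> A i \<in> sets borel" by simp
    have PA[measurable]: "Pi\<^sub>E K A \<in> sets (PiM K (\<lambda>_. lborel))"
      using A' \<open>finite K\<close> by (intro sets_PiM_I_finite) auto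
    have "emeasure (density (PiM K (\<lambda>_. lborel)) (\<lambda>x. \<Prod>k\<in>K. ennreal (std_normal_density (x k)))) (Pi\<^sub>E K A)
        = (\<integral>\<^sup>+x. (\<Prod>k\<in>K. ennreal (std_normal_density (x k))) * indicator (Pi\<^sub>E K A) x \<partial>PiM K (\<lambda>_. lborel))"
      by (intro emeasure_density) measurable
    also have "\<dots> = (\<integral>\<^sup>+x. (\<Prod>k\<in>K. ennreal (std_normal_density (x k)) * indicator (A k) (x k)) \<partial>PiM K (\<lambda>_. lborel))"
    proof (intro nn_integral_cong)
      fix x :: "'a \<Rightarrow> real" assume "x \<in> space (PiM K (\<lambda>_. lborel))"
      then have "indicator (Pi\<^sub>E K A) x = (\<Prod>k\<in>K. indicator (A k) (x k) :: ennreal)"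
        using \<open>finite K\<close> by (auto simp: indicator_def space_PiM PiE_iff)
      then show "(\<Prod>k\<in>K. ennreal (std_normal_density (x k))) * indicator (Pi\<^sub>E K A) x
          = (\<Prod>k\<in>K. ennreal (std_normal_density (x k)) * indicator (A k) (x k))"
        by (simp add: prod.distrib)
    qed
    also have "\<dots> = (\<Prod>k\<in>K. \<integral>\<^sup>+x. ennreal (std_normal_density x) * indicator (A k) x \<partial>lborel)"
      using \<open>finite K\<close> by (intro lborel_product.product_nn_integral_prod) auto
    also have "\<dots> = (\<Prod>k\<in>K. emeasure (density lborel (\<lambda>x. ennreal (std_normal_density x))) (A k))"
      by (intro prod.cong refl, subst emeasure_density) auto
    finally show "emeasure (density (PiM K (\<lambda>_. lborel)) (\<lambda>x. \<Prod>k\<in>K. ennreal (std_normal_density (x k)))) (Pi\<^sub>E K A)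
        = (\<Prod>k\<in>K. emeasure (density lborel (\<lambda>x. ennreal (std_normal_density x))) (A k))" .
  qed
qed

lemma prod_std_normal_density:
  "finite K \<Longrightarrow> (\<Prod>k\<in>K. ennreal (std_normal_density (x k)))
    = ennreal ((1 / sqrt (2 * pi)) ^ card K) * ennreal (exp (- (\<Sum>k\<in>K. (x k)\<^sup>2) / 2))"
proof -
  assume "finite K"
  then have "(\<Prod>k\<in>K. std_normal_density (x k)) = (1 / sqrt (2 * pi)) ^ card K * exp (- (\<Sum>k\<in>K. (x k)\<^sup>2) / 2)"
    by (simp only: std_normal_density_def prod.distrib prod_constant exp_sum[symmetric])
       (simp add: sum_negf sum_divide_distrib)
  then show ?thesis
    by (simp add: prod_ennreal ennreal_mult)
qed

definition std_form :: "'k set \<Rightarrow> ('k \<Rightarrow> real) \<Rightarrow> ('k \<Rightarrow> real) \<Rightarrow> real" where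
  "std_form K u v = (\<Sum>k\<in>K. u k * v k)"

lemma psd_form_std_form: "finite K \<Longrightarrow> psd_form K (std_form K)"
  by unfold_locales
     (auto simp: std_form_def algebra_simps sum.distrib sum_distrib_left intro!: sum_nonneg sum.cong)

text \<open>The full-rank representation from which all others are derived. Invariance under the
  null space of \<open>std_form K\<close> means that only coordinates in \<open>K\<close> are read,
  so \<open>ext0 K z\<close> and \<open>z\<close> are interchangeable.\<close>

lemma gauss_rep_std_form:
  fixes K :: "'k set"
  assumes "finite K"
  shows "gauss_rep K (std_gauss K) (std_form K) K"
  unfolding gauss_rep_def
proof (intro conjI allI exI[of _ "(1 / sqrt (2 * pi)) ^ card K"] ballI impI)
  interpret psd_form K "std_form K" using assms by (rule psd_form_std_form)
  show "K \<subseteq> K" by simp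
  show "\<exists>z. (\<forall>k. k \<notin> K \<longrightarrow> z k = 0) \<and> std_form K (\<lambda>k. u k - z k) (\<lambda>k. u k - z k) = 0" for u
    by (rule exI[of _ "ext0 K u"]) (auto simp: std_form_def ext0_def)
  show "(1 / sqrt (2 * pi)) ^ card K > 0" by simp
  fix F :: "('k \<Rightarrow> real) \<Rightarrow> ennreal"
  assume F[measurable]: "F \<in> borel_measurable (PiM K (\<lambda>_. lborel))" and inv: "null_inv (std_form K) F"
  have eq: "F (ext0 K z) = F z" for z
    by (rule null_inv_cong[OF inv]) (auto simp: std_form_def ext0_def)
  have "(\<integral>\<^sup>+u. F u \<partial>std_gauss K) = (\<integral>\<^sup>+x. (\<Prod>k\<in>K. ennreal (std_normal_density (x k))) * F x \<partial>PiM K (\<lambda>_. lborel))"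
    unfolding std_gauss_eq_density[OF assms] by (intro nn_integral_density) measurable
  also have "\<dots> = (\<integral>\<^sup>+x. ennreal ((1 / sqrt (2 * pi)) ^ card K) *
      (F (ext0 K x) * ennreal (exp (- std_form K (ext0 K x) (ext0 K x) / 2))) \<partial>PiM K (\<lambda>_. lborel))"
    unfolding eq prod_std_normal_density[OF assms]
    by (intro nn_integral_cong) (simp add: std_form_def ext0_def power2_eq_square ac_simps)
  also have "\<dots> = ennreal ((1 / sqrt (2 * pi)) ^ card K) *
      (\<integral>\<^sup>+x. F (ext0 K x) * ennreal (exp (- std_form K (ext0 K x) (ext0 K x) / 2)) \<partial>PiM K (\<lambda>_. lborel))"
  proof (rule nn_integral_cmult)
    have "(\<lambda>x. std_form K (ext0 K x) (ext0 K x)) \<in> borel_measurable (PiM K (\<lambda>_. lborel))"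
      by (rule borel_measurable_form) (rule measurable_ext0_component)+
    then show "(\<lambda>x. F (ext0 K x) * ennreal (exp (- std_form K (ext0 K x) (ext0 K x) / 2)))
        \<in> borel_measurable (PiM K (\<lambda>_. lborel))"
      unfolding eq by measurable
  qed
  finally show "(\<integral>\<^sup>+u. F u \<partial>std_gauss K) = ennreal ((1 / sqrt (2 * pi)) ^ card K) *
      (\<integral>\<^sup>+x. F (ext0 K x) * ennreal (exp (- std_form K (ext0 K x) (ext0 K x) / 2)) \<partial>PiM K (\<lambda>_. lborel))" .
qed

definition proj_form :: "(('k \<Rightarrow> real) \<Rightarrow> ('k \<Rightarrow> real) \<Rightarrow> real) \<Rightarrow> ('l \<Rightarrow> 'k \<Rightarrow> real) \<Rightarrow> 'l set \<Rightarrow>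
    ('k \<Rightarrow> real) \<Rightarrow> ('k \<Rightarrow> real) \<Rightarrow> real" where
  "proj_form \<beta> w L u v = \<beta> u v - (\<Sum>l\<in>L. \<beta> u (w l) * \<beta> v (w l) / \<beta> (w l) (w l))"

text \<open>Removing one more vector of an orthogonal family is a Schur step, because the vectors
  already removed do not affect products with it (\<open>pa\<close>). Each step costs one dimension;
  this is how degrees of freedom are counted.\<close>

lemma proj_form_rep:
  assumes psd: "psd_form K \<beta>" and rep: "gauss_rep K \<gamma> \<beta> J" and L: "finite L"
    and pos: "\<And>l. l \<in> L \<Longrightarrow> \<beta> (w l) (w l) > 0"
    and orth: "\<And>l l'. l \<in> L \<Longrightarrow> l' \<in> L \<Longrightarrow> l \<noteq> l' \<Longrightarrow> \<beta> (w l) (w l') = 0"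
  shows "psd_form K (proj_form \<beta> w L) \<and>
    (\<exists>J'. card J' + card L = card J \<and> gauss_rep K \<gamma> (proj_form \<beta> w L) J')"
  using L pos orth
proof (induction L)
  case empty
  have "proj_form \<beta> w {} = \<beta>" by (simp add: proj_form_def fun_eq_iff)
  then show ?case using psd rep by auto
next
  case (insert a L)
  have IH: "psd_form K (proj_form \<beta> w L)"
      "\<exists>J'. card J' + card L = card J \<and> gauss_rep K \<gamma> (proj_form \<beta> w L) J'"
    using insert.IH insert.prems by blast+
  interpret P: psd_form K "proj_form \<beta> w L" by (rule IH(1))
  from IH(2) obtain J' where J': "card J' + card L = card J" "gauss_rep K \<gamma> (proj_form \<beta> w L) J'" by blast
  interpret psd_form K \<beta> by fact
  have pa: "proj_form \<beta> w L u (w a) = \<beta> u (w a)" for u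
  proof -
    have "\<beta> (w a) (w l) = 0" if "l \<in> L" for l
      using insert.prems(2)[of a l] insert.hyps that by auto
    then show ?thesis by (simp add: proj_form_def)
  qed
  have eq: "proj_form \<beta> w (insert a L) = schur (proj_form \<beta> w L) (w a)"
    using insert.hyps by (simp add: fun_eq_iff schur_def pa) (simp add: proj_form_def)
  have "proj_form \<beta> w L (w a) (w a) > 0" using pa insert.prems(1) by simp
  from gauss_rep_schur[where \<beta>="proj_form \<beta> w L" and w="w a", OF P.psd_form_axioms J'(2) this] obtain i
    where i: "i \<in> J'" "gauss_rep K \<gamma> (schur (proj_form \<beta> w L) (w a)) (J' - {i})" .
  have "finite J'" using J'(2) finite_K by (auto simp: gauss_rep_def intro: finite_subset)
  then have "card (J' - {i}) + 1 = card J'" using i(1) by (metis Suc_eq_plus1 card_Suc_Diff1)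
  then have "card (J' - {i}) + card (insert a L) = card J"
    using J'(1) insert.hyps by simp
  then show ?case
    unfolding eq using P.psd_form_schur i(2) by blast
qed

section \<open>Elimination of rows and pivots\<close>

fun row_form :: "(('k \<Rightarrow> real) \<Rightarrow> ('k \<Rightarrow> real) \<Rightarrow> real) \<Rightarrow> (nat \<Rightarrow> 'k \<Rightarrow> real) \<Rightarrow> nat \<Rightarrow>
    ('k \<Rightarrow> real) \<Rightarrow> ('k \<Rightarrow> real) \<Rightarrow> real" where
  "row_form \<beta> y 0 = \<beta>"
| "row_form \<beta> y (Suc i) = schur (row_form \<beta> y i) (y i)"

definition pivot :: "(('k \<Rightarrow> real) \<Rightarrow> ('k \<Rightarrow> real) \<Rightarrow> real) \<Rightarrow> (nat \<Rightarrow> 'k \<Rightarrow> real) \<Rightarrow> nat \<Rightarrow> real" where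
  "pivot \<beta> y i = row_form \<beta> y i (y i) (y i)"

lemma (in psd_form) psd_form_row_form: "psd_form K (row_form \<beta> y i)"
  by (induction i) (auto intro: psd_form.psd_form_schur psd_form_axioms)

lemma row_form_cong: "(\<And>l. l < i \<Longrightarrow> y l = y' l) \<Longrightarrow> row_form \<beta> y i = row_form \<beta> y' i"
  by (induction i) auto

lemma (in psd_form) pivot_nonneg: "pivot \<beta> y i \<ge> 0"
  unfolding pivot_def by (rule psd_form.nonneg[OF psd_form_row_form])

lemma (in psd_form) borel_measurable_row_form:
  assumes "\<And>l k. l < i \<Longrightarrow> k \<in> K \<Longrightarrow> (\<lambda>x. y x l k) \<in> borel_measurable M"
    and "\<And>k. k \<in> K \<Longrightarrow> (\<lambda>x. u x k) \<in> borel_measurable M"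
    and "\<And>k. k \<in> K \<Longrightarrow> (\<lambda>x. v x k) \<in> borel_measurable M"
  shows "(\<lambda>x. row_form \<beta> (y x) i (u x) (v x)) \<in> borel_measurable M"
  using assms
proof (induction i arbitrary: u v)
  case 0
  then show ?case by (auto intro: borel_measurable_form)
next
  case (Suc i)
  have y: "\<And>k. k \<in> K \<Longrightarrow> (\<lambda>x. y x i k) \<in> borel_measurable M" using Suc.prems(1) by simp
  have IH: "(\<lambda>x. row_form \<beta> (y x) i (u x) (v x)) \<in> borel_measurable M"
    if "\<And>k. k \<in> K \<Longrightarrow> (\<lambda>x. u x k) \<in> borel_measurable M"
      "\<And>k. k \<in> K \<Longrightarrow> (\<lambda>x. v x k) \<in> borel_measurable M" for u v
    using Suc.prems(1) that by (intro Suc.IH) auto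
  show ?case
    unfolding row_form.simps schur_def
    by (intro borel_measurable_diff borel_measurable_times borel_measurable_divide IH y Suc.prems(2,3))
qed

lemma (in psd_form) borel_measurable_pivot:
  assumes "\<And>l k. l \<le> i \<Longrightarrow> k \<in> K \<Longrightarrow> (\<lambda>x. y x l k) \<in> borel_measurable M"
  shows "(\<lambda>x. pivot \<beta> (y x) i) \<in> borel_measurable M"
  unfolding pivot_def using assms by (intro borel_measurable_row_form) auto

text \<open>A vanishing pivot would leave the form unchanged; positive pivots make the rank drop by
  exactly one per row. The set \<open>J'\<close> may depend on the rows, but its cardinality does
  not, and only the cardinality determines the chi-square law.\<close>

lemma (in psd_form) gauss_rep_row_form:
  assumes "gauss_rep K \<gamma> \<beta> J" and "\<And>l. l < i \<Longrightarrow> pivot \<beta> y l > 0"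
  shows "\<exists>J'. card J' + i = card J \<and> gauss_rep K \<gamma> (row_form \<beta> y i) J'"
  using assms(2)
proof (induction i)
  case 0
  then show ?case using assms(1) by auto
next
  case (Suc i)
  then obtain J' where J': "card J' + i = card J" "gauss_rep K \<gamma> (row_form \<beta> y i) J'" by auto
  have "row_form \<beta> y i (y i) (y i) > 0" using Suc.prems[of i] by (simp add: pivot_def)
  from gauss_rep_schur[where \<beta>="row_form \<beta> y i" and w="y i", OF psd_form_row_form J'(2) this] obtain k
    where k: "k \<in> J'" "gauss_rep K \<gamma> (schur (row_form \<beta> y i) (y i)) (J' - {k})" .
  have "finite J'" using J'(2) finite_K by (auto simp: gauss_rep_def intro: finite_subset)
  then have "card (J' - {k}) + 1 = card J'" using k(1) by (metis Suc_eq_plus1 card_Suc_Diff1)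
  then show ?case using J'(1) k(2) by (intro exI[of _ "J' - {k}"]) simp
qed

text \<open>Row operations of a lower triangular matrix rescale the pivots by its squared diagonal entries.\<close>

lemma (in psd_form) row_form_triangular:
  assumes "\<And>l. l < i \<Longrightarrow> c l \<noteq> 0"
    and "\<And>l. l < i \<Longrightarrow> row_form \<beta> y l (\<lambda>k. y' l k - c l * y l k) (\<lambda>k. y' l k - c l * y l k) = 0"
  shows "row_form \<beta> y' i = row_form \<beta> y i"
  using assms
proof (induction i)
  case 0
  then show ?case by simp
next
  case (Suc i)
  interpret R: psd_form K "row_form \<beta> y i" by (rule psd_form_row_form)
  have IH: "row_form \<beta> y' i = row_form \<beta> y i" using Suc by auto
  \<comment> \<open>Null vectors drop out of every product, so \<open>y' i\<close> acts like
    \<open>c i * y i\<close>, and the factors \<open>c i\<close> cancel in the Schur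
    quotient.\<close>
  have "row_form \<beta> y i u (y' i) = c i * row_form \<beta> y i u (y i)" for u
    using R.null_right[OF Suc.prems(2)[of i], of u] by (simp add: R.diff_right R.scale_right)
  moreover from this[of "y' i"] this[of "y i"]
  have "row_form \<beta> y i (y' i) (y' i) = c i * c i * row_form \<beta> y i (y i) (y i)"
    using R.sym[of "y' i" "y i"] by simp
  ultimately show ?case
    using Suc.prems(1)[of i] by (simp add: IH schur_def fun_eq_iff)
qed

lemma (in psd_form) pivot_triangular:
  assumes "\<And>l. l \<le> i \<Longrightarrow> c l \<noteq> 0"
    and "\<And>l. l \<le> i \<Longrightarrow> row_form \<beta> y l (\<lambda>k. y' l k - c l * y l k) (\<lambda>k. y' l k - c l * y l k) = 0"
  shows "pivot \<beta> y' i = (c i)\<^sup>2 * pivot \<beta> y i"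
proof -
  interpret R: psd_form K "row_form \<beta> y i" by (rule psd_form_row_form)
  have IH: "row_form \<beta> y' i = row_form \<beta> y i"
    using assms by (intro row_form_triangular[of i c]) auto
  have "row_form \<beta> y i u (y' i) = c i * row_form \<beta> y i u (y i)" for u
    using R.null_right[OF assms(2)[of i], of u] by (simp add: R.diff_right R.scale_right)
  from this[of "y' i"] this[of "y i"] show ?thesis
    unfolding pivot_def IH using R.sym[of "y' i" "y i"] by (simp add: power2_eq_square)
qed

lemma (in psd_form) row_form_null:
  "\<beta> u u = 0 \<Longrightarrow> row_form \<beta> y i u u = 0"
  by (induction i) (auto intro: psd_form.schur_null[OF psd_form_row_form])

lemma (in psd_form) row_form_row_null:
  "l < i \<Longrightarrow> row_form \<beta> y i (y l) (y l) = 0"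
proof (induction i)
  case (Suc i)
  then show ?case
    using psd_form.schur_null[OF psd_form_row_form] psd_form.schur_self[OF psd_form_row_form]
    by (cases "l = i") auto
qed simp

lemma (in psd_form) row_form_combination_null:
  assumes "\<beta> \<nu> \<nu> = 0"
  shows "row_form \<beta> y i (\<lambda>k. (\<Sum>l<i. a l * y l k) + \<nu> k) (\<lambda>k. (\<Sum>l<i. a l * y l k) + \<nu> k) = 0"
proof -
  interpret R: psd_form K "row_form \<beta> y i" by (rule psd_form_row_form)
  have "row_form \<beta> y i (\<lambda>k. (\<Sum>l<m. a l * y l k) + \<nu> k) (\<lambda>k. (\<Sum>l<m. a l * y l k) + \<nu> k) = 0" if "m \<le> i" for m
    using that
  proof (induction m)
    case 0
    then show ?case using row_form_null[OF assms] by simp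
  next
    case (Suc m)
    have "(\<lambda>k. (\<Sum>l<Suc m. a l * y l k) + \<nu> k) = (\<lambda>k. a m * y m k + ((\<Sum>l<m. a l * y l k) + \<nu> k))"
      by (simp add: fun_eq_iff)
    then show ?case
      using Suc by (simp only:) (intro R.null_add row_form_row_null, auto)
  qed
  then show ?thesis by simp
qed

text \<open>Converse of \<open>row_form_combination_null\<close>: after \<open>i\<close> steps the
  null space consists of combinations of the first \<open>i\<close> rows plus original null vectors.
  This description no longer mentions the elimination, so it can be carried from the pooled form to
  the group forms.\<close>

lemma (in psd_form) row_form_null_cases:
  assumes "row_form \<beta> y i w w = 0"
  obtains a \<nu> where "\<beta> \<nu> \<nu> = 0" "w = (\<lambda>k. (\<Sum>l<i. a l * y l k) + \<nu> k)"
proof -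
  have "\<exists>a \<nu>. \<beta> \<nu> \<nu> = 0 \<and> w = (\<lambda>k. (\<Sum>l<i. a l * y l k) + \<nu> k)"
    using assms
  proof (induction i arbitrary: w)
    case 0
    then show ?case by auto
  next
    case (Suc i)
    interpret R: psd_form K "row_form \<beta> y i" by (rule psd_form_row_form)
    show ?case
    proof (cases "row_form \<beta> y i (y i) (y i) = 0")
      case True
      then have "row_form \<beta> y i w w = 0" using Suc.prems by (simp add: schur_def)
      from Suc.IH[OF this] obtain a \<nu> where a: "\<beta> \<nu> \<nu> = 0" "w = (\<lambda>k. (\<Sum>l<i. a l * y l k) + \<nu> k)" by blast
      have "w = (\<lambda>k. (\<Sum>l<Suc i. (a(i := 0)) l * y l k) + \<nu> k)"
        unfolding a(2) by (simp add: fun_eq_iff)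
      with a(1) show ?thesis by blast
    next
      case False
      \<comment> \<open>The coefficient of the projection of \<open>w\<close> on row
        \<open>i\<close>; completing the square shows that the residual is null for the preceding
        form.\<close>
      let ?c = "row_form \<beta> y i w (y i) / row_form \<beta> y i (y i) (y i)"
      have "row_form \<beta> y i (\<lambda>k. - ?c * y i k + w k) (\<lambda>k. - ?c * y i k + w k) = 0"
        unfolding R.schur_complete_square[OF False] using Suc.prems by simp
      from Suc.IH[OF this] obtain a \<nu> where a: "\<beta> \<nu> \<nu> = 0"
        "(\<lambda>k. - ?c * y i k + w k) = (\<lambda>k. (\<Sum>l<i. a l * y l k) + \<nu> k)" by blast
      have "w k = (\<Sum>l<Suc i. (a(i := ?c)) l * y l k) + \<nu> k" for k
        using fun_cong[OF a(2), of k] by simp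
      then have "w = (\<lambda>k. (\<Sum>l<Suc i. (a(i := ?c)) l * y l k) + \<nu> k)" by (rule ext)
      with a(1) show ?thesis by blast
    qed
  qed
  then show thesis using that by blast
qed

section \<open>Chi-square pivots and Basu's theorem\<close>

definition chi_square :: "nat \<Rightarrow> real measure" where
  "chi_square k = density lborel (\<lambda>u. ennreal
     (if u > 0 then u powr (real k / 2 - 1) * exp (- u / 2) / (2 powr (real k / 2) * Gamma (real k / 2)) else 0))"

lemma sets_chi_square [simp, measurable_cong]: "sets (chi_square k) = sets borel"
  by (simp add: chi_square_def)

lemma space_chi_square [simp]: "space (chi_square k) = UNIV"
  by (simp add: chi_square_def)

text \<open>The left-hand side is the radial integral that polar coordinates produce for a Gaussian
  density.\<close>

lemma nn_integral_chi_square: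
  assumes k: "k > 0" and [measurable]: "h \<in> borel_measurable borel"
  shows "(\<integral>\<^sup>+u. ennreal (if u > 0 then u powr (real k / 2 - 1) else 0) * (h u * ennreal (exp (- u / 2))) \<partial>lborel)
    = ennreal (2 powr (real k / 2) * Gamma (real k / 2)) * (\<integral>\<^sup>+u. h u \<partial>chi_square k)"
proof -
  have G: "Gamma (real k / 2) > 0" using k by (intro Gamma_real_pos) auto
  have "(\<integral>\<^sup>+u. h u \<partial>chi_square k) = (\<integral>\<^sup>+u. ennreal (if u > 0 then u powr (real k / 2 - 1) * exp (- u / 2) /
      (2 powr (real k / 2) * Gamma (real k / 2)) else 0) * h u \<partial>lborel)"
    unfolding chi_square_def by (intro nn_integral_density) auto
  then have "ennreal (2 powr (real k / 2) * Gamma (real k / 2)) * (\<integral>\<^sup>+u. h u \<partial>chi_square k)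
      = (\<integral>\<^sup>+u. ennreal (2 powr (real k / 2) * Gamma (real k / 2)) *
          (ennreal (if u > 0 then u powr (real k / 2 - 1) * exp (- u / 2) /
          (2 powr (real k / 2) * Gamma (real k / 2)) else 0) * h u) \<partial>lborel)"
    by (simp add: nn_integral_cmult)
  also have "\<dots> = (\<integral>\<^sup>+u. ennreal (if u > 0 then u powr (real k / 2 - 1) else 0) * (h u * ennreal (exp (- u / 2))) \<partial>lborel)"
  proof (rule nn_integral_cong)
    fix u :: real
    have "ennreal (2 powr (real k / 2) * Gamma (real k / 2)) *
        ennreal (u powr (real k / 2 - 1) * exp (- u / 2) / (2 powr (real k / 2) * Gamma (real k / 2)))
      = ennreal (u powr (real k / 2 - 1)) * ennreal (exp (- u / 2))"
      using G by (simp add: ennreal_mult[symmetric])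
    then show "ennreal (2 powr (real k / 2) * Gamma (real k / 2)) *
          (ennreal (if u > 0 then u powr (real k / 2 - 1) * exp (- u / 2) /
          (2 powr (real k / 2) * Gamma (real k / 2)) else 0) * h u)
        = ennreal (if u > 0 then u powr (real k / 2 - 1) else 0) * (h u * ennreal (exp (- u / 2)))"
      by (auto simp: mult.assoc[symmetric]) (simp add: ac_simps)
  qed
  finally show ?thesis by simp
qed

lemma prob_space_chi_square:
  assumes k: "k > 0"
  shows "prob_space (chi_square k)"
proof
  have G: "Gamma (real k / 2) > 0" using k by (intro Gamma_real_pos) auto
  \<comment> \<open>Replacing \<open>u\<close> by \<open>2 * u\<close> turns the density into the
    integrand of the Gamma integral.\<close>
  have integrand: "ennreal (if 2 * u > 0 then (2 * u) powr (real k / 2 - 1) else 0) * ennreal (exp (- (2 * u) / 2))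
      = ennreal (2 powr (real k / 2 - 1)) * ennreal (indicator {0..} u * u powr (real k / 2 - 1) / exp u)" for u
  proof -
    have "(2 * u) powr (real k / 2 - 1) * exp (- u) = 2 powr (real k / 2 - 1) * (u powr (real k / 2 - 1) / exp u)"
      by (simp only: powr_mult exp_minus divide_inverse mult_ac)
    then show ?thesis
      by (cases "u > 0"; cases "u = 0") (simp_all add: ennreal_mult[symmetric])
  qed
  have "ennreal (2 powr (real k / 2) * Gamma (real k / 2)) * (\<integral>\<^sup>+u. 1 \<partial>chi_square k)
      = (\<integral>\<^sup>+u. ennreal (if u > 0 then u powr (real k / 2 - 1) else 0) * ennreal (exp (- u / 2)) \<partial>lborel)"
    using nn_integral_chi_square[OF k, of "\<lambda>_. 1"] by simp
  also have "\<dots> = ennreal 2 * (\<integral>\<^sup>+u. ennreal (if 2 * u > 0 then (2 * u) powr (real k / 2 - 1) else 0) *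
      ennreal (exp (- (2 * u) / 2)) \<partial>lborel)"
    by (subst nn_integral_real_affine[where t=0 and c=2]) (auto cong: if_cong)
  also have "\<dots> = ennreal 2 * (\<integral>\<^sup>+u. ennreal (2 powr (real k / 2 - 1)) *
      ennreal (indicator {0..} u * u powr (real k / 2 - 1) / exp u) \<partial>lborel)"
    unfolding integrand ..
  also have "\<dots> = ennreal 2 * (ennreal (2 powr (real k / 2 - 1)) * ennreal (Gamma (real k / 2)))"
    using k by (subst nn_integral_cmult) (auto simp: Gamma_conv_nn_integral_real[of "real k / 2"])
  also have "\<dots> = ennreal (2 powr (real k / 2) * Gamma (real k / 2))"
    using G by (simp add: ennreal_mult[symmetric] powr_diff flip: ennreal_numeral)
  finally have eq: "ennreal (2 powr (real k / 2) * Gamma (real k / 2)) * emeasure (chi_square k) UNIV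
      = ennreal (2 powr (real k / 2) * Gamma (real k / 2)) * 1" by simp
  have "2 powr (real k / 2) * Gamma (real k / 2) > 0" using G by simp
  then show "emeasure (chi_square k) (space (chi_square k)) = 1"
    using eq[unfolded ennreal_mult_cancel_left] by (auto simp: ennreal_eq_0_iff)
qed

text \<open>The weight is the derivative of \<open>u powr (real k / 2)\<close>, the growth of mass
  that scaling yields in polar coordinates.\<close>

lemma nn_integral_powr_from_0:
  assumes "k > 0" and "s > 0"
  shows "(\<integral>\<^sup>+u. ennreal (if 0 < u then real k / 2 * u powr (real k / 2 - 1) else 0) * indicator {..<s} u \<partial>lborel)
    = ennreal (s powr (real k / 2))"
proof -
  have "((\<lambda>x. x powr (real k / 2 - 1)) has_integral s powr (real k / 2 - 1 + 1) / (real k / 2 - 1 + 1)) {0..s}"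
    using assms by (intro has_integral_powr_from_0) auto
  from has_integral_mult_right[OF this, of "real k / 2"]
  have "((\<lambda>x. real k / 2 * x powr (real k / 2 - 1)) has_integral s powr (real k / 2)) {0..s}"
    using assms by simp
  from nn_integral_has_integral_lebesgue[OF _ this]
  have "(\<integral>\<^sup>+u. ennreal (indicator {0..s} u * (real k / 2 * u powr (real k / 2 - 1))) \<partial>lborel) = ennreal (s powr (real k / 2))"
    by simp
  moreover have "(\<integral>\<^sup>+u. ennreal (if 0 < u then real k / 2 * u powr (real k / 2 - 1) else 0) * indicator {..<s} u \<partial>lborel)
      = (\<integral>\<^sup>+u. ennreal (indicator {0..s} u * (real k / 2 * u powr (real k / 2 - 1))) \<partial>lborel)"
    by (rule nn_integral_cong_AE, rule AE_mp[OF AE_lborel_singleton[of s]], rule AE_I2)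
       (auto simp: indicator_def)
  ultimately show ?thesis by simp
qed

text \<open>Polar coordinates: the measure \<open>g(z) dz\<close> of \<open>{Q < s}\<close> is homogeneous in \<open>s\<close> of degree \<open>card J / 2\<close>.\<close>

lemma nn_integral_radial:
  fixes Q :: "('k \<Rightarrow> real) \<Rightarrow> real" and g :: "('k \<Rightarrow> real) \<Rightarrow> ennreal"
  assumes J: "finite J" "card J > 0"
    and [measurable]: "Q \<in> borel_measurable (PiM J (\<lambda>_. lborel))" "g \<in> borel_measurable (PiM J (\<lambda>_. lborel))"
      "h \<in> borel_measurable borel"
    and Q0: "\<And>z. Q z \<ge> 0" and Qs: "\<And>c z. c > 0 \<Longrightarrow> Q (\<lambda>j\<in>J. c * z j) = c\<^sup>2 * Q z"
    and gs: "\<And>c z. c > 0 \<Longrightarrow> g (\<lambda>j\<in>J. c * z j) = g z"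
    and fin: "(\<integral>\<^sup>+z. g z * indicator {..<1} (Q z) \<partial>PiM J (\<lambda>_. lborel)) < \<infinity>"
  shows "(\<integral>\<^sup>+z. g z * h (Q z) \<partial>PiM J (\<lambda>_. lborel))
    = (\<integral>\<^sup>+z. g z * indicator {..<1} (Q z) \<partial>PiM J (\<lambda>_. lborel)) *
      (\<integral>\<^sup>+u. ennreal (if 0 < u then real (card J) / 2 * u powr (real (card J) / 2 - 1) else 0) * h u \<partial>lborel)"
proof -
  let ?L = "PiM J (\<lambda>_. lborel :: real measure)" and ?k = "card J"
  define \<Phi> where "\<Phi> = (\<integral>\<^sup>+z. g z * indicator {..<1} (Q z) \<partial>?L)"
  let ?r = "\<lambda>u. ennreal (if 0 < u then real ?k / 2 * u powr (real ?k / 2 - 1) else 0)"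
  \<comment> \<open>The law of \<open>Q\<close> and its claimed density form. Both are reflected by
    a minus sign because the uniqueness argument tests measures on the half-lines
    \<open>{x<..}\<close>, where it also asks for finite mass.\<close>
  let ?M1 = "distr (density ?L g) borel (\<lambda>z. - Q z)"
  let ?M2 = "distr (density lborel (\<lambda>u. \<Phi> * ?r u)) borel uminus"
  \<comment> \<open>Scaling by \<open>sqrt s\<close>: the Jacobian is
    \<open>sqrt s ^ card J\<close>, while \<open>g\<close> is scale invariant and \<open>Q\<close>
    is quadratic.\<close>
  have hom: "(\<integral>\<^sup>+z. g z * indicator {..<s} (Q z) \<partial>?L) = ennreal (s powr (real ?k / 2)) * \<Phi>" if s: "s > 0" for s
  proof -
    have "(\<integral>\<^sup>+z. g z * indicator {..<s} (Q z) \<partial>?L)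
        = ennreal (sqrt s ^ ?k) * (\<integral>\<^sup>+z. g (\<lambda>j\<in>J. sqrt s * z j) * indicator {..<s} (Q (\<lambda>j\<in>J. sqrt s * z j)) \<partial>?L)"
      using s J by (intro nn_integral_PiM_scale[symmetric]) auto
    also have "(\<integral>\<^sup>+z. g (\<lambda>j\<in>J. sqrt s * z j) * indicator {..<s} (Q (\<lambda>j\<in>J. sqrt s * z j)) \<partial>?L) = \<Phi>"
      unfolding \<Phi>_def using s by (intro nn_integral_cong) (auto simp: gs Qs indicator_def mult_less_cancel_left1)
    also have "sqrt s ^ ?k = s powr (real ?k / 2)"
      using s by (simp add: powr_half_sqrt[symmetric] powr_realpow[symmetric] powr_powr)
    finally show ?thesis .
  qed
  have e1: "emeasure ?M1 {x<..} = (if x < 0 then ennreal ((-x) powr (real ?k / 2)) * \<Phi> else 0)" for x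
  proof -
    have "emeasure ?M1 {x<..} = (\<integral>\<^sup>+z. g z * indicator ((\<lambda>z. - Q z) -` {x<..} \<inter> space ?L) z \<partial>?L)"
      by (subst emeasure_distr) (auto intro!: emeasure_density)
    also have "\<dots> = (\<integral>\<^sup>+z. g z * indicator {..<-x} (Q z) \<partial>?L)"
      by (intro nn_integral_cong) (auto simp: indicator_def)
    also have "\<dots> = (if x < 0 then ennreal ((-x) powr (real ?k / 2)) * \<Phi> else 0)"
    proof (cases "x < 0")
      case True then show ?thesis using hom[of "-x"] by simp
    next
      case False
      then have "indicator {..<-x} (Q z) = (0::ennreal)" for z using Q0[of z] by (auto simp: indicator_def)
      then show ?thesis using False by simp
    qed
    finally show ?thesis .
  qed
  have e2: "emeasure ?M2 {x<..} = (if x < 0 then ennreal ((-x) powr (real ?k / 2)) * \<Phi> else 0)" for x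
  proof -
    have "uminus -` {x<..} = {..<-x}" by auto
    then have "emeasure ?M2 {x<..} = (\<integral>\<^sup>+u. \<Phi> * ?r u * indicator {..<-x} u \<partial>lborel)"
      by (subst emeasure_distr) (auto intro!: emeasure_density)
    also have "\<dots> = (\<integral>\<^sup>+u. \<Phi> * (?r u * indicator {..<-x} u) \<partial>lborel)"
      by (simp add: mult.assoc)
    also have "\<dots> = \<Phi> * (\<integral>\<^sup>+u. ?r u * indicator {..<-x} u \<partial>lborel)"
      by (intro nn_integral_cmult) measurable
    also have "\<dots> = (if x < 0 then ennreal ((-x) powr (real ?k / 2)) * \<Phi> else 0)"
    proof (cases "x < 0")
      case True then show ?thesis using nn_integral_powr_from_0[of ?k "-x"] J by (simp add: mult.commute)
    next
      case False
      then have zero: "?r u * indicator {..<-x} u = (0::ennreal)" for u by (auto simp: indicator_def)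
      have "(\<integral>\<^sup>+u. ?r u * indicator {..<-x} u \<partial>lborel) = (\<integral>\<^sup>+(u::real). 0 \<partial>lborel)"
        by (rule nn_integral_cong) (rule zero)
      then show ?thesis using False by simp
    qed
    finally show ?thesis .
  qed
  have "?M1 = ?M2"
    using fin by (intro measure_eqI_lessThan) (auto simp: e1 e2 \<Phi>_def[symmetric] ennreal_mult_less_top)
  then have "(\<integral>\<^sup>+u. h (- u) \<partial>?M1) = (\<integral>\<^sup>+u. h (- u) \<partial>?M2)" by simp
  then have "(\<integral>\<^sup>+z. g z * h (Q z) \<partial>?L) = (\<integral>\<^sup>+u. \<Phi> * ?r u * h u \<partial>lborel)"
    by (simp add: nn_integral_distr nn_integral_density)
  also have "\<dots> = \<Phi> * (\<integral>\<^sup>+u. ?r u * h u \<partial>lborel)"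
    by (subst nn_integral_cmult[symmetric]) (auto simp: mult.assoc)
  finally show ?thesis unfolding \<Phi>_def .
qed

text \<open>Basu's theorem for one row: \<open>\<beta> u u\<close> is chi-square distributed and independent of every
  function of \<open>u\<close> that is invariant under scaling and under the null space of \<open>\<beta>\<close>.\<close>

lemma gauss_rep_chi_square:
  fixes G :: "('k \<Rightarrow> real) \<Rightarrow> ennreal"
  assumes psd: "psd_form K \<beta>" and rep: "gauss_rep K \<gamma> \<beta> J" and J: "card J > 0"
    and prob: "prob_space \<gamma>" and sets: "sets \<gamma> = sets (PiM K (\<lambda>_. lborel))"
    and G: "G \<in> borel_measurable (PiM K (\<lambda>_. lborel))" and G1: "\<And>u. G u \<le> 1"
    and inv: "null_inv \<beta> G" and scale: "\<And>c u. c > 0 \<Longrightarrow> G (\<lambda>k. c * u k) = G u"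
    and h[measurable]: "h \<in> borel_measurable borel"
  shows "(\<integral>\<^sup>+u. G u * h (\<beta> u u) \<partial>\<gamma>) = (\<integral>\<^sup>+u. G u \<partial>\<gamma>) * (\<integral>\<^sup>+x. h x \<partial>chi_square (card J))"
proof -
  interpret psd_form K \<beta> by fact
  interpret \<gamma>: prob_space \<gamma> by fact
  interpret C: prob_space "chi_square (card J)" using J by (rule prob_space_chi_square)
  let ?L = "PiM J (\<lambda>_. lborel :: real measure)" and ?k = "card J"
  let ?Q = "\<lambda>z. \<beta> (ext0 J z) (ext0 J z)"
  have JK: "J \<subseteq> K" using rep unfolding gauss_rep_def by (rule conjunct1)
  have finJ: "finite J" using J card_gt_0_iff by blast
  obtain c where c: "c > 0" and rep': "\<And>F. F \<in> borel_measurable (PiM K (\<lambda>_. lborel)) \<Longrightarrow>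
      null_inv \<beta> F \<Longrightarrow> (\<integral>\<^sup>+u. F u \<partial>\<gamma>) = ennreal c *
        (\<integral>\<^sup>+z. F (ext0 J z) * ennreal (exp (- ?Q z / 2)) \<partial>?L)"
    using rep[unfolded gauss_rep_def, THEN conjunct2, THEN conjunct2] by blast
  have Q[measurable]: "?Q \<in> borel_measurable ?L"
    by (rule borel_measurable_form) (rule measurable_ext0_component)+
  have \<beta>m[measurable]: "(\<lambda>u. \<beta> u u) \<in> borel_measurable (PiM K (\<lambda>_. lborel))"
    by (rule borel_measurable_form) simp_all
  have "(\<integral>\<^sup>+u. 1 \<partial>\<gamma>) = ennreal c * (\<integral>\<^sup>+z. 1 * ennreal (exp (- ?Q z / 2)) \<partial>?L)"
    by (rule rep') (auto simp: null_inv_def)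
  then have "ennreal c * (\<integral>\<^sup>+z. ennreal (exp (- ?Q z / 2)) \<partial>?L) = 1"
    by (simp add: \<gamma>.emeasure_space_1)
  then have fin1: "(\<integral>\<^sup>+z. ennreal (exp (- ?Q z / 2)) \<partial>?L) < \<infinity>"
    using c by (auto simp: less_top[symmetric] ennreal_mult_top)
  have Qs: "?Q (\<lambda>j\<in>J. a * z j) = a\<^sup>2 * ?Q z" for a z
  proof -
    have "ext0 J (\<lambda>j\<in>J. a * z j) = (\<lambda>k. a * ext0 J z k)" by (auto simp: ext0_def)
    then show ?thesis by (simp add: scale_left scale_right power2_eq_square)
  qed
  have inv\<beta>: "\<beta> u u = \<beta> v v" if "\<beta> (\<lambda>k. u k - v k) (\<lambda>k. u k - v k) = 0" for u v
    using null_right[OF that, of u] null_right[OF that, of v] sym[of u v] by (simp add: diff_right)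
  \<comment> \<open>The factor in front of the chi-square integral does not depend on
    \<open>h'\<close>. Comparing \<open>h\<close> with the constant 1 eliminates it, so neither
    \<open>c\<close> nor the mass of the unit ball has to be evaluated.\<close>
  have main: "(\<integral>\<^sup>+u. G' u * h' (\<beta> u u) \<partial>\<gamma>) = ennreal c * (\<integral>\<^sup>+z. G' (ext0 J z) * indicator {..<1} (?Q z) \<partial>?L) *
      (ennreal (real ?k / 2) * (ennreal (2 powr (real ?k / 2) * Gamma (real ?k / 2)) * (\<integral>\<^sup>+x. h' x \<partial>chi_square ?k)))"
    if [measurable]: "h' \<in> borel_measurable borel" and G'[measurable]: "G' \<in> borel_measurable (PiM K (\<lambda>_. lborel))"
      and G1': "\<And>u. G' u \<le> 1" and inv': "null_inv \<beta> G'" and scale': "\<And>c u. c > 0 \<Longrightarrow> G' (\<lambda>k. c * u k) = G' u"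
    for h' and G' :: "('k \<Rightarrow> real) \<Rightarrow> ennreal"
  proof -
    have gm[measurable]: "(\<lambda>z. G' (ext0 J z)) \<in> borel_measurable ?L"
      by (rule measurable_ext0[OF inv' psd JK G'])
    have gs: "G' (ext0 J (\<lambda>j\<in>J. a * z j)) = G' (ext0 J z)" if "a > 0" for a z
    proof -
      have "ext0 J (\<lambda>j\<in>J. a * z j) = (\<lambda>k. a * ext0 J z k)" by (auto simp: ext0_def)
      then show ?thesis using scale'[OF that] by simp
    qed
    \<comment> \<open>Where the form is below 1, the Gaussian weight is at least
      \<open>exp (- 1 / 2)\<close>; so normalisability of the Gaussian bounds this mass.\<close>
    have "(\<integral>\<^sup>+z. G' (ext0 J z) * indicator {..<1} (?Q z) \<partial>?L)
        \<le> (\<integral>\<^sup>+z. ennreal (exp (1/2)) * ennreal (exp (- ?Q z / 2)) \<partial>?L)"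
    proof (rule nn_integral_mono)
      fix z
      have "G' (ext0 J z) * indicator {..<1} (?Q z) \<le> indicator {..<1} (?Q z)"
        using mult_right_mono[OF G1', of "indicator {..<1} (?Q z)"] by simp
      also have "\<dots> \<le> ennreal (exp (1/2) * exp (- ?Q z / 2))"
        unfolding exp_add[symmetric] by (auto simp: indicator_def simp flip: ennreal_1)
      finally show "G' (ext0 J z) * indicator {..<1} (?Q z) \<le> ennreal (exp (1/2)) * ennreal (exp (- ?Q z / 2))"
        by (simp add: ennreal_mult)
    qed
    also have "\<dots> = ennreal (exp (1/2)) * (\<integral>\<^sup>+z. ennreal (exp (- ?Q z / 2)) \<partial>?L)"
      by (intro nn_integral_cmult) measurable
    also have "\<dots> < \<infinity>" using fin1 by (simp add: ennreal_mult_less_top)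
    finally have fin: "(\<integral>\<^sup>+z. G' (ext0 J z) * indicator {..<1} (?Q z) \<partial>?L) < \<infinity>" .
    have "(\<integral>\<^sup>+u. G' u * h' (\<beta> u u) \<partial>\<gamma>)
        = ennreal c * (\<integral>\<^sup>+z. G' (ext0 J z) * h' (?Q z) * ennreal (exp (- ?Q z / 2)) \<partial>?L)"
    proof (rule rep')
      show "null_inv \<beta> (\<lambda>u. G' u * h' (\<beta> u u))"
        unfolding null_inv_def
      proof (intro allI impI)
        fix u v assume "\<beta> (\<lambda>k. u k - v k) (\<lambda>k. u k - v k) = 0"
        from null_inv_cong[OF inv' this] inv\<beta>[OF this]
        show "G' u * h' (\<beta> u u) = G' v * h' (\<beta> v v)" by simp
      qed
    qed measurable
    also have "(\<integral>\<^sup>+z. G' (ext0 J z) * h' (?Q z) * ennreal (exp (- ?Q z / 2)) \<partial>?L)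
        = (\<integral>\<^sup>+z. G' (ext0 J z) * (\<lambda>x. h' x * ennreal (exp (- x / 2))) (?Q z) \<partial>?L)"
      by (simp add: mult.assoc)
    also have "\<dots> = (\<integral>\<^sup>+z. G' (ext0 J z) * indicator {..<1} (?Q z) \<partial>?L) *
      (\<integral>\<^sup>+u. ennreal (if 0 < u then real ?k / 2 * u powr (real ?k / 2 - 1) else 0) *
        (h' u * ennreal (exp (- u / 2))) \<partial>lborel)"
      by (rule nn_integral_radial[OF finJ J]) (use nonneg Qs gs fin in auto)
    also have "(\<integral>\<^sup>+u. ennreal (if 0 < u then real ?k / 2 * u powr (real ?k / 2 - 1) else 0) *
        (h' u * ennreal (exp (- u / 2))) \<partial>lborel)
      = (\<integral>\<^sup>+u. ennreal (real ?k / 2) * (ennreal (if 0 < u then u powr (real ?k / 2 - 1) else 0) *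
        (h' u * ennreal (exp (- u / 2)))) \<partial>lborel)"
      by (intro nn_integral_cong) (auto simp: mult.assoc[symmetric] ennreal_mult[symmetric])
    also have "\<dots> = ennreal (real ?k / 2) * (\<integral>\<^sup>+u. ennreal (if 0 < u then u powr (real ?k / 2 - 1) else 0) *
        (h' u * ennreal (exp (- u / 2))) \<partial>lborel)"
      by (intro nn_integral_cmult) measurable
    also have "(\<integral>\<^sup>+u. ennreal (if 0 < u then u powr (real ?k / 2 - 1) else 0) *
        (h' u * ennreal (exp (- u / 2))) \<partial>lborel)
      = ennreal (2 powr (real ?k / 2) * Gamma (real ?k / 2)) * (\<integral>\<^sup>+x. h' x \<partial>chi_square ?k)"
      by (rule nn_integral_chi_square[OF J]) measurable
    finally show ?thesis by (simp add: mult.assoc)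
  qed
  have "(\<integral>\<^sup>+u. G u \<partial>\<gamma>) = ennreal c * (\<integral>\<^sup>+z. G (ext0 J z) * indicator {..<1} (?Q z) \<partial>?L) *
      (ennreal (real ?k / 2) * ennreal (2 powr (real ?k / 2) * Gamma (real ?k / 2)))"
    using main[of "\<lambda>_. 1" G] G G1 inv scale C.emeasure_space_1 by simp
  then show ?thesis
    using main[of h G] G G1 inv scale h by (simp add: mult.assoc)
qed

text \<open>
  Iterating the one-row statement from the last row to the first: the pivots are independent, and
  independent of every statistic \<open>H\<close> that is invariant under the row operations.
\<close>

lemma pivots_chi_square:
  fixes H :: "(nat \<Rightarrow> 'k \<Rightarrow> real) \<Rightarrow> ennreal"
  assumes psd: "psd_form K \<beta>" and rep: "gauss_rep K \<gamma> \<beta> J" and J: "p \<le> card J"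
    and prob: "prob_space \<gamma>" and sets: "sets \<gamma> = sets (PiM K (\<lambda>_. lborel))"
    and H[measurable]: "H \<in> borel_measurable (PiM {..<p} (\<lambda>_. \<gamma>))" and H1: "\<And>y. H y \<le> 1"
    and inv: "\<And>y v w c i. i < p \<Longrightarrow> c > 0 \<Longrightarrow>
      row_form \<beta> y i (\<lambda>k. v k - c * w k) (\<lambda>k. v k - c * w k) = 0 \<Longrightarrow> H (y(i := v)) = H (y(i := w))"
    and h[measurable]: "\<And>i. i < p \<Longrightarrow> h i \<in> borel_measurable borel"
    and h0: "\<And>i u. i < p \<Longrightarrow> u \<le> 0 \<Longrightarrow> h i u = 0"
  shows "(\<integral>\<^sup>+y. H y * (\<Prod>i<p. h i (pivot \<beta> y i)) \<partial>PiM {..<p} (\<lambda>_. \<gamma>))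
    = (\<integral>\<^sup>+y. H y \<partial>PiM {..<p} (\<lambda>_. \<gamma>)) * (\<Prod>i<p. \<integral>\<^sup>+x. h i x \<partial>chi_square (card J - i))"
proof -
  interpret psd_form K \<beta> by fact
  interpret \<gamma>: prob_space \<gamma> by fact
  interpret P: product_prob_space "\<lambda>_. \<gamma>" UNIV by standard
  note [measurable_cong] = sets
  have comp: "(\<lambda>y. y l k) \<in> borel_measurable (PiM I (\<lambda>_. \<gamma>))" if "l \<in> I" "k \<in> K" for l k and I :: "nat set"
  proof -
    have "(\<lambda>u. u k) \<in> borel_measurable \<gamma>" using that(2) by measurable
    from measurable_compose[OF measurable_component_singleton[OF that(1)] this] show ?thesis .
  qed
  have piv[measurable]: "(\<lambda>y. pivot \<beta> y i) \<in> borel_measurable (PiM {..<p} (\<lambda>_. \<gamma>))" if "i < p" for i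
    using that by (intro borel_measurable_pivot comp) auto
  have "(\<integral>\<^sup>+y. H y * (\<Prod>i<m. h i (pivot \<beta> y i)) \<partial>PiM {..<p} (\<lambda>_. \<gamma>))
    = (\<integral>\<^sup>+y. H y \<partial>PiM {..<p} (\<lambda>_. \<gamma>)) * (\<Prod>i<m. \<integral>\<^sup>+x. h i x \<partial>chi_square (card J - i))" if "m \<le> p" for m
    using that
  proof (induction m)
    case 0
    then show ?case by simp
  next
    case (Suc m)
    define I where "I = {..<p} - {m}"
    have m: "m < p" using Suc.prems by simp
    have ins: "{..<p} = insert m I" using m by (auto simp: I_def)
    have mI: "m \<notin> I" "finite I" by (auto simp: I_def)
    note [measurable] = h[OF m]
    let ?F = "\<lambda>y. H y * (\<Prod>i<m. h i (pivot \<beta> y i))"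
    have Fm: "?F \<in> borel_measurable (PiM {..<p} (\<lambda>_. \<gamma>))"
      using m by (intro borel_measurable_times_ennreal borel_measurable_prod_ennreal
        measurable_compose[OF piv h] H) auto
    have Fm': "(\<lambda>y. ?F y * h m (pivot \<beta> y m)) \<in> borel_measurable (PiM {..<p} (\<lambda>_. \<gamma>))"
      using m by (intro borel_measurable_times_ennreal Fm measurable_compose[OF piv h]) auto
    \<comment> \<open>With the other rows fixed, the earlier pivots are constants and the form
      eliminated by the rows before \<open>m\<close> is a fixed form, so row \<open>m\<close> alone
      faces the one-row statement.\<close>
    have inner: "(\<integral>\<^sup>+v. ?F (y(m := v)) * h m (pivot \<beta> (y(m := v)) m) \<partial>\<gamma>)
        = (\<integral>\<^sup>+v. ?F (y(m := v)) \<partial>\<gamma>) * (\<integral>\<^sup>+x. h m x \<partial>chi_square (card J - m))"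
      if y: "y \<in> space (PiM I (\<lambda>_. \<gamma>))" for y
    proof -
      let ?C = "\<Prod>i<m. h i (pivot \<beta> y i)"
      have pc: "pivot \<beta> (y(m := v)) i = pivot \<beta> y i" if "i < m" for i v
        using that row_form_cong[of i "y(m := v)" y \<beta>] by (simp add: pivot_def)
      have pm: "pivot \<beta> (y(m := v)) m = row_form \<beta> y m v v" for v
        using row_form_cong[of m "y(m := v)" y \<beta>] by (simp add: pivot_def)
      have FC: "?F (y(m := v)) = ?C * H (y(m := v))" for v
        using pc by (simp add: mult.commute)
      have upd: "(\<lambda>v. y(m := v)) \<in> PiM K (\<lambda>_. lborel) \<rightarrow>\<^sub>M PiM {..<p} (\<lambda>_. \<gamma>)"
        unfolding ins using measurable_component_update[OF y mI(1)] by (simp cong: measurable_cong_sets)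
      have Hm[measurable]: "(\<lambda>v. H (y(m := v))) \<in> borel_measurable (PiM K (\<lambda>_. lborel))"
        by (rule measurable_compose[OF upd H])
      interpret R: psd_form K "row_form \<beta> y m" by (rule psd_form_row_form)
      have Rm[measurable]: "(\<lambda>v. row_form \<beta> y m v v) \<in> borel_measurable (PiM K (\<lambda>_. lborel))"
        by (rule R.borel_measurable_form) simp_all
      show ?thesis
      \<comment> \<open>If an earlier pivot fails to be positive, the rank is not under control, but
        then the product of the \<open>h i\<close> is zero; this is why they have to vanish at
        nonpositive arguments.\<close>
      proof (cases "\<forall>i<m. pivot \<beta> y i > 0")
        case False
        then obtain i where "i < m" "pivot \<beta> y i \<le> 0" by force
        then have C0: "?C = 0" using h0[of i] m by (intro prod_zero) auto
        show ?thesis unfolding FC C0 by simp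
      next
        case True
        then obtain J' where J': "card J' + m = card J" "gauss_rep K \<gamma> (row_form \<beta> y m) J'"
          using gauss_rep_row_form[OF rep, of m y] by blast
        have "(\<integral>\<^sup>+v. H (y(m := v)) * h m (row_form \<beta> y m v v) \<partial>\<gamma>)
            = (\<integral>\<^sup>+v. H (y(m := v)) \<partial>\<gamma>) * (\<integral>\<^sup>+x. h m x \<partial>chi_square (card J'))"
        proof (rule gauss_rep_chi_square[OF R.psd_form_axioms J'(2) _ prob sets])
          show "card J' > 0" using J'(1) J m by simp
          show "null_inv (row_form \<beta> y m) (\<lambda>v. H (y(m := v)))"
            unfolding null_inv_def
          proof (intro allI impI)
            fix u v assume "row_form \<beta> y m (\<lambda>k. u k - v k) (\<lambda>k. u k - v k) = 0"
            then show "H (y(m := u)) = H (y(m := v))" using m by (intro inv[of m 1]) auto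
          qed
          show "H (y(m := \<lambda>k. c * u k)) = H (y(m := u))" if "c > 0" for c u
            using m that R.zero_left by (intro inv[of m c]) auto
        qed (use H1 h[OF m] in measurable)
        then have "?C * (\<integral>\<^sup>+v. H (y(m := v)) * h m (row_form \<beta> y m v v) \<partial>\<gamma>)
            = ?C * (\<integral>\<^sup>+v. H (y(m := v)) \<partial>\<gamma>) * (\<integral>\<^sup>+x. h m x \<partial>chi_square (card J - m))"
          using J'(1) by (simp add: mult.assoc flip: J'(1))
        then show ?thesis
          unfolding FC pm by (simp add: nn_integral_cmult mult.assoc)
      qed
    qed
    have "(\<integral>\<^sup>+y. H y * (\<Prod>i<Suc m. h i (pivot \<beta> y i)) \<partial>PiM {..<p} (\<lambda>_. \<gamma>))
        = (\<integral>\<^sup>+y. ?F y * h m (pivot \<beta> y m) \<partial>PiM {..<p} (\<lambda>_. \<gamma>))"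
      by (simp add: mult.assoc)
    also have "\<dots> = (\<integral>\<^sup>+y. (\<integral>\<^sup>+v. ?F (y(m := v)) * h m (pivot \<beta> (y(m := v)) m) \<partial>\<gamma>) \<partial>PiM I (\<lambda>_. \<gamma>))"
      using Fm' unfolding ins by (subst P.product_nn_integral_insert[OF mI(2,1)]) auto
    also have "\<dots> = (\<integral>\<^sup>+y. (\<integral>\<^sup>+v. ?F (y(m := v)) \<partial>\<gamma>) * (\<integral>\<^sup>+x. h m x \<partial>chi_square (card J - m)) \<partial>PiM I (\<lambda>_. \<gamma>))"
      by (rule nn_integral_cong) (rule inner)
    also have "\<dots> = (\<integral>\<^sup>+y. (\<integral>\<^sup>+v. ?F (y(m := v)) \<partial>\<gamma>) \<partial>PiM I (\<lambda>_. \<gamma>)) * (\<integral>\<^sup>+x. h m x \<partial>chi_square (card J - m))"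
    proof (rule nn_integral_multc)
      have [measurable]: "?F \<in> borel_measurable (PiM (insert m I) (\<lambda>_. \<gamma>))" using Fm unfolding ins[symmetric] .
      show "(\<lambda>y. \<integral>\<^sup>+v. ?F (y(m := v)) \<partial>\<gamma>) \<in> borel_measurable (PiM I (\<lambda>_. \<gamma>))"
        by measurable
    qed
    also have "(\<integral>\<^sup>+y. (\<integral>\<^sup>+v. ?F (y(m := v)) \<partial>\<gamma>) \<partial>PiM I (\<lambda>_. \<gamma>)) = (\<integral>\<^sup>+y. ?F y \<partial>PiM {..<p} (\<lambda>_. \<gamma>))"
      using Fm unfolding ins by (subst P.product_nn_integral_insert[OF mI(2,1)]) auto
    also have "\<dots> = (\<integral>\<^sup>+y. H y \<partial>PiM {..<p} (\<lambda>_. \<gamma>)) * (\<Prod>i<m. \<integral>\<^sup>+x. h i x \<partial>chi_square (card J - i))"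
      using Suc by simp
    finally show ?case by (simp add: mult.assoc)
  qed
  then show ?thesis by blast
qed

text \<open>Each elimination splits off one rank-one term; at a zero pivot the term and the Schur
  correction vanish together, both by division by zero.\<close>

lemma row_form_expand:
  "\<beta> u v = (\<Sum>i<m. row_form \<beta> y i u (y i) * row_form \<beta> y i v (y i) / pivot \<beta> y i) + row_form \<beta> y m u v"
  by (induction m) (auto simp: schur_def pivot_def)

text \<open>The factorisation \<open>A = L D L\<^sup>T\<close> of the Gram matrix.\<close>

lemma (in psd_form) det_Gram:
  assumes pos: "\<And>i. i < p \<Longrightarrow> pivot \<beta> y i > 0"
  shows "Determinant.det (Matrix.mat p p (\<lambda>(r, s). \<beta> (y r) (y s))) = (\<Prod>i<p. pivot \<beta> y i)"
proof -
  let ?a = "\<lambda>i r. row_form \<beta> y i (y r) (y i)"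
  \<comment> \<open>Dividing the columns by the pivots puts ones on the diagonal of
    \<open>?L\<close>, so all pivots sit on the diagonal of \<open>?U\<close>. Both are triangular
    because a row is null for every form that has eliminated it.\<close>
  let ?L = "Matrix.mat p p (\<lambda>(r, i). ?a i r / pivot \<beta> y i)"
  let ?U = "Matrix.mat p p (\<lambda>(i, s). ?a i s)"
  have nz: "pivot \<beta> y i \<noteq> 0" if "i < p" for i using pos[OF that] by simp
  have null: "row_form \<beta> y i (y r) v = 0" if "r < i" for i r v
  proof -
    interpret R: psd_form K "row_form \<beta> y i" by (rule psd_form_row_form)
    show ?thesis by (rule R.null_left) (rule row_form_row_null[OF that])
  qed
  have "Matrix.mat p p (\<lambda>(r, s). \<beta> (y r) (y s)) = ?L * ?U"
  proof (rule eq_matI)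
    fix r s assume rs: "r < dim_row (?L * ?U)" "s < dim_col (?L * ?U)"
    have "\<beta> (y r) (y s) = (\<Sum>i<p. ?a i r * ?a i s / pivot \<beta> y i)"
      using row_form_expand[of \<beta> "y r" "y s" y p] null[of r p] rs by simp
    also have "\<dots> = (?L * ?U) $$ (r, s)"
      using rs by (simp add: scalar_prod_def lessThan_atLeast0)
    finally show "Matrix.mat p p (\<lambda>(r, s). \<beta> (y r) (y s)) $$ (r, s) = (?L * ?U) $$ (r, s)"
      using rs by simp
  qed auto
  then have "Determinant.det (Matrix.mat p p (\<lambda>(r, s). \<beta> (y r) (y s))) = Determinant.det ?L * Determinant.det ?U"
    by (simp add: det_mult[of _ p])
  also have "Determinant.det ?L = prod_list (diag_mat ?L)"
    by (rule det_lower_triangular[of p]) (auto simp: null)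
  also have "diag_mat ?L = map (\<lambda>i. 1) [0..<p]"
    using nz by (auto simp: diag_mat_def pivot_def[symmetric])
  also have "prod_list \<dots> = 1" by (simp add: prod.distinct_set_conv_list[symmetric])
  also have "Determinant.det ?U = prod_list (diag_mat ?U)"
    by (rule det_upper_triangular[of _ p]) (auto simp: null upper_triangular_def)
  also have "diag_mat ?U = map (\<lambda>i. pivot \<beta> y i) [0..<p]"
    by (auto simp: diag_mat_def pivot_def)
  also have "prod_list \<dots> = (\<Prod>i<p. pivot \<beta> y i)"
    by (simp add: prod.distinct_set_conv_list[symmetric] lessThan_atLeast0)
  finally show ?thesis by simp
qed

section \<open>Polygamma bounds\<close>

lemma sums_telescope_shift:
  fixes f :: "real \<Rightarrow> real"
  assumes "(f \<longlongrightarrow> 0) at_top"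
  shows "(\<lambda>k. f (x + real k) - f (x + real (Suc k))) sums f x"
proof -
  have "filterlim (\<lambda>k. x + real k) at_top sequentially" by real_asymp
  from filterlim_compose[OF assms this] have "(\<lambda>k. f (x + real k)) \<longlonglongrightarrow> 0" .
  from telescope_sums'[OF this] show ?thesis by simp
qed

text \<open>Termwise comparison with telescoping series: \<open>1 / a - 1 / (a + 1)\<close> lies
  below \<open>1 / a ^ 2\<close>, and adding \<open>1 / a ^ 2 - 1 / (a + 1) ^ 2\<close> lifts it
  above.\<close>

lemma sums_inverse_square_le:
  assumes "x > 0" and "(\<lambda>k. inverse ((x + real k) ^ 2)) sums s"
  shows "1 / x \<le> s" "s \<le> 1 / x + 1 / x ^ 2"
proof -
  have t1: "(\<lambda>k. 1 / (x + real k) - 1 / (x + real (Suc k))) sums (1 / x)"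
    by (rule sums_telescope_shift) real_asymp
  have t2: "(\<lambda>k. 1 / (x + real k) ^ 2 - 1 / (x + real (Suc k)) ^ 2) sums (1 / x ^ 2)"
    by (rule sums_telescope_shift) real_asymp
  show "1 / x \<le> s"
  proof (rule sums_le[OF _ t1 assms(2)])
    fix k
    define a where "a = x + real k"
    have a: "a > 0" using assms(1) by (simp add: a_def)
    have "1 / a - 1 / (a + 1) = 1 / (a * (a + 1))" using a by (simp add: field_simps)
    also have "\<dots> \<le> 1 / (a * a)" using a by (intro divide_left_mono mult_left_mono) auto
    finally have "1 / a - 1 / (a + 1) \<le> inverse (a ^ 2)"
      by (simp add: inverse_eq_divide power2_eq_square)
    then show "1 / (x + real k) - 1 / (x + real (Suc k)) \<le> inverse ((x + real k) ^ 2)"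
      by (simp add: a_def add_ac)
  qed
  show "s \<le> 1 / x + 1 / x ^ 2"
  proof (rule sums_le[OF _ assms(2) sums_add[OF t1 t2]])
    fix k
    define a where "a = x + real k"
    have a: "a > 0" using assms(1) by (simp add: a_def)
    have "1 / (a + 1) ^ 2 \<le> 1 / (a * (a + 1))"
      using a by (intro divide_left_mono) (auto simp: power2_eq_square)
    also have "\<dots> = 1 / a - 1 / (a + 1)" using a by (simp add: field_simps)
    finally have "inverse (a ^ 2) \<le> 1 / a - 1 / (a + 1) + (1 / a ^ 2 - 1 / (a + 1) ^ 2)"
      by (simp add: inverse_eq_divide)
    then show "inverse ((x + real k) ^ 2) \<le> 1 / (x + real k) - 1 / (x + real (Suc k))
        + (1 / (x + real k) ^ 2 - 1 / (x + real (Suc k)) ^ 2)"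
      by (simp add: a_def add_ac)
  qed
qed

lemma trigamma_bounds:
  fixes x :: real
  assumes "x > 0"
  shows "1 / x \<le> Polygamma 1 x" "Polygamma 1 x \<le> 1 / x + 1 / x ^ 2"
proof -
  have "(\<lambda>k. inverse ((x + real k) ^ 2)) sums Polygamma 1 x"
    using Polygamma_LIMSEQ[of x 1] assms by (simp add: numeral_2_eq_2)
  from sums_inverse_square_le[OF assms this]
  show "1 / x \<le> Polygamma 1 x" "Polygamma 1 x \<le> 1 / x + 1 / x ^ 2" .
qed

text \<open>One factor of each cube is bounded by \<open>1 / x\<close>, which leaves the trigamma
  series at a real point. For \<open>x \<ge> 1/2\<close> one has
  \<open>1 / x + 1 / x ^ 2 \<le> 3 / x\<close>, and the factor 2! in \<open>Polygamma 2\<close>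
  doubles the constant.\<close>

lemma norm_Polygamma_2_le:
  fixes z :: complex
  assumes "Re z \<ge> x" and x: "x \<ge> 1/2"
  shows "norm (Polygamma 2 z) \<le> 6 / x ^ 2"
proof -
  have z: "z \<noteq> 0" using assms by auto
  let ?s = "Polygamma 1 x"
  have s: "(\<lambda>k. inverse ((x + real k) ^ 2)) sums ?s"
    using Polygamma_LIMSEQ[of x 1] assms by (simp add: numeral_2_eq_2)
  have le: "norm (inverse ((z + of_nat k) ^ Suc 2)) \<le> 1 / x * inverse ((x + real k) ^ 2)" for k
  proof -
    have "x + real k \<le> Re (z + of_nat k)" using assms by simp
    also have "\<dots> \<le> norm (z + of_nat k)" by (rule complex_Re_le_cmod)
    finally have n: "x + real k \<le> norm (z + of_nat k)" .
    have "norm (inverse ((z + of_nat k) ^ Suc 2)) = inverse (norm (z + of_nat k) ^ 3)"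
      by (simp add: norm_inverse norm_power eval_nat_numeral norm_mult)
    also have "\<dots> \<le> inverse ((x + real k) ^ 3)"
      using n x by (intro le_imp_inverse_le power_mono) auto
    also have "\<dots> = inverse (x + real k) * inverse ((x + real k) ^ 2)"
      by (simp add: eval_nat_numeral)
    also have "\<dots> \<le> inverse x * inverse ((x + real k) ^ 2)"
      using x by (intro mult_right_mono le_imp_inverse_le) auto
    finally show ?thesis by (simp add: inverse_eq_divide)
  qed
  have "norm (\<Sum>k. inverse ((z + of_nat k) ^ Suc 2)) \<le> (\<Sum>k. 1 / x * inverse ((x + real k) ^ 2))"
    using s by (intro norm_suminf_le le summable_mult) (auto simp: sums_iff)
  also have "\<dots> = 1 / x * ?s" using sums_mult[OF s, of "1 / x"] by (simp add: sums_iff)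
  also have "\<dots> \<le> 1 / x * (1 / x + 1 / x ^ 2)"
    using x trigamma_bounds(2)[of x] by (intro mult_left_mono) auto
  also have "\<dots> \<le> 3 / x ^ 2"
    using x by (simp add: field_simps power2_eq_square)
  finally have "norm (\<Sum>k. inverse ((z + of_nat k) ^ Suc 2)) \<le> 3 / x ^ 2" .
  then show ?thesis by (simp add: Polygamma_def norm_mult)
qed

text \<open>The digamma function has increment \<open>1 / a\<close>; compare it with
  \<open>ln a - 1 / (2 * a)\<close>. The defect \<open>?t a\<close> is the error of the trapezoidal
  rule for the integral of \<open>1 / x\<close> over a unit interval, hence nonpositive by
  convexity, and the midpoint rule bounds it from below.\<close>

lemma digamma_bounds:
  fixes x :: real
  assumes x: "x > 0"
  shows "Digamma x \<le> ln x - 1 / (2 * x)" "ln x - 1 / (2 * x) - 1 / x ^ 2 \<le> Digamma x"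
proof -
  let ?f = "\<lambda>x::real. ln x - 1 / (2 * x)"
  let ?t = "\<lambda>a::real. ?f (a + 1) - ?f a - 1 / a"
  have t: "?t a \<le> 0" "- (1 / a ^ 2 - 1 / (a + 1) ^ 2) \<le> ?t a" if a: "a > 0" for a
  proof -
    have teq: "?t a = ln (a + 1) - ln a - (1 / a + 1 / (a + 1)) / 2"
    proof -
      have "1 / (2 * x) = (1 / x) / 2" for x :: real by simp
      moreover have "A - C / 2 - (B - D / 2) - D = A - B - (D + C) / 2" for A B C D :: real
        by (simp add: field_simps)
      ultimately show ?thesis by (simp only:)
    qed
    show "?t a \<le> 0"
      unfolding teq using ln_inverse_approx_le[of a 1] a by (simp add: inverse_eq_divide)
    \<comment> \<open>Trapezoidal minus midpoint value, to be dominated by a term that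
      telescopes.\<close>
    have "(1 / a + 1 / (a + 1)) / 2 - 2 / (2 * a + 1) = 1 / (2 * a * (a + 1) * (2 * a + 1))"
      using a by (simp add: divide_simps) (simp add: algebra_simps)
    also have "\<dots> \<le> 1 / a ^ 2 - 1 / (a + 1) ^ 2"
    proof -
      have "1 / a ^ 2 - 1 / (a + 1) ^ 2 = (2 * a + 1) / (a ^ 2 * (a + 1) ^ 2)"
        using a by (simp add: divide_simps) (simp add: algebra_simps power2_eq_square)
      moreover have "1 / (2 * a * (a + 1) * (2 * a + 1)) \<le> (2 * a + 1) / (a ^ 2 * (a + 1) ^ 2)"
      proof -
        have "a * (a + 1) \<le> (2 * a + 1) * (2 * (2 * a + 1))"
          using a by (simp add: algebra_simps)
        then have "(a * (a + 1)) * (a * (a + 1)) \<le> ((2 * a + 1) * (2 * (2 * a + 1))) * (a * (a + 1))"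
          using a by (intro mult_right_mono) auto
        then show ?thesis
          using a by (simp add: divide_simps) (simp add: algebra_simps power2_eq_square)
      qed
      ultimately show ?thesis by simp
    qed
    finally show "- (1 / a ^ 2 - 1 / (a + 1) ^ 2) \<le> ?t a"
      unfolding teq using ln_inverse_approx_ge[of a "a + 1"] a by (simp add: algebra_simps)
  qed
  let ?S = "\<lambda>m. ln (real m) - (\<Sum>n<m. inverse (x + real n))"
  have S: "?S \<longlonglongrightarrow> Digamma x"
    using Digamma_LIMSEQ[of x] x by simp
  \<comment> \<open>Telescoping: the far end \<open>?f (x + real m)\<close> cancels
    \<open>ln (real m)\<close> in the limit, leaving \<open>?f x\<close> and the accumulated
    defects.\<close>
  have Seq: "?S m = ln (real m) - ?f (x + real m) + ?f x + (\<Sum>n<m. ?t (x + real n))" for m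
    by (induction m) (auto simp: inverse_eq_divide add_ac)
  have lim: "(\<lambda>m. ln (real m) - ?f (x + real m) + ?f x + c) \<longlonglongrightarrow> 0 + ?f x + c" for c
    by (intro tendsto_add tendsto_const) real_asymp
  have "Digamma x \<le> 0 + ?f x + 0"
  proof (rule LIMSEQ_le[OF S lim], intro exI allI impI)
    fix m :: nat
    have "(\<Sum>n<m. ?t (x + real n)) \<le> 0" using x by (intro sum_nonpos t) auto
    then show "?S m \<le> ln (real m) - ?f (x + real m) + ?f x + 0" unfolding Seq by simp
  qed
  then show "Digamma x \<le> ?f x" by simp
  have "0 + ?f x + - (1 / x ^ 2) \<le> Digamma x"
  proof (rule LIMSEQ_le[OF lim S], intro exI allI impI)
    fix m :: nat
    have "(\<Sum>n<m. - (1 / (x + real n) ^ 2 - 1 / (x + real (Suc n)) ^ 2)) \<le> (\<Sum>n<m. ?t (x + real n))"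
      using x t(2)[of "x + real _"] by (intro sum_mono) (auto simp: add_ac)
    moreover have "(\<Sum>n<m. - (1 / (x + real n) ^ 2 - 1 / (x + real (Suc n)) ^ 2))
        = 1 / (x + real m) ^ 2 - 1 / x ^ 2"
      by (induction m) auto
    ultimately have "- (1 / x ^ 2) \<le> (\<Sum>n<m. ?t (x + real n))"
      using x by (smt (verit) zero_le_divide_1_iff zero_le_power2)
    then show "ln (real m) - ?f (x + real m) + ?f x + - (1 / x ^ 2) \<le> ?S m" unfolding Seq by simp
  qed
  then show "?f x - 1 / x ^ 2 \<le> Digamma x" by simp
qed

text \<open>Taylor expansion in the half plane to the right of \<open>x\<close>, a convex set on
  which the third derivative of \<open>ln_Gamma\<close> is uniformly bounded. Along the imaginary
  direction the quadratic term is real and nonpositive: it becomes the Gaussian variance. The value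
  \<open>x = 1/2\<close> is one degree of freedom.\<close>

lemma ln_Gamma_Taylor:
  fixes x \<tau> :: real
  assumes x: "x \<ge> 1/2"
  shows "norm (ln_Gamma (Complex x \<tau>) - (of_real (ln_Gamma x) + \<i> * of_real (\<tau> * Digamma x)
      - of_real (\<tau> ^ 2 * Polygamma 1 x / 2))) \<le> 3 * \<bar>\<tau>\<bar> ^ 3 / x ^ 2"
proof -
  define f :: "nat \<Rightarrow> complex \<Rightarrow> complex" where
    "f = (\<lambda>i. if i = 0 then ln_Gamma else Polygamma (i - 1))"
  let ?S = "{z. Re z \<ge> x}"
  have conv: "convex ?S" by (rule convex_halfspace_Re_ge)
  have nonneg: "z \<notin> \<real>\<^sub>\<le>\<^sub>0" "z \<notin> \<int>\<^sub>\<le>\<^sub>0" if "z \<in> ?S" for z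
  proof -
    show "z \<notin> \<real>\<^sub>\<le>\<^sub>0" using that x by (auto simp: complex_nonpos_Reals_iff)
    then show "z \<notin> \<int>\<^sub>\<le>\<^sub>0" using nonpos_Ints_subset_nonpos_Reals by blast
  qed
  have d: "(f i has_field_derivative f (Suc i) z) (at z within ?S)" if "z \<in> ?S" "i \<le> 2" for i z
    using nonneg[OF that(1)] unfolding f_def
    by (cases i) (auto intro!: derivative_eq_intros)
  have B: "norm (f (Suc 2) z) \<le> 6 / x ^ 2" if "z \<in> ?S" for z
    using norm_Polygamma_2_le[of x z] that x by (simp add: f_def)
  have T: "norm (f 0 (Complex x \<tau>) - (\<Sum>i\<le>2. f i (of_real x) * (Complex x \<tau> - of_real x) ^ i / fact i))
      \<le> 6 / x ^ 2 * norm (Complex x \<tau> - of_real x) ^ Suc 2 / fact 2"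
    by (rule field_Taylor[OF conv d B]) auto
  have d: "Complex x \<tau> - of_real x = \<i> * of_real \<tau>"
    by (simp add: complex_eq_iff)
  have N: "6 / x ^ 2 * norm (\<i> * complex_of_real \<tau>) ^ Suc 2 / fact 2 = 3 * \<bar>\<tau>\<bar> ^ 3 / x ^ 2"
    by (simp add: norm_mult)
  have S: "(\<Sum>i\<le>2. f i (of_real x) * (\<i> * of_real \<tau>) ^ i / fact i)
      = of_real (ln_Gamma x) + \<i> * of_real (\<tau> * Digamma x) - of_real (\<tau> ^ 2 * Polygamma 1 x / 2)"
  proof -
    have "(\<Sum>i\<le>2. f i (of_real x) * (\<i> * of_real \<tau>) ^ i / fact i)
        = f 0 (of_real x) + f 1 (of_real x) * (\<i> * of_real \<tau>) + f 2 (of_real x) * (\<i> * of_real \<tau>) ^ 2 / 2"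
      by (simp add: numeral_2_eq_2)
    also have "f 0 (of_real x) = of_real (ln_Gamma x)"
      using x by (simp add: f_def ln_Gamma_complex_of_real)
    also have "f 1 (of_real x) = of_real (Digamma x)"
      using x by (simp add: f_def Polygamma_of_real)
    also have "f 2 (of_real x) = of_real (Polygamma 1 x)"
      using x by (simp add: f_def Polygamma_of_real)
    finally show ?thesis by (simp add: power_mult_distrib mult_ac)
  qed
  show ?thesis using T unfolding d N S by (simp add: f_def)
qed

lemma abs_diff_le_add:
  fixes X L G e :: real
  assumes "\<bar>X - L\<bar> \<le> A * e" "\<bar>L - G\<bar> \<le> B * e" "A + \<bar>B\<bar> \<le> C" "e \<ge> 0"
  shows "\<bar>X - G\<bar> \<le> C * e"
proof -
  have "\<bar>X - G\<bar> \<le> (A + B) * e" using assms(1,2) unfolding distrib_right by linarith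
  also have "\<dots> \<le> C * e" using assms(3,4) by (intro mult_right_mono) auto
  finally show ?thesis .
qed

text \<open>Each approximant is a difference \<open>G k - G (k - 1)\<close>, so sums over
  consecutive degrees of freedom will telescope. The first \<open>G\<close>,
  \<open>(x - 1/2) * ln (x - 1) - (x - 1)\<close>, is shifted so that the terms of order
  \<open>1 / k\<close> agree; it produces the group part of the centering. The second,
  \<open>x * ln x - x\<close>, misses such a term and serves the pooled matrix. The third is
  \<open>2 * ln x\<close>.\<close>

lemma eventually_digamma_half:
  obtains C k\<^sub>0 where "C > 0" and "k\<^sub>0 \<ge> 4"
    and "\<And>k. k \<ge> k\<^sub>0 \<Longrightarrow> \<bar>Digamma (real k / 2) + ln 2 - (((real k - 1/2) * ln (real k - 1) - (real k - 1))
        - ((real k - 3/2) * ln (real k - 2) - (real k - 2)))\<bar> \<le> C / real k ^ 2"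
    and "\<And>k. k \<ge> k\<^sub>0 \<Longrightarrow> \<bar>Digamma (real k / 2) + ln 2 - ((real k * ln (real k) - real k)
        - ((real k - 1) * ln (real k - 1) - (real k - 1)))\<bar> \<le> C / real k"
    and "\<And>k. k \<ge> k\<^sub>0 \<Longrightarrow> \<bar>Polygamma 1 (real k / 2) - 2 * (ln (real k) - ln (real k - 1))\<bar> \<le> C / real k ^ 2"
proof -
  let ?a = "\<lambda>k::nat. ln (real k) - 1 / real k - (((real k - 1/2) * ln (real k - 1) - (real k - 1))
        - ((real k - 3/2) * ln (real k - 2) - (real k - 2)))"
  let ?b = "\<lambda>k::nat. ln (real k) - 1 / real k - ((real k * ln (real k) - real k)
        - ((real k - 1) * ln (real k - 1) - (real k - 1)))"
  let ?c = "\<lambda>k::nat. 2 / real k - 2 * (ln (real k) - ln (real k - 1))"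
  have "?a \<in> O(\<lambda>k. 1 / real k ^ 2)" by real_asymp
  then obtain Ca where Ca: "eventually (\<lambda>k. norm (?a k) \<le> Ca * norm (1 / real k ^ 2)) at_top"
    by (elim landau_o.bigE)
  have "?b \<in> O(\<lambda>k. 1 / real k)" by real_asymp
  then obtain Cb where Cb: "eventually (\<lambda>k. norm (?b k) \<le> Cb * norm (1 / real k)) at_top"
    by (elim landau_o.bigE)
  have "?c \<in> O(\<lambda>k. 1 / real k ^ 2)" by real_asymp
  then obtain Cc where Cc: "eventually (\<lambda>k. norm (?c k) \<le> Cc * norm (1 / real k ^ 2)) at_top"
    by (elim landau_o.bigE)
  from eventually_conj[OF Ca eventually_conj[OF Cb Cc]]
  obtain k1 where k1: "\<And>k. k \<ge> k1 \<Longrightarrow> \<bar>?a k\<bar> \<le> Ca / real k ^ 2 \<and> \<bar>?b k\<bar> \<le> Cb / real k \<and> \<bar>?c k\<bar> \<le> Cc / real k ^ 2"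
    unfolding eventually_at_top_linorder by auto
  define C where "C = \<bar>Ca\<bar> + \<bar>Cb\<bar> + \<bar>Cc\<bar> + 4"
  have dig: "\<bar>Digamma (real k / 2) + ln 2 - (ln (real k) - 1 / real k)\<bar> \<le> 4 / real k ^ 2"
    and tri: "\<bar>Polygamma 1 (real k / 2) - 2 / real k\<bar> \<le> 4 / real k ^ 2" if "k \<ge> 4" for k :: nat
    using that digamma_bounds[of "real k / 2"] trigamma_bounds[of "real k / 2"]
    by (auto simp: abs_le_iff ln_div power_divide)
  show thesis
  proof (rule that[of C "max 4 k1"])
    fix k assume k: "k \<ge> max 4 k1"
    have le: "4 / real k ^ 2 \<le> 4 / real k"
      using k by (intro divide_left_mono) (auto simp: power2_eq_square)
    note K = k1[of k] dig[of k] tri[of k]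
    show "\<bar>Digamma (real k / 2) + ln 2 - (((real k - 1/2) * ln (real k - 1) - (real k - 1))
        - ((real k - 3/2) * ln (real k - 2) - (real k - 2)))\<bar> \<le> C / real k ^ 2"
      using abs_diff_le_add[of _ "ln (real k) - 1 / real k" 4 "1 / real k ^ 2" _ Ca C] K k
      by (simp add: C_def)
    show "\<bar>Digamma (real k / 2) + ln 2 - ((real k * ln (real k) - real k)
        - ((real k - 1) * ln (real k - 1) - (real k - 1)))\<bar> \<le> C / real k"
      using abs_diff_le_add[of _ "ln (real k) - 1 / real k" 4 "1 / real k" _ Cb C] K k
        order_trans[OF dig[of k] le]
      by (simp add: C_def)
    show "\<bar>Polygamma 1 (real k / 2) - 2 * (ln (real k) - ln (real k - 1))\<bar> \<le> C / real k ^ 2"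
      using abs_diff_le_add[of _ "2 / real k" 4 "1 / real k ^ 2" _ Cc C] K k
      by (simp add: C_def)
  qed (auto simp: C_def)
qed

section \<open>Logarithmic chi-square variables\<close>

definition ln_chi_square_char :: "nat \<Rightarrow> real \<Rightarrow> complex" where
  "ln_chi_square_char k = char (distr (chi_square k) borel ln)"

text \<open>The characteristic function of a logarithm is a Mellin transform: the mean of
  \<open>u\<close> to the power \<open>\<i> * \<tau>\<close>, which for the chi-square density is
  Euler's integral at \<open>k / 2 + \<i> * \<tau>\<close>.\<close>

lemma ln_chi_square_char_Gamma:
  assumes k: "k > 0"
  shows "ln_chi_square_char k \<tau> = exp (\<i> * of_real (\<tau> * ln 2)) * Gamma (Complex (real k / 2) \<tau>) / of_real (Gamma (real k / 2))"
proof -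
  let ?z = "Complex (real k / 2) \<tau>" and ?c = "2 powr (real k / 2) * Gamma (real k / 2)"
  let ?g = "\<lambda>u. if u > 0 then u powr (real k / 2 - 1) * exp (- u / 2) / ?c else 0"
  let ?f = "\<lambda>t. complex_of_real t powr (?z - 1) / of_real (exp t)"
  have G: "Gamma (real k / 2) > 0" using k by (intro Gamma_real_pos) auto
  then have c: "?c > 0" by simp
  have z: "Re ?z > 0" using k by simp
  have f: "?f t = of_real (t powr (real k / 2 - 1) * exp (- t)) * iexp (\<tau> * ln t)" if True: "t > 0" for t
  proof -
    have "complex_of_real t powr (?z - 1) = exp ((?z - 1) * of_real (ln t))"
      using True by (simp add: powr_def Ln_of_real)
    also have "(?z - 1) * of_real (ln t) = of_real ((real k / 2 - 1) * ln t) + \<i> * of_real (\<tau> * ln t)"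
      by (simp add: complex_eq_iff)
    also have "exp \<dots> = of_real (exp ((real k / 2 - 1) * ln t)) * iexp (\<tau> * ln t)"
      by (simp only: exp_add exp_of_real)
    also have "exp ((real k / 2 - 1) * ln t) = t powr (real k / 2 - 1)"
      using True by (simp add: powr_def)
    finally have e: "complex_of_real t powr (?z - 1) = of_real (t powr (real k / 2 - 1)) * iexp (\<tau> * ln t)" .
    show ?thesis unfolding e by (simp only: exp_minus of_real_mult of_real_inverse divide_inverse mult_ac)
  qed
  have "(\<lambda>t. indicator {0<..} t *\<^sub>R ?f t) = (\<lambda>t. indicator {0<..} t *\<^sub>R
      (of_real (t powr (real k / 2 - 1) * exp (- t)) * iexp (\<tau> * ln t)))"
  proof
    fix t :: real
    show "indicator {0<..} t *\<^sub>R ?f t = indicator {0<..} t *\<^sub>R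
      (of_real (t powr (real k / 2 - 1) * exp (- t)) * iexp (\<tau> * ln t))"
    proof (cases "t > 0")
      case True
      show ?thesis unfolding f[OF True] ..
    next
      case False
      then have "indicator {0<..} t = (0::real)" by simp
      then show ?thesis by (simp only: scaleR_zero_left)
    qed
  qed
  then have m: "(\<lambda>t. indicator {0<..} t *\<^sub>R ?f t) \<in> borel_measurable borel"
    by simp
  \<comment> \<open>Euler's integral is first a gauge integral; absolute integrability and Borel
    measurability carry it over to \<open>lborel\<close>.\<close>
  have int: "(LINT t|lborel. indicator {0<..} t *\<^sub>R ?f t) = Gamma ?z"
  proof -
    have "set_integrable lebesgue {0<..} ?f"
      using absolutely_integrable_Gamma_integral'[OF z] by simp
    then have "set_integrable lborel {0<..} ?f"
      unfolding set_integrable_def using integrable_completion[of _ lborel] m by auto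
    from set_borel_integral_eq_integral(2)[OF this] integral_unique[OF Gamma_integral_complex'[OF z]]
    show ?thesis by (simp add: set_lebesgue_integral_def)
  qed
  have "ln_chi_square_char k \<tau> = (CLINT u|chi_square k. iexp (\<tau> * ln u))"
    unfolding ln_chi_square_char_def char_def by (subst integral_distr) auto
  also have "\<dots> = (CLINT u|lborel. ?g u *\<^sub>R iexp (\<tau> * ln u))"
    unfolding chi_square_def using c by (subst integral_density) auto
  also have "\<dots> = 2 *\<^sub>R (CLINT t|lborel. ?g (0 + 2 * t) *\<^sub>R iexp (\<tau> * ln (0 + 2 * t)))"
    by (subst lborel_integral_real_affine[where t=0 and c=2]) auto
  also have "(\<lambda>t. ?g (0 + 2 * t) *\<^sub>R iexp (\<tau> * ln (0 + 2 * t)))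
      = (\<lambda>t. (exp (\<i> * of_real (\<tau> * ln 2)) / of_real (2 * Gamma (real k / 2))) * (indicator {0<..} t *\<^sub>R ?f t))"
  proof
    fix t :: real
    show "?g (0 + 2 * t) *\<^sub>R iexp (\<tau> * ln (0 + 2 * t))
        = (exp (\<i> * of_real (\<tau> * ln 2)) / of_real (2 * Gamma (real k / 2))) * (indicator {0<..} t *\<^sub>R ?f t)"
    proof (cases "t > 0")
      case True
      have g: "?g (2 * t) = t powr (real k / 2 - 1) * exp (- t) / (2 * Gamma (real k / 2))"
        using True by (simp add: powr_mult powr_diff)
      have "iexp (\<tau> * ln (2 * t)) = iexp (\<tau> * ln 2) * iexp (\<tau> * ln t)"
        using True by (simp add: ln_mult distrib_left exp_add)
      then show ?thesis
        using True unfolding add_0 g f[OF True] by (simp add: scaleR_conv_of_real)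
    qed simp
  qed
  also have "2 *\<^sub>R (CLINT t|lborel. (exp (\<i> * of_real (\<tau> * ln 2)) / of_real (2 * Gamma (real k / 2))) *
      (indicator {0<..} t *\<^sub>R ?f t))
    = exp (\<i> * of_real (\<tau> * ln 2)) * Gamma ?z / of_real (Gamma (real k / 2))"
    by (subst integral_mult_right_zero, subst int) (simp add: scaleR_conv_of_real)
  finally show ?thesis .
qed

definition ln_chi_square_mean :: "nat \<Rightarrow> real" where
  "ln_chi_square_mean k = Digamma (real k / 2) + ln 2"

definition ln_chi_square_var :: "nat \<Rightarrow> real" where
  "ln_chi_square_var k = Polygamma 1 (real k / 2)"

definition ln_chi_square_rem :: "nat \<Rightarrow> real \<Rightarrow> complex" where
  "ln_chi_square_rem k \<tau> = ln_Gamma (Complex (real k / 2) \<tau>) - (of_real (ln_Gamma (real k / 2))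
      + \<i> * of_real (\<tau> * Digamma (real k / 2)) - of_real (\<tau> ^ 2 * Polygamma 1 (real k / 2) / 2))"

text \<open>The exponent is the cumulant expansion to second order. The exponential form also shows
  that the value never vanishes, which the later division needs.\<close>

lemma ln_chi_square_char_expansion:
  assumes k: "k > 0"
  shows "ln_chi_square_char k \<tau> = exp (\<i> * of_real (\<tau> * ln_chi_square_mean k)
      - of_real (\<tau> ^ 2 * ln_chi_square_var k / 2) + ln_chi_square_rem k \<tau>)"
    and "norm (ln_chi_square_rem k \<tau>) \<le> 12 * \<bar>\<tau>\<bar> ^ 3 / real k ^ 2"
proof -
  let ?z = "Complex (real k / 2) \<tau>"
  have "?z \<notin> \<real>\<^sub>\<le>\<^sub>0" using k by (auto simp: complex_nonpos_Reals_iff)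
  then have "?z \<notin> \<int>\<^sub>\<le>\<^sub>0" using nonpos_Ints_subset_nonpos_Reals by blast
  then have "Gamma ?z = exp (ln_Gamma ?z)" by (simp add: Gamma_complex_altdef)
  moreover have "complex_of_real (Gamma (real k / 2)) = exp (of_real (ln_Gamma (real k / 2)))"
    using k by (simp add: Gamma_real_pos_exp flip: exp_of_real)
  ultimately have "ln_chi_square_char k \<tau>
      = exp (\<i> * of_real (\<tau> * ln 2) + ln_Gamma ?z - of_real (ln_Gamma (real k / 2)))"
    unfolding ln_chi_square_char_Gamma[OF k] exp_diff exp_add by simp
  also have "\<i> * of_real (\<tau> * ln 2) + ln_Gamma ?z - of_real (ln_Gamma (real k / 2))
      = \<i> * of_real (\<tau> * ln_chi_square_mean k)
      - of_real (\<tau> ^ 2 * ln_chi_square_var k / 2) + ln_chi_square_rem k \<tau>"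
    by (simp add: ln_chi_square_mean_def ln_chi_square_var_def ln_chi_square_rem_def algebra_simps)
  finally show "ln_chi_square_char k \<tau> = exp (\<i> * of_real (\<tau> * ln_chi_square_mean k)
      - of_real (\<tau> ^ 2 * ln_chi_square_var k / 2) + ln_chi_square_rem k \<tau>)" .
  show "norm (ln_chi_square_rem k \<tau>) \<le> 12 * \<bar>\<tau>\<bar> ^ 3 / real k ^ 2"
    using ln_Gamma_Taylor[of "real k / 2" \<tau>] k by (simp add: ln_chi_square_rem_def power_divide)
qed

section \<open>Asymptotics of the characteristic function\<close>

text \<open>The degrees of freedom \<open>m\<close>, ..., \<open>m - p + 1\<close> of successive
  pivots are consecutive, so approximate increments of \<open>G\<close> add up with \<open>p\<close>
  errors.\<close>

lemma sum_telescope_approx: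
  fixes f :: "nat \<Rightarrow> real" and G :: "real \<Rightarrow> real"
  assumes "p \<le> m" and "\<And>k. m - p < k \<Longrightarrow> k \<le> m \<Longrightarrow> \<bar>f k - (G (real k) - G (real k - 1))\<bar> \<le> c"
  shows "\<bar>(\<Sum>i<p. f (m - i)) - (G (real m) - G (real m - real p))\<bar> \<le> real p * c"
  using assms
proof (induction p)
  case (Suc p)
  have IH: "\<bar>(\<Sum>i<p. f (m - i)) - (G (real m) - G (real m - real p))\<bar> \<le> real p * c"
    using Suc by (intro Suc.IH) auto
  have "\<bar>f (m - p) - (G (real (m - p)) - G (real (m - p) - 1))\<bar> \<le> c"
    using Suc.prems(1) by (intro Suc.prems(2)) auto
  moreover have "real (m - p) = real m - real p" using Suc.prems(1) by simp
  ultimately have "\<bar>f (m - p) - (G (real m - real p) - G (real m - real p - 1))\<bar> \<le> c" by simp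
  moreover have "real m - real (Suc p) = real m - real p - 1" "real (Suc p) * c = real p * c + c"
    by (simp_all add: algebra_simps)
  ultimately show ?case using IH unfolding sum.lessThan_Suc by (simp only:)
qed simp

text \<open>All degrees of freedom involved exceed \<open>m - p\<close>, so each error is at most
  its value there. The subtracted \<open>real p * ln (real m)\<close> is what dividing the matrix by
  \<open>m\<close> takes from its log-determinant.\<close>

lemma group_asymptotics:
  obtains C k\<^sub>0 where "C > 0"
    and "\<And>m p :: nat. p < m \<Longrightarrow> m - p \<ge> k\<^sub>0 \<Longrightarrow>
      \<bar>(\<Sum>i<p. ln_chi_square_mean (m - i)) - real p * ln (real m)
        - ((real m - 1/2) * ln ((real m - 1) / (real m - real p - 1))
           - real p * ln (real m / (real m - real p - 1)) - real p)\<bar> \<le> C * real p / (real m - real p) ^ 2"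
    and "\<And>m p :: nat. p < m \<Longrightarrow> m - p \<ge> k\<^sub>0 \<Longrightarrow>
      \<bar>(\<Sum>i<p. ln_chi_square_mean (m - i)) - real p * ln (real m)
        - ((real m - real p) * ln (real m / (real m - real p)) - real p)\<bar> \<le> C * real p / (real m - real p)"
    and "\<And>m p :: nat. p < m \<Longrightarrow> m - p \<ge> k\<^sub>0 \<Longrightarrow>
      \<bar>(\<Sum>i<p. ln_chi_square_var (m - i)) - 2 * ln (real m / (real m - real p))\<bar> \<le> C * real p / (real m - real p) ^ 2"
proof -
  obtain C k0 where C: "C > 0" and k0: "k0 \<ge> 4"
    and a: "\<And>k. k \<ge> k0 \<Longrightarrow> \<bar>Digamma (real k / 2) + ln 2 - (((real k - 1/2) * ln (real k - 1) - (real k - 1))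
        - ((real k - 3/2) * ln (real k - 2) - (real k - 2)))\<bar> \<le> C / real k ^ 2"
    and b: "\<And>k. k \<ge> k0 \<Longrightarrow> \<bar>Digamma (real k / 2) + ln 2 - ((real k * ln (real k) - real k)
        - ((real k - 1) * ln (real k - 1) - (real k - 1)))\<bar> \<le> C / real k"
    and c: "\<And>k. k \<ge> k0 \<Longrightarrow> \<bar>Polygamma 1 (real k / 2) - 2 * (ln (real k) - ln (real k - 1))\<bar> \<le> C / real k ^ 2"
    using eventually_digamma_half by metis
  show thesis
  proof (rule that[OF C, of k0])
    fix m p :: nat
    assume pm: "p < m" and k: "m - p \<ge> k0"
    have r: "real m - real p = real (m - p)" using pm by simp
    have pos: "real m - real p > 0" "real m - real p - 1 > 0" "real m - 1 > 0" "real m > 0"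
      using k k0 pm by auto
    have sq: "C / real l ^ 2 \<le> C / (real m - real p) ^ 2" and li: "C / real l \<le> C / (real m - real p)"
      if "m - p < l" for l
      using that pos C unfolding r
      by (auto intro!: divide_left_mono power_mono mult_pos_pos)
    have "\<bar>(\<Sum>i<p. ln_chi_square_mean (m - i)) - (((real m - 1/2) * ln (real m - 1) - (real m - 1))
        - ((real m - real p - 1/2) * ln (real m - real p - 1) - (real m - real p - 1)))\<bar>
        \<le> real p * (C / (real m - real p) ^ 2)"
    proof (rule sum_telescope_approx[where G = "\<lambda>x. (x - 1/2) * ln (x - 1) - (x - 1)"])
      fix l assume "m - p < l" "l \<le> m"
      with k a[of l] sq[of l] show "\<bar>ln_chi_square_mean l - ((real l - 1/2) * ln (real l - 1) - (real l - 1)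
          - ((real l - 1 - 1/2) * ln (real l - 1 - 1) - (real l - 1 - 1)))\<bar> \<le> C / (real m - real p) ^ 2"
        by (simp add: ln_chi_square_mean_def)
    qed (use pm in simp)
    moreover have "((real m - 1/2) * ln (real m - 1) - (real m - 1))
        - ((real m - real p - 1/2) * ln (real m - real p - 1) - (real m - real p - 1))
      = real p * ln (real m) + ((real m - 1/2) * ln ((real m - 1) / (real m - real p - 1))
           - real p * ln (real m / (real m - real p - 1)) - real p)"
      using pos by (simp add: ln_div algebra_simps)
    ultimately show "\<bar>(\<Sum>i<p. ln_chi_square_mean (m - i)) - real p * ln (real m)
        - ((real m - 1/2) * ln ((real m - 1) / (real m - real p - 1))
           - real p * ln (real m / (real m - real p - 1)) - real p)\<bar> \<le> C * real p / (real m - real p) ^ 2"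
      by (simp add: algebra_simps)
    have "\<bar>(\<Sum>i<p. ln_chi_square_mean (m - i)) - ((real m * ln (real m) - real m)
        - ((real m - real p) * ln (real m - real p) - (real m - real p)))\<bar>
        \<le> real p * (C / (real m - real p))"
    proof (rule sum_telescope_approx[where G = "\<lambda>x. x * ln x - x"])
      fix l assume "m - p < l" "l \<le> m"
      with k b[of l] li[of l] show "\<bar>ln_chi_square_mean l - (real l * ln (real l) - real l
          - ((real l - 1) * ln (real l - 1) - (real l - 1)))\<bar> \<le> C / (real m - real p)"
        by (simp add: ln_chi_square_mean_def)
    qed (use pm in simp)
    moreover have "(real m * ln (real m) - real m)
        - ((real m - real p) * ln (real m - real p) - (real m - real p))
      = real p * ln (real m) + ((real m - real p) * ln (real m / (real m - real p)) - real p)"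
      using pos by (simp add: ln_div algebra_simps)
    ultimately show "\<bar>(\<Sum>i<p. ln_chi_square_mean (m - i)) - real p * ln (real m)
        - ((real m - real p) * ln (real m / (real m - real p)) - real p)\<bar> \<le> C * real p / (real m - real p)"
      by (simp add: algebra_simps)
    have "\<bar>(\<Sum>i<p. ln_chi_square_var (m - i)) - (2 * ln (real m) - 2 * ln (real m - real p))\<bar>
        \<le> real p * (C / (real m - real p) ^ 2)"
    proof (rule sum_telescope_approx[where G = "\<lambda>x. 2 * ln x"])
      fix l assume "m - p < l" "l \<le> m"
      with k c[of l] sq[of l] show "\<bar>ln_chi_square_var l - (2 * ln (real l) - 2 * ln (real l - 1))\<bar>
          \<le> C / (real m - real p) ^ 2"
        by (simp add: ln_chi_square_var_def)
    qed (use pm in simp)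
    then show "\<bar>(\<Sum>i<p. ln_chi_square_var (m - i)) - 2 * ln (real m / (real m - real p))\<bar>
        \<le> C * real p / (real m - real p) ^ 2"
      using pos by (simp add: ln_div algebra_simps)
  qed
qed

text \<open>With \<open>m = N j - 1\<close> degrees of freedom this is the brace in
  \<open>LR_centering\<close>. The summand \<open>- p\<close> of the mean expansion is left out
  because its weighted total cancels against the pooled one.\<close>

definition group_centering :: "nat \<Rightarrow> nat \<Rightarrow> real" where
  "group_centering p m = (real m - 1/2) * ln ((real m - 1) / (real m - real p - 1))
     - real p * ln (real m / (real m - real p - 1))"

definition log_LR_centering :: "nat \<Rightarrow> nat \<Rightarrow> (nat \<Rightarrow> nat) \<Rightarrow> real" where
  "log_LR_centering p q m =
     (let M = (\<Sum>j=1..q. m j) in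
      (\<Sum>j=1..q. real (m j) / 2 * (group_centering p (m j) + real p * ln (real (m j))))
      - real M / 2 * ((real M - real p) * ln (real M / (real M - real p)) + real p * ln (real M)))"

text \<open>The characteristic function, at \<open>t / w\<close>, of the centred log-likelihood ratio.\<close>

definition log_LR_char :: "nat \<Rightarrow> nat \<Rightarrow> (nat \<Rightarrow> nat) \<Rightarrow> real \<Rightarrow> real \<Rightarrow> complex" where
  "log_LR_char p q m w t =
     (let M = (\<Sum>j=1..q. m j) in
      exp (- \<i> * of_real (t * log_LR_centering p q m / w))
      * (\<Prod>j=1..q. \<Prod>i<p. ln_chi_square_char (m j - i) (t * real (m j) / (2 * w)))
      / (\<Prod>i<p. ln_chi_square_char (M - i) (t * real M / (2 * w))))"

text \<open>Splits the exponent into a drift, a variance and a remainder, to be estimated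
  separately. The centering is distributed over the brackets of the drift, so that each bracket is a
  pure approximation error.\<close>

lemma log_LR_char_exp:
  assumes "\<And>j. j \<in> {1..q} \<Longrightarrow> p < m j" and "p < M" and M: "M = (\<Sum>j=1..q. m j)" and w: "w \<noteq> 0"
  shows "log_LR_char p q m w t = exp (\<i> * of_real (t / w *
      ((\<Sum>j=1..q. real (m j) / 2 * ((\<Sum>i<p. ln_chi_square_mean (m j - i)) - real p * ln (real (m j))
          - (group_centering p (m j) - real p)))
        - real M / 2 * ((\<Sum>i<p. ln_chi_square_mean (M - i)) - real p * ln (real M)
          - ((real M - real p) * ln (real M / (real M - real p)) - real p))))
     - of_real (t\<^sup>2 / 2 * (((\<Sum>j=1..q. (real (m j))\<^sup>2 / 4 * (\<Sum>i<p. ln_chi_square_var (m j - i)))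
        - (real M)\<^sup>2 / 4 * (\<Sum>i<p. ln_chi_square_var (M - i))) / w\<^sup>2))
     + ((\<Sum>j=1..q. \<Sum>i<p. ln_chi_square_rem (m j - i) (t * real (m j) / (2 * w)))
        - (\<Sum>i<p. ln_chi_square_rem (M - i) (t * real M / (2 * w)))))"
proof -
  let ?\<mu> = ln_chi_square_mean and ?v = ln_chi_square_var and ?r = ln_chi_square_rem
  have grp: "(\<Prod>i<p. ln_chi_square_char (k - i) (t * real k / (2 * w)))
      = exp (\<i> * of_real (t / w * (real k / 2 * (\<Sum>i<p. ?\<mu> (k - i))))
          - of_real (t\<^sup>2 / 2 * ((real k)\<^sup>2 / 4 * (\<Sum>i<p. ?v (k - i)) / w\<^sup>2))
          + (\<Sum>i<p. ?r (k - i) (t * real k / (2 * w))))" if k: "p < k" for k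
  proof -
    have "(\<Prod>i<p. ln_chi_square_char (k - i) (t * real k / (2 * w)))
        = (\<Prod>i<p. exp (\<i> * of_real (t * real k / (2 * w) * ?\<mu> (k - i))
          - of_real ((t * real k / (2 * w))\<^sup>2 * ?v (k - i) / 2) + ?r (k - i) (t * real k / (2 * w))))"
      using k by (intro prod.cong refl ln_chi_square_char_expansion) auto
    also have "\<dots> = exp (\<Sum>i<p. \<i> * of_real (t * real k / (2 * w) * ?\<mu> (k - i))
          - of_real ((t * real k / (2 * w))\<^sup>2 * ?v (k - i) / 2) + ?r (k - i) (t * real k / (2 * w)))"
      by (rule exp_sum[symmetric]) simp
    also have "(\<Sum>i<p. \<i> * of_real (t * real k / (2 * w) * ?\<mu> (k - i))
          - of_real ((t * real k / (2 * w))\<^sup>2 * ?v (k - i) / 2) + ?r (k - i) (t * real k / (2 * w)))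
        = \<i> * of_real (\<Sum>i<p. t * real k / (2 * w) * ?\<mu> (k - i))
          - of_real (\<Sum>i<p. (t * real k / (2 * w))\<^sup>2 * ?v (k - i) / 2)
          + (\<Sum>i<p. ?r (k - i) (t * real k / (2 * w)))"
      by (simp only: sum.distrib sum_subtractf of_real_sum sum_distrib_left)
    also have "(\<Sum>i<p. t * real k / (2 * w) * ?\<mu> (k - i)) = t / w * (real k / 2 * (\<Sum>i<p. ?\<mu> (k - i)))"
      by (simp add: sum_distrib_left mult_ac)
    also have "(\<Sum>i<p. (t * real k / (2 * w))\<^sup>2 * ?v (k - i) / 2)
        = t\<^sup>2 / 2 * ((real k)\<^sup>2 / 4 * (\<Sum>i<p. ?v (k - i)) / w\<^sup>2)"
      using w by (simp add: sum_distrib_left sum_divide_distrib power_mult_distrib power_divide field_simps)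
    finally show ?thesis .
  qed
  have "(\<Prod>j=1..q. \<Prod>i<p. ln_chi_square_char (m j - i) (t * real (m j) / (2 * w)))
      = (\<Prod>j=1..q. exp (\<i> * of_real (t / w * (real (m j) / 2 * (\<Sum>i<p. ?\<mu> (m j - i))))
          - of_real (t\<^sup>2 / 2 * ((real (m j))\<^sup>2 / 4 * (\<Sum>i<p. ?v (m j - i)) / w\<^sup>2))
          + (\<Sum>i<p. ?r (m j - i) (t * real (m j) / (2 * w)))))"
    using assms(1) by (intro prod.cong refl grp) auto
  also have "\<dots> = exp (\<Sum>j=1..q. \<i> * of_real (t / w * (real (m j) / 2 * (\<Sum>i<p. ?\<mu> (m j - i))))
          - of_real (t\<^sup>2 / 2 * ((real (m j))\<^sup>2 / 4 * (\<Sum>i<p. ?v (m j - i)) / w\<^sup>2))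
          + (\<Sum>i<p. ?r (m j - i) (t * real (m j) / (2 * w))))"
    by (rule exp_sum[symmetric]) simp
  also have "(\<Sum>j=1..q. \<i> * of_real (t / w * (real (m j) / 2 * (\<Sum>i<p. ?\<mu> (m j - i))))
          - of_real (t\<^sup>2 / 2 * ((real (m j))\<^sup>2 / 4 * (\<Sum>i<p. ?v (m j - i)) / w\<^sup>2))
          + (\<Sum>i<p. ?r (m j - i) (t * real (m j) / (2 * w))))
      = \<i> * of_real (t / w * (\<Sum>j=1..q. real (m j) / 2 * (\<Sum>i<p. ?\<mu> (m j - i))))
          - of_real (t\<^sup>2 / 2 * ((\<Sum>j=1..q. (real (m j))\<^sup>2 / 4 * (\<Sum>i<p. ?v (m j - i))) / w\<^sup>2))
          + (\<Sum>j=1..q. \<Sum>i<p. ?r (m j - i) (t * real (m j) / (2 * w)))"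
    by (simp only: sum.distrib sum_subtractf of_real_sum sum_distrib_left sum_divide_distrib)
  finally have num: "(\<Prod>j=1..q. \<Prod>i<p. ln_chi_square_char (m j - i) (t * real (m j) / (2 * w)))
      = exp (\<i> * of_real (t / w * (\<Sum>j=1..q. real (m j) / 2 * (\<Sum>i<p. ?\<mu> (m j - i))))
          - of_real (t\<^sup>2 / 2 * ((\<Sum>j=1..q. (real (m j))\<^sup>2 / 4 * (\<Sum>i<p. ?v (m j - i))) / w\<^sup>2))
          + (\<Sum>j=1..q. \<Sum>i<p. ?r (m j - i) (t * real (m j) / (2 * w))))" .
  \<comment> \<open>The constants \<open>- p\<close> cancel here because the weights
    \<open>m j\<close> add up to \<open>M\<close>.\<close>
  have cent: "(\<Sum>j=1..q. real (m j) / 2 * ((\<Sum>i<p. ?\<mu> (m j - i)) - real p * ln (real (m j))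
          - (group_centering p (m j) - real p)))
        - real M / 2 * ((\<Sum>i<p. ?\<mu> (M - i)) - real p * ln (real M)
          - ((real M - real p) * ln (real M / (real M - real p)) - real p))
      = (\<Sum>j=1..q. real (m j) / 2 * (\<Sum>i<p. ?\<mu> (m j - i))) - real M / 2 * (\<Sum>i<p. ?\<mu> (M - i))
        - log_LR_centering p q m"
  proof -
    have "(\<Sum>j=1..q. real (m j) / 2 * ((\<Sum>i<p. ?\<mu> (m j - i)) - real p * ln (real (m j))
          - (group_centering p (m j) - real p)))
        = (\<Sum>j=1..q. real (m j) / 2 * (\<Sum>i<p. ?\<mu> (m j - i)))
          - (\<Sum>j=1..q. real (m j) / 2 * (group_centering p (m j) + real p * ln (real (m j))))
          + (\<Sum>j=1..q. real (m j)) * (real p / 2)"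
      unfolding sum_distrib_right sum_subtractf[symmetric] sum.distrib[symmetric]
      by (intro sum.cong refl) (simp add: algebra_simps)
    also have "(\<Sum>j=1..q. real (m j)) = real M" using M by simp
    finally show ?thesis
      unfolding log_LR_centering_def Let_def M[symmetric] by (simp add: algebra_simps)
  qed
  show ?thesis
    unfolding log_LR_char_def Let_def M[symmetric] num grp[OF assms(2)] cent
    unfolding exp_add[symmetric] exp_diff[symmetric]
    by (rule arg_cong[where f=exp])
       (simp add: algebra_simps diff_divide_distrib add_divide_distrib)
qed

text \<open>The limsup condition provides the relative gap \<open>\<epsilon>\<close>, which turns
  errors measured in \<open>m - p\<close> into errors measured in \<open>m\<close>.\<close>

lemma inverse_square_gap_le:
  assumes "C \<ge> 0" "\<epsilon> > 0" "m > 0" "\<epsilon> * m \<le> m - p"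
  shows "C / (m - p :: real) ^ 2 \<le> C / (\<epsilon>\<^sup>2 * m\<^sup>2)"
proof -
  have em: "\<epsilon> * m > 0" using assms by simp
  then have mp: "m - p > 0" using assms(4) by linarith
  have "(\<epsilon> * m)\<^sup>2 \<le> (m - p)\<^sup>2" "(\<epsilon> * m)\<^sup>2 > 0" "(m - p)\<^sup>2 > 0"
    using em mp assms(4) by (auto intro!: power_mono)
  then show ?thesis
    using assms(1) by (auto intro!: divide_left_mono simp: power_mult_distrib)
qed

text \<open>There are \<open>p\<close> remainders of order \<open>(m / w) ^ 3 / (m - p) ^ 2\<close>.
  The bound is linear in \<open>m\<close>, so summing over the groups gives
  \<open>p * M / w ^ 3\<close>, which is \<open>1 / w\<close>.\<close>

lemma ln_chi_square_rem_sum_le: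
  assumes "p < m" and \<epsilon>: "\<epsilon> > 0" "\<epsilon> * real m \<le> real m - real p" and w: "w > 0"
  shows "norm (\<Sum>i<p. ln_chi_square_rem (m - i) (t * real m / (2 * w)))
    \<le> 3/2 * \<bar>t\<bar> ^ 3 * real p * real m / (\<epsilon>\<^sup>2 * w ^ 3)"
proof -
  let ?B = "12 * \<bar>t * real m / (2 * w)\<bar> ^ 3"
  have "norm (\<Sum>i<p. ln_chi_square_rem (m - i) (t * real m / (2 * w))) \<le> (\<Sum>i<p. ?B / (real m - real p)\<^sup>2)"
  proof (rule sum_norm_le)
    fix i assume i: "i \<in> {..<p}"
    have "norm (ln_chi_square_rem (m - i) (t * real m / (2 * w))) \<le> ?B / real (m - i) ^ 2"
      using i assms(1) by (intro ln_chi_square_char_expansion(2)) auto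
    also have "\<dots> \<le> ?B / (real m - real p)\<^sup>2"
      using i assms(1) by (intro divide_left_mono power_mono mult_pos_pos) auto
    finally show "norm (ln_chi_square_rem (m - i) (t * real m / (2 * w))) \<le> ?B / (real m - real p)\<^sup>2" .
  qed
  also have "\<dots> = real p * (?B / (real m - real p)\<^sup>2)" by simp
  also have "\<dots> \<le> real p * (?B / (\<epsilon>\<^sup>2 * (real m)\<^sup>2))"
    using assms by (intro mult_left_mono inverse_square_gap_le) auto
  also have "\<dots> = 3/2 * \<bar>t\<bar> ^ 3 * real p * real m / (\<epsilon>\<^sup>2 * w ^ 3)"
    using assms by (simp add: abs_mult power_mult_distrib power_divide field_simps eval_nat_numeral)
  finally show ?thesis .
qed

text \<open>Group weights \<open>m / 2\<close> against errors of order \<open>p / m ^ 2\<close>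
  leave at most a constant per group, whence the term in \<open>q\<close>; the cruder pooled error
  \<open>p / M\<close> against \<open>M / 2\<close> leaves \<open>p\<close>. For the variances the
  weights are of order \<open>m ^ 2\<close>, which leaves \<open>p\<close> per matrix.\<close>

lemma log_LR_error_bounds:
  obtains C k\<^sub>0 where "C > 0"
    and "\<And>p q m M \<epsilon>. p \<ge> 1 \<Longrightarrow> \<epsilon> > 0 \<Longrightarrow>
      (\<And>j. j \<in> {1..q} \<Longrightarrow> p < m j \<and> \<epsilon> * real (m j) \<le> real (m j) - real p \<and> k\<^sub>0 \<le> m j - p) \<Longrightarrow>
      2 * p < M \<Longrightarrow> k\<^sub>0 \<le> M - p \<Longrightarrow>
      \<bar>(\<Sum>j=1..q. real (m j) / 2 * ((\<Sum>i<p. ln_chi_square_mean (m j - i)) - real p * ln (real (m j))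
          - (group_centering p (m j) - real p)))
        - real M / 2 * ((\<Sum>i<p. ln_chi_square_mean (M - i)) - real p * ln (real M)
          - ((real M - real p) * ln (real M / (real M - real p)) - real p))\<bar> \<le> C * (real q / \<epsilon>\<^sup>2 + real p)"
    and "\<And>p q m M \<epsilon>. p \<ge> 1 \<Longrightarrow> \<epsilon> > 0 \<Longrightarrow>
      (\<And>j. j \<in> {1..q} \<Longrightarrow> p < m j \<and> \<epsilon> * real (m j) \<le> real (m j) - real p \<and> k\<^sub>0 \<le> m j - p) \<Longrightarrow>
      2 * p < M \<Longrightarrow> k\<^sub>0 \<le> M - p \<Longrightarrow>
      \<bar>((\<Sum>j=1..q. (real (m j))\<^sup>2 / 4 * (\<Sum>i<p. ln_chi_square_var (m j - i)))
        - (real M)\<^sup>2 / 4 * (\<Sum>i<p. ln_chi_square_var (M - i)))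
       - ((\<Sum>j=1..q. (real (m j))\<^sup>2 / 2 * ln (real (m j) / (real (m j) - real p)))
        - (real M)\<^sup>2 / 2 * ln (real M / (real M - real p)))\<bar> \<le> C * (real q / \<epsilon>\<^sup>2 + 1) * real p"
proof -
  obtain C k0 where C: "C > 0"
    and a: "\<And>m p :: nat. p < m \<Longrightarrow> m - p \<ge> k0 \<Longrightarrow>
      \<bar>(\<Sum>i<p. ln_chi_square_mean (m - i)) - real p * ln (real m)
        - ((real m - 1/2) * ln ((real m - 1) / (real m - real p - 1))
           - real p * ln (real m / (real m - real p - 1)) - real p)\<bar> \<le> C * real p / (real m - real p) ^ 2"
    and b: "\<And>m p :: nat. p < m \<Longrightarrow> m - p \<ge> k0 \<Longrightarrow>
      \<bar>(\<Sum>i<p. ln_chi_square_mean (m - i)) - real p * ln (real m)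
        - ((real m - real p) * ln (real m / (real m - real p)) - real p)\<bar> \<le> C * real p / (real m - real p)"
    and c: "\<And>m p :: nat. p < m \<Longrightarrow> m - p \<ge> k0 \<Longrightarrow>
      \<bar>(\<Sum>i<p. ln_chi_square_var (m - i)) - 2 * ln (real m / (real m - real p))\<bar> \<le> C * real p / (real m - real p) ^ 2"
    using group_asymptotics by metis
  show thesis
  proof (rule that[OF C, of k0])
    fix p q M :: nat and m :: "nat \<Rightarrow> nat" and \<epsilon> :: real
    assume p: "p \<ge> 1" and \<epsilon>: "\<epsilon> > 0" and grp: "\<And>j. j \<in> {1..q} \<Longrightarrow> p < m j \<and>
        \<epsilon> * real (m j) \<le> real (m j) - real p \<and> k0 \<le> m j - p"
      and M: "2 * p < M" "k0 \<le> M - p"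
    have M': "p < M" "real M > 0" "real M / 2 \<le> real M - real p" using M by auto
    let ?D = "\<lambda>k. \<Sum>i<p. ln_chi_square_mean (k - i)" and ?V = "\<lambda>k. \<Sum>i<p. ln_chi_square_var (k - i)"
    have 1: "\<bar>real (m j) / 2 * (?D (m j) - real p * ln (real (m j)) - (group_centering p (m j) - real p))\<bar> \<le> C / \<epsilon>\<^sup>2"
      if j: "j \<in> {1..q}" for j
    proof -
      have "\<bar>real (m j) / 2 * (?D (m j) - real p * ln (real (m j)) - (group_centering p (m j) - real p))\<bar>
          \<le> real (m j) / 2 * (C * real p / (real (m j) - real p) ^ 2)"
        unfolding abs_mult using grp[OF j] a[of p "m j"]
        by (intro mult_mono) (auto simp: group_centering_def)
      also have "\<dots> \<le> real (m j) / 2 * (C * real p / (\<epsilon>\<^sup>2 * (real (m j))\<^sup>2))"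
        using grp[OF j] \<epsilon> C by (intro mult_left_mono inverse_square_gap_le) auto
      also have "\<dots> = C / \<epsilon>\<^sup>2 * (real p / (2 * real (m j)))"
        using grp[OF j] by (simp add: field_simps power2_eq_square)
      also have "\<dots> \<le> C / \<epsilon>\<^sup>2 * 1"
        using grp[OF j] C by (intro mult_left_mono) (auto simp: field_simps)
      finally show ?thesis by simp
    qed
    have "\<bar>\<Sum>j=1..q. real (m j) / 2 * (?D (m j) - real p * ln (real (m j)) - (group_centering p (m j) - real p))\<bar>
        \<le> (\<Sum>j=1..q. C / \<epsilon>\<^sup>2)"
      by (rule order_trans[OF sum_abs]) (rule sum_mono, rule 1)
    also have "\<dots> = C * (real q / \<epsilon>\<^sup>2)" by simp
    finally have sum1: "\<bar>\<Sum>j=1..q. real (m j) / 2 * (?D (m j) - real p * ln (real (m j)) - (group_centering p (m j) - real p))\<bar>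
        \<le> C * (real q / \<epsilon>\<^sup>2)" .
    have sum2: "\<bar>real M / 2 * (?D M - real p * ln (real M) - ((real M - real p) * ln (real M / (real M - real p)) - real p))\<bar>
        \<le> C * real p"
    proof -
      have "\<bar>real M / 2 * (?D M - real p * ln (real M) - ((real M - real p) * ln (real M / (real M - real p)) - real p))\<bar>
          \<le> real M / 2 * (C * real p / (real M - real p))"
        unfolding abs_mult using M M' b[of p M] by (intro mult_mono) auto
      also have "\<dots> = C * real p * ((real M / 2) / (real M - real p))" by simp
      also have "\<dots> \<le> C * real p * 1"
        using M' C by (intro mult_left_mono) (auto simp: field_simps)
      finally show ?thesis by simp
    qed
    show "\<bar>(\<Sum>j=1..q. real (m j) / 2 * (?D (m j) - real p * ln (real (m j))
          - (group_centering p (m j) - real p)))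
        - real M / 2 * (?D M - real p * ln (real M)
          - ((real M - real p) * ln (real M / (real M - real p)) - real p))\<bar> \<le> C * (real q / \<epsilon>\<^sup>2 + real p)"
      unfolding distrib_left using sum1 sum2 by (rule order_trans[OF abs_triangle_ineq4 add_mono])
    \<comment> \<open>Stated for a free gap constant \<open>e\<close>: the groups use
      \<open>\<epsilon>\<close>, the pooled matrix one half.\<close>
    have 2: "\<bar>(real k)\<^sup>2 / 4 * ?V k - (real k)\<^sup>2 / 2 * ln (real k / (real k - real p))\<bar> \<le> C / (4 * e\<^sup>2) * real p"
      if k: "p < k" "k0 \<le> k - p" "e * real k \<le> real k - real p" "e > 0" for k e
    proof -
      have "(real k)\<^sup>2 / 4 * ?V k - (real k)\<^sup>2 / 2 * ln (real k / (real k - real p))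
          = (real k)\<^sup>2 / 4 * (?V k - 2 * ln (real k / (real k - real p)))" by (simp add: algebra_simps)
      also have "\<bar>\<dots>\<bar> \<le> (real k)\<^sup>2 / 4 * (C * real p / (real k - real p) ^ 2)"
        unfolding abs_mult using k c[of p k] by (intro mult_mono) auto
      also have "\<dots> \<le> (real k)\<^sup>2 / 4 * (C * real p / (e\<^sup>2 * (real k)\<^sup>2))"
        using k C by (intro mult_left_mono inverse_square_gap_le) auto
      also have "\<dots> = C / (4 * e\<^sup>2) * real p" using k by (simp add: field_simps)
      finally show ?thesis .
    qed
    have "\<bar>\<Sum>j=1..q. (real (m j))\<^sup>2 / 4 * ?V (m j) - (real (m j))\<^sup>2 / 2 * ln (real (m j) / (real (m j) - real p))\<bar>
        \<le> (\<Sum>j=1..q. C / (4 * \<epsilon>\<^sup>2) * real p)"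
      using grp \<epsilon> by (intro order_trans[OF sum_abs] sum_mono 2) auto
    also have "\<dots> = C * (real q / \<epsilon>\<^sup>2) * real p / 4" by (simp add: mult_ac)
    also have "\<dots> \<le> C * (real q / \<epsilon>\<^sup>2) * real p"
    proof -
      have "x / 4 \<le> x" if "0 \<le> x" for x :: real using that by simp
      moreover have "0 \<le> C * (real q / \<epsilon>\<^sup>2) * real p" using C by simp
      ultimately show ?thesis by blast
    qed
    finally have "\<bar>(\<Sum>j=1..q. (real (m j))\<^sup>2 / 4 * ?V (m j)) - (\<Sum>j=1..q. (real (m j))\<^sup>2 / 2 * ln (real (m j) / (real (m j) - real p)))\<bar>
        \<le> C * (real q / \<epsilon>\<^sup>2) * real p"
      unfolding sum_subtractf .
    moreover have "\<bar>(real M)\<^sup>2 / 4 * ?V M - (real M)\<^sup>2 / 2 * ln (real M / (real M - real p))\<bar> \<le> C * real p"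
      using 2[of M "1/2"] M M' by (simp add: power2_eq_square)
    ultimately show "\<bar>((\<Sum>j=1..q. (real (m j))\<^sup>2 / 4 * ?V (m j)) - (real M)\<^sup>2 / 4 * ?V M)
       - ((\<Sum>j=1..q. (real (m j))\<^sup>2 / 2 * ln (real (m j) / (real (m j) - real p)))
        - (real M)\<^sup>2 / 2 * ln (real M / (real M - real p)))\<bar> \<le> C * (real q / \<epsilon>\<^sup>2 + 1) * real p"
      unfolding distrib_left distrib_right by linarith
  qed
qed

text \<open>The drift is of order \<open>q + p\<close>, negligible against \<open>w\<close> since
  \<open>q / w\<close> tends to 0 and \<open>p / w = sqrt (p / M)\<close>; the remainder is of order
  \<open>1 / w\<close>. Only the variance survives.\<close>

lemma log_LR_char_tendsto:
  fixes p q M :: "nat \<Rightarrow> nat" and m :: "nat \<Rightarrow> nat \<Rightarrow> nat" and w :: "nat \<Rightarrow> real" and \<sigma> t \<epsilon> :: real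
  assumes M: "\<And>n. M n = (\<Sum>j=1..q n. m n j)" and w: "\<And>n. w n = sqrt (real (p n) * real (M n))"
    and p_lim: "filterlim p at_top sequentially" and q1: "eventually (\<lambda>n. q n \<ge> 1) sequentially"
    and \<epsilon>: "\<epsilon> > 0"
    and grp: "eventually (\<lambda>n. \<forall>j\<in>{1..q n}. p n < m n j \<and> \<epsilon> * real (m n j) \<le> real (m n j) - real (p n)) sequentially"
    and qs: "(\<lambda>n. real (q n) / w n) \<longlonglongrightarrow> 0" and ps: "(\<lambda>n. real (p n) / real (M n)) \<longlonglongrightarrow> 0"
    and var: "(\<lambda>n. 1/2 * (\<Sum>j=1..q n. (real (m n j))\<^sup>2 / (real (p n) * real (M n)) *
        ln (real (m n j) / (real (m n j) - real (p n)))) - 1/2) \<longlonglongrightarrow> \<sigma>\<^sup>2"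
  shows "(\<lambda>n. log_LR_char (p n) (q n) (m n) (w n) t) \<longlonglongrightarrow> exp (of_real (- (t\<^sup>2 * \<sigma>\<^sup>2 / 2)))"
proof -
  obtain C k0 where C: "C > 0"
    and bA: "\<And>p q m M \<epsilon>. p \<ge> 1 \<Longrightarrow> \<epsilon> > 0 \<Longrightarrow>
      (\<And>j. j \<in> {1..q} \<Longrightarrow> p < m j \<and> \<epsilon> * real (m j) \<le> real (m j) - real p \<and> k0 \<le> m j - p) \<Longrightarrow>
      2 * p < M \<Longrightarrow> k0 \<le> M - p \<Longrightarrow>
      \<bar>(\<Sum>j=1..q. real (m j) / 2 * ((\<Sum>i<p. ln_chi_square_mean (m j - i)) - real p * ln (real (m j))
          - (group_centering p (m j) - real p)))
        - real M / 2 * ((\<Sum>i<p. ln_chi_square_mean (M - i)) - real p * ln (real M)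
          - ((real M - real p) * ln (real M / (real M - real p)) - real p))\<bar> \<le> C * (real q / \<epsilon>\<^sup>2 + real p)"
    and bV: "\<And>p q m M \<epsilon>. p \<ge> 1 \<Longrightarrow> \<epsilon> > 0 \<Longrightarrow>
      (\<And>j. j \<in> {1..q} \<Longrightarrow> p < m j \<and> \<epsilon> * real (m j) \<le> real (m j) - real p \<and> k0 \<le> m j - p) \<Longrightarrow>
      2 * p < M \<Longrightarrow> k0 \<le> M - p \<Longrightarrow>
      \<bar>((\<Sum>j=1..q. (real (m j))\<^sup>2 / 4 * (\<Sum>i<p. ln_chi_square_var (m j - i)))
        - (real M)\<^sup>2 / 4 * (\<Sum>i<p. ln_chi_square_var (M - i)))
       - ((\<Sum>j=1..q. (real (m j))\<^sup>2 / 2 * ln (real (m j) / (real (m j) - real p)))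
        - (real M)\<^sup>2 / 2 * ln (real M / (real M - real p)))\<bar> \<le> C * (real q / \<epsilon>\<^sup>2 + 1) * real p"
    using log_LR_error_bounds by blast
  define A where "A n = (\<Sum>j=1..q n. real (m n j) / 2 * ((\<Sum>i<p n. ln_chi_square_mean (m n j - i))
          - real (p n) * ln (real (m n j)) - (group_centering (p n) (m n j) - real (p n))))
        - real (M n) / 2 * ((\<Sum>i<p n. ln_chi_square_mean (M n - i)) - real (p n) * ln (real (M n))
          - ((real (M n) - real (p n)) * ln (real (M n) / (real (M n) - real (p n))) - real (p n)))" for n
  define V where "V n = (\<Sum>j=1..q n. (real (m n j))\<^sup>2 / 4 * (\<Sum>i<p n. ln_chi_square_var (m n j - i)))
        - (real (M n))\<^sup>2 / 4 * (\<Sum>i<p n. ln_chi_square_var (M n - i))" for n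
  define V' where "V' n = (\<Sum>j=1..q n. (real (m n j))\<^sup>2 / 2 * ln (real (m n j) / (real (m n j) - real (p n))))
        - (real (M n))\<^sup>2 / 2 * ln (real (M n) / (real (M n) - real (p n)))" for n
  define R where "R n = (\<Sum>j=1..q n. \<Sum>i<p n. ln_chi_square_rem (m n j - i) (t * real (m n j) / (2 * w n)))
        - (\<Sum>i<p n. ln_chi_square_rem (M n - i) (t * real (M n) / (2 * w n)))" for n
  define good where "good n \<longleftrightarrow> p n \<ge> 1 \<and> 2 * p n < M n \<and> k0 \<le> M n - p n \<and>
    (\<forall>j\<in>{1..q n}. p n < m n j \<and> \<epsilon> * real (m n j) \<le> real (m n j) - real (p n) \<and> k0 \<le> m n j - p n)" for n
  have good: "eventually good sequentially"
  proof -
    \<comment> \<open>\<open>p\<close> becomes so large that \<open>\<epsilon> * p \<ge> k0\<close>;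
      as \<open>m > p\<close>, every gap \<open>m - p\<close> is then at least \<open>k0\<close>,
      uniformly in the group.\<close>
    have e1: "eventually (\<lambda>n. p n \<ge> Suc (k0 + nat \<lceil>real k0 / \<epsilon>\<rceil>)) sequentially"
      using p_lim by (simp add: filterlim_at_top)
    have e2: "eventually (\<lambda>n. real (p n) / real (M n) < 1/2) sequentially"
      using ps by (rule order_tendstoD) simp
    from q1 grp e1 e2 show ?thesis
    proof eventually_elim
      case (elim n)
      have k: "k0 \<le> m n j - p n" if "j \<in> {1..q n}" for j
      proof -
        have pj: "p n < m n j" "\<epsilon> * real (m n j) \<le> real (m n j) - real (p n)"
          using elim(2) that by blast+
        have "real k0 / \<epsilon> \<le> real (p n)" using elim(3) by linarith
        then have "real k0 \<le> \<epsilon> * real (p n)" using \<epsilon> by (simp add: field_simps)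
        also have "\<dots> \<le> \<epsilon> * real (m n j)" using pj \<epsilon> by (intro mult_left_mono) auto
        also have "\<dots> \<le> real (m n j) - real (p n)" by (rule pj)
        finally show ?thesis by linarith
      qed
      have "m n 1 \<le> M n" unfolding M using elim(1) by (intro member_le_sum) auto
      then have "M n > 0" using elim(1,2) by force
      then have "2 * p n < M n" using elim(4) by (simp add: field_simps)
      moreover from this have "k0 \<le> M n - p n" using elim(3) by linarith
      ultimately show ?case unfolding good_def using elim k by auto
    qed
  qed
  have pM: "real (p n) > 0" "real (M n) > 0" "w n > 0" "(w n)\<^sup>2 = real (p n) * real (M n)" if "good n" for n
    using that by (auto simp: good_def w)
  have pw: "(\<lambda>n. real (p n) / w n) \<longlonglongrightarrow> 0"
  proof (rule Lim_transform_eventually)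
    show "(\<lambda>n. sqrt (real (p n) / real (M n))) \<longlonglongrightarrow> 0" using tendsto_real_sqrt[OF ps] by simp
    show "eventually (\<lambda>n. sqrt (real (p n) / real (M n)) = real (p n) / w n) sequentially"
      using good
    proof eventually_elim
      case (elim n)
      show ?case using pM[OF elim] by (simp add: w real_sqrt_mult real_sqrt_divide real_div_sqrt flip: divide_divide_eq_left)
    qed
  qed
  have qM: "(\<lambda>n. real (q n) / real (M n)) \<longlonglongrightarrow> 0"
  proof (rule Lim_transform_eventually)
    show "(\<lambda>n. real (q n) / w n * (real (p n) / w n)) \<longlonglongrightarrow> 0" using tendsto_mult[OF qs pw] by simp
    show "eventually (\<lambda>n. real (q n) / w n * (real (p n) / w n) = real (q n) / real (M n)) sequentially"
      using good
    proof eventually_elim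
      case (elim n)
      have "real (q n) / w n * (real (p n) / w n) = real (q n) * real (p n) / (w n)\<^sup>2"
        by (simp add: power2_eq_square)
      then show ?case using pM[OF elim] by simp
    qed
  qed
  have M0: "(\<lambda>n. 1 / real (M n)) \<longlonglongrightarrow> 0"
  proof (rule tendsto_sandwich[OF _ _ tendsto_const ps])
    show "eventually (\<lambda>n. 1 / real (M n) \<le> real (p n) / real (M n)) sequentially"
      using good by eventually_elim (auto simp: good_def intro!: divide_right_mono)
  qed simp
  have w0: "(\<lambda>n. 1 / w n) \<longlonglongrightarrow> 0"
  proof (rule tendsto_sandwich[OF _ _ tendsto_const pw])
    show "eventually (\<lambda>n. 1 / w n \<le> real (p n) / w n) sequentially"
      using good
    proof eventually_elim
      case (elim n)
      then show ?case using pM[OF elim] by (intro divide_right_mono) (auto simp: good_def)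
    qed
    show "eventually (\<lambda>n. 0 \<le> 1 / w n) sequentially" by (simp add: w)
  qed
  have A0: "(\<lambda>n. A n / w n) \<longlonglongrightarrow> 0"
  proof (rule Lim_null_comparison)
    show "(\<lambda>n. C / \<epsilon>\<^sup>2 * (real (q n) / w n) + C * (real (p n) / w n)) \<longlonglongrightarrow> 0"
      using tendsto_add[OF tendsto_mult_left[OF qs, of "C / \<epsilon>\<^sup>2"] tendsto_mult_left[OF pw, of C]]
      by (simp only: mult_zero_right add_0_left)
    show "eventually (\<lambda>n. norm (A n / w n) \<le> C / \<epsilon>\<^sup>2 * (real (q n) / w n) + C * (real (p n) / w n)) sequentially"
      using good
    proof eventually_elim
      case (elim n)
      have "\<bar>A n\<bar> \<le> C * (real (q n) / \<epsilon>\<^sup>2 + real (p n))"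
        unfolding A_def using elim \<epsilon> by (intro bA) (auto simp: good_def)
      then have "\<bar>A n\<bar> / w n \<le> C * (real (q n) / \<epsilon>\<^sup>2 + real (p n)) / w n"
        using pM[OF elim] by (intro divide_right_mono) auto
      also have "\<dots> = C / \<epsilon>\<^sup>2 * (real (q n) / w n) + C * (real (p n) / w n)"
        by (simp add: algebra_simps add_divide_distrib)
      finally show ?case using pM[OF elim] by simp
    qed
  qed
  \<comment> \<open>The origin of the \<open>- 1/2\<close> in the variance: the pooled part is half
    of this quantity, and \<open>- ln (1 - r) / r\<close> tends to 1 at
    \<open>r = p / M\<close>.\<close>
  have r1: "(\<lambda>n. real (M n) / real (p n) * ln (real (M n) / (real (M n) - real (p n)))) \<longlonglongrightarrow> 1"
  proof (rule Lim_transform_eventually)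
    have "filterlim (\<lambda>n. real (p n) / real (M n)) (at_right 0) sequentially"
      unfolding filterlim_at using ps good by (auto elim!: eventually_mono simp: good_def)
    moreover have "((\<lambda>r::real. - ln (1 - r) / r) \<longlongrightarrow> 1) (at_right 0)" by real_asymp
    ultimately show "(\<lambda>n. - ln (1 - real (p n) / real (M n)) / (real (p n) / real (M n))) \<longlonglongrightarrow> 1"
      by (rule filterlim_compose[rotated])
    show "eventually (\<lambda>n. - ln (1 - real (p n) / real (M n)) / (real (p n) / real (M n))
        = real (M n) / real (p n) * ln (real (M n) / (real (M n) - real (p n)))) sequentially"
      using good
    proof eventually_elim
      case (elim n)
      have "1 - real (p n) / real (M n) = (real (M n) - real (p n)) / real (M n)"
        using pM[OF elim] by (simp add: field_simps)
      then show ?case using pM[OF elim] elim by (simp add: good_def ln_div)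
    qed
  qed
  have V'lim: "(\<lambda>n. V' n / (w n)\<^sup>2) \<longlonglongrightarrow> \<sigma>\<^sup>2"
  proof (rule Lim_transform_eventually)
    show "(\<lambda>n. (1/2 * (\<Sum>j=1..q n. (real (m n j))\<^sup>2 / (real (p n) * real (M n)) *
        ln (real (m n j) / (real (m n j) - real (p n)))) - 1/2) + 1/2
        - 1/2 * (real (M n) / real (p n) * ln (real (M n) / (real (M n) - real (p n))))) \<longlonglongrightarrow> \<sigma>\<^sup>2"
      using tendsto_diff[OF tendsto_add[OF var tendsto_const[of "1/2"]] tendsto_mult_left[OF r1, of "1/2"]] by simp
    show "eventually (\<lambda>n. (1/2 * (\<Sum>j=1..q n. (real (m n j))\<^sup>2 / (real (p n) * real (M n)) *
        ln (real (m n j) / (real (m n j) - real (p n)))) - 1/2) + 1/2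
        - 1/2 * (real (M n) / real (p n) * ln (real (M n) / (real (M n) - real (p n)))) = V' n / (w n)\<^sup>2) sequentially"
      using good
    proof eventually_elim
      case (elim n)
      have "1/2 * (\<Sum>j=1..q n. (real (m n j))\<^sup>2 / (real (p n) * real (M n)) *
          ln (real (m n j) / (real (m n j) - real (p n))))
        = (\<Sum>j=1..q n. (real (m n j))\<^sup>2 / 2 * ln (real (m n j) / (real (m n j) - real (p n)))) / (real (p n) * real (M n))"
        unfolding sum_distrib_left sum_divide_distrib by (intro sum.cong refl) simp
      moreover have "1/2 * (real (M n) / real (p n) * ln (real (M n) / (real (M n) - real (p n))))
          = (real (M n))\<^sup>2 / 2 * ln (real (M n) / (real (M n) - real (p n))) / (real (p n) * real (M n))"
        using pM[OF elim] by (simp add: power2_eq_square)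
      ultimately show ?case unfolding V'_def pM(4)[OF elim] diff_divide_distrib by simp
    qed
  qed
  have "(\<lambda>n. V n / (w n)\<^sup>2 - V' n / (w n)\<^sup>2) \<longlonglongrightarrow> 0"
  proof (rule Lim_null_comparison)
    show "(\<lambda>n. C / \<epsilon>\<^sup>2 * (real (q n) / real (M n)) + C * (1 / real (M n))) \<longlonglongrightarrow> 0"
      using tendsto_add[OF tendsto_mult_left[OF qM, of "C / \<epsilon>\<^sup>2"] tendsto_mult_left[OF M0, of C]]
      by (simp only: mult_zero_right add_0_left)
    show "eventually (\<lambda>n. norm (V n / (w n)\<^sup>2 - V' n / (w n)\<^sup>2) \<le>
        C / \<epsilon>\<^sup>2 * (real (q n) / real (M n)) + C * (1 / real (M n))) sequentially"
      using good
    proof eventually_elim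
      case (elim n)
      have "\<bar>V n - V' n\<bar> \<le> C * (real (q n) / \<epsilon>\<^sup>2 + 1) * real (p n)"
        unfolding V_def V'_def using elim \<epsilon> by (intro bV) (auto simp: good_def)
      then have "\<bar>V n - V' n\<bar> / (w n)\<^sup>2 \<le> C * (real (q n) / \<epsilon>\<^sup>2 + 1) * real (p n) / (w n)\<^sup>2"
        by (intro divide_right_mono) auto
      also have "\<dots> = C / \<epsilon>\<^sup>2 * (real (q n) / real (M n)) + C * (1 / real (M n))"
        unfolding pM(4)[OF elim] using pM[OF elim] by (simp add: field_simps)
      finally show ?case by (simp add: diff_divide_distrib[symmetric] abs_divide)
    qed
  qed
  from tendsto_add[OF this V'lim] have Vlim: "(\<lambda>n. V n / (w n)\<^sup>2) \<longlonglongrightarrow> \<sigma>\<^sup>2" by simp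
  have R0: "R \<longlonglongrightarrow> 0"
  proof (rule Lim_null_comparison)
    show "(\<lambda>n. 3/2 * \<bar>t\<bar> ^ 3 * (1 / \<epsilon>\<^sup>2 + 4) * (1 / w n)) \<longlonglongrightarrow> 0"
      using tendsto_mult_left[OF w0, of "3/2 * \<bar>t\<bar> ^ 3 * (1 / \<epsilon>\<^sup>2 + 4)"] by (simp only: mult_zero_right)
    show "eventually (\<lambda>n. norm (R n) \<le> 3/2 * \<bar>t\<bar> ^ 3 * (1 / \<epsilon>\<^sup>2 + 4) * (1 / w n)) sequentially"
      using good
    proof eventually_elim
      case (elim n)
      have "norm (\<Sum>j=1..q n. \<Sum>i<p n. ln_chi_square_rem (m n j - i) (t * real (m n j) / (2 * w n)))
          \<le> (\<Sum>j=1..q n. 3/2 * \<bar>t\<bar> ^ 3 * real (p n) * real (m n j) / (\<epsilon>\<^sup>2 * w n ^ 3))"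
        using elim \<epsilon> pM[OF elim] by (intro sum_norm_le ln_chi_square_rem_sum_le) (auto simp: good_def)
      also have "\<dots> = 3/2 * \<bar>t\<bar> ^ 3 * real (p n) * real (M n) / (\<epsilon>\<^sup>2 * w n ^ 3)"
        unfolding M of_nat_sum sum_distrib_left sum_divide_distrib ..
      also have "\<dots> = 3/2 * \<bar>t\<bar> ^ 3 * (real (p n) * real (M n)) / (\<epsilon>\<^sup>2 * w n ^ 3)" by simp
      also have "\<dots> = 3/2 * \<bar>t\<bar> ^ 3 * (1 / \<epsilon>\<^sup>2) * (1 / w n)"
        unfolding pM(4)[OF elim, symmetric] using pM(3)[OF elim] by (simp add: eval_nat_numeral)
      finally have 1: "norm (\<Sum>j=1..q n. \<Sum>i<p n. ln_chi_square_rem (m n j - i) (t * real (m n j) / (2 * w n)))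
          \<le> 3/2 * \<bar>t\<bar> ^ 3 * (1 / \<epsilon>\<^sup>2) * (1 / w n)" .
      have "norm (\<Sum>i<p n. ln_chi_square_rem (M n - i) (t * real (M n) / (2 * w n)))
          \<le> 3/2 * \<bar>t\<bar> ^ 3 * real (p n) * real (M n) / ((1/2)\<^sup>2 * w n ^ 3)"
        using elim pM[OF elim] by (intro ln_chi_square_rem_sum_le) (auto simp: good_def)
      also have "\<dots> = 3/2 * \<bar>t\<bar> ^ 3 * (real (p n) * real (M n)) / ((1/2)\<^sup>2 * w n ^ 3)" by simp
      also have "\<dots> = 3/2 * \<bar>t\<bar> ^ 3 * 4 * (1 / w n)"
        unfolding pM(4)[OF elim, symmetric] using pM(3)[OF elim] by (simp add: eval_nat_numeral)
      finally have 2: "norm (\<Sum>i<p n. ln_chi_square_rem (M n - i) (t * real (M n) / (2 * w n)))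
          \<le> 3/2 * \<bar>t\<bar> ^ 3 * 4 * (1 / w n)" .
      show ?case
        unfolding R_def distrib_left distrib_right using norm_triangle_ineq4 1 2 by (rule order_trans[OF _ add_mono])
    qed
  qed
  have "(\<lambda>n. exp (\<i> * of_real (t * (A n / w n)) - of_real (t\<^sup>2 / 2 * (V n / (w n)\<^sup>2)) + R n))
      \<longlonglongrightarrow> exp (\<i> * of_real (t * 0) - of_real (t\<^sup>2 / 2 * \<sigma>\<^sup>2) + 0)"
    by (intro tendsto_intros A0 Vlim R0)
  moreover have "eventually (\<lambda>n. exp (\<i> * of_real (t * (A n / w n)) - of_real (t\<^sup>2 / 2 * (V n / (w n)\<^sup>2)) + R n)
      = log_LR_char (p n) (q n) (m n) (w n) t) sequentially"
    using good
  proof eventually_elim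
    case (elim n)
    have "log_LR_char (p n) (q n) (m n) (w n) t
        = exp (\<i> * of_real (t / w n * A n) - of_real (t\<^sup>2 / 2 * (V n / (w n)\<^sup>2)) + R n)"
      unfolding A_def V_def R_def using elim pM[OF elim]
      by (intro log_LR_char_exp M) (auto simp: good_def)
    then show ?case by simp
  qed
  ultimately have "(\<lambda>n. log_LR_char (p n) (q n) (m n) (w n) t)
      \<longlonglongrightarrow> exp (\<i> * of_real (t * 0) - of_real (t\<^sup>2 / 2 * \<sigma>\<^sup>2) + 0)"
    by (rule Lim_transform_eventually)
  then show ?thesis by simp
qed

section \<open>Whitening\<close>

text \<open>A Cholesky factor, read off from elimination on unit vectors taken in reverse order:
  once all \<open>e l\<close> with \<open>l > r\<close> are eliminated, the form sees only
  coordinates up to \<open>r\<close>, so the factor is lower triangular. This is what makes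
  whitening a row operation compatible with the pivots.\<close>

lemma lower_triangular_square_root:
  fixes \<beta> :: "(nat \<Rightarrow> real) \<Rightarrow> (nat \<Rightarrow> real) \<Rightarrow> real"
  assumes psd: "psd_form {..<p} \<beta>" and pos: "\<And>u k. k < p \<Longrightarrow> u k \<noteq> 0 \<Longrightarrow> \<beta> u u > 0"
  obtains B :: "nat \<Rightarrow> nat \<Rightarrow> real" where "\<And>r. r < p \<Longrightarrow> B r r > 0"
    and "\<And>u. \<beta> u u = (\<Sum>r<p. (\<Sum>l\<le>r. B r l * u l)\<^sup>2)"
proof -
  interpret psd_form "{..<p}" \<beta> by fact
  define e where "e l = (\<lambda>k. if k = l then 1 else 0 :: real)" for l :: nat
  define y where "y i = e (p - Suc i)" for i
  define B where "B r l = row_form \<beta> y (p - Suc r) (e l) (e r) / sqrt (pivot \<beta> y (p - Suc r))" for r l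
  have yr: "y (p - Suc r) = e r" if "r < p" for r
    using that by (simp add: y_def)
  \<comment> \<open>A zero pivot would make \<open>y i\<close> a combination of the unit vectors
    used before it and a null vector. All of these vanish at coordinate \<open>p - Suc i\<close>,
    where \<open>y i\<close> is 1.\<close>
  have pv: "pivot \<beta> y i > 0" if i: "i < p" for i
  proof (rule ccontr)
    assume "\<not> pivot \<beta> y i > 0"
    then have "row_form \<beta> y i (y i) (y i) = 0"
      using pivot_nonneg[of y i] by (simp add: pivot_def)
    from row_form_null_cases[OF this] obtain a \<nu>
      where \<nu>: "\<beta> \<nu> \<nu> = 0" "y i = (\<lambda>k. (\<Sum>l<i. a l * y l k) + \<nu> k)" .
    have "\<nu> (p - Suc i) = 0" using pos[of "p - Suc i" \<nu>] \<nu>(1) i by force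
    moreover have "y l (p - Suc i) = 0" if "l < i" for l
      using that i by (auto simp: y_def e_def)
    ultimately have "y i (p - Suc i) = 0" using fun_cong[OF \<nu>(2), of "p - Suc i"] by simp
    then show False by (simp add: y_def e_def)
  qed
  have null: "row_form \<beta> y (p - Suc r) (e l) v = 0" if "r < l" "l < p" for r l v
  proof -
    have "row_form \<beta> y (p - Suc r) (y (p - Suc l)) (y (p - Suc l)) = 0"
      using that by (intro row_form_row_null) auto
    then have "row_form \<beta> y (p - Suc r) (e l) (e l) = 0" using yr[of l] that by simp
    then show ?thesis by (rule psd_form.null_left[OF psd_form_row_form])
  qed
  show thesis
  proof (rule that[of B])
    show "B r r > 0" if "r < p" for r
      using pv[of "p - Suc r"] that by (simp add: B_def pivot_def yr real_div_sqrt)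
    show "\<beta> u u = (\<Sum>r<p. (\<Sum>l\<le>r. B r l * u l)\<^sup>2)" for u
    proof -
      have rf: "row_form \<beta> y i u w = (\<Sum>l<p. u l * row_form \<beta> y i (e l) w)" for i w
      proof -
        interpret R: psd_form "{..<p}" "row_form \<beta> y i" by (rule psd_form_row_form)
        show ?thesis using R.expand[of u w] by (simp add: e_def)
      qed
      have "row_form \<beta> y p (e l) u = 0" if "l < p" for l
      proof -
        have "row_form \<beta> y p (y (p - Suc l)) (y (p - Suc l)) = 0"
          using that by (intro row_form_row_null) auto
        then have "row_form \<beta> y p (e l) (e l) = 0" using yr[of l] that by simp
        then show ?thesis by (rule psd_form.null_left[OF psd_form_row_form])
      qed
      then have "row_form \<beta> y p u u = 0" unfolding rf[of p u] by (intro sum.neutral) auto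
      then have "\<beta> u u = (\<Sum>i<p. row_form \<beta> y i u (y i) * row_form \<beta> y i u (y i) / pivot \<beta> y i)"
        using row_form_expand[of \<beta> u u y p] by simp
      also have "\<dots> = (\<Sum>i<p. (row_form \<beta> y i u (y i) / sqrt (pivot \<beta> y i))\<^sup>2)"
        using pv by (intro sum.cong refl) (auto simp: power_divide power2_eq_square less_imp_le)
      also have "\<dots> = (\<Sum>r<p. (row_form \<beta> y (p - Suc r) u (e r) / sqrt (pivot \<beta> y (p - Suc r)))\<^sup>2)"
        by (rule sum.reindex_bij_witness[of _ "\<lambda>r. p - Suc r" "\<lambda>r. p - Suc r"]) (auto simp: y_def)
      also have "\<dots> = (\<Sum>r<p. (\<Sum>l\<le>r. B r l * u l)\<^sup>2)"
      proof (intro sum.cong refl arg_cong[where f="\<lambda>x. x\<^sup>2"])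
        fix r assume r: "r \<in> {..<p}"
        have "row_form \<beta> y (p - Suc r) u (e r) = (\<Sum>l\<le>r. u l * row_form \<beta> y (p - Suc r) (e l) (e r))"
          unfolding rf[of "p - Suc r" "e r"] using r null
          by (intro sum.mono_neutral_right) auto
        then show "row_form \<beta> y (p - Suc r) u (e r) / sqrt (pivot \<beta> y (p - Suc r)) = (\<Sum>l\<le>r. B r l * u l)"
          by (simp add: B_def sum_divide_distrib mult.commute)
      qed
      finally show ?thesis .
    qed
  qed
qed

text \<open>With \<open>u = \<Theta> *\<^sub>v v\<close> the quadratic form of
  \<open>\<Theta>\<close> at \<open>v\<close> is that of \<open>S\<close> at \<open>u\<close>.
  Invertibility comes first, because \<open>the (mat_inverse S)\<close> has a meaning only if an
  inverse is found.\<close>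

lemma positive_definite_inverse:
  assumes S: "positive_definite p S"
  defines "\<Theta> \<equiv> the (mat_inverse S)"
  shows "\<Theta> \<in> carrier_mat p p" and "Matrix.transpose_mat \<Theta> = \<Theta>"
    and "\<And>v. v \<in> carrier_vec p \<Longrightarrow> v \<noteq> 0\<^sub>v p \<Longrightarrow> v \<bullet> (\<Theta> *\<^sub>v v) > 0"
proof -
  have Sc: "S \<in> carrier_mat p p" and St: "Matrix.transpose_mat S = S"
    and Spos: "\<And>v. v \<in> carrier_vec p \<Longrightarrow> v \<noteq> 0\<^sub>v p \<Longrightarrow> v \<bullet> (S *\<^sub>v v) > 0"
    using S by (auto simp: positive_definite_def)
  have "Determinant.det S \<noteq> 0"
  proof
    assume "Determinant.det S = 0"
    then obtain v where v: "v \<in> carrier_vec p" "v \<noteq> 0\<^sub>v p" "S *\<^sub>v v = 0\<^sub>v p"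
      using det_0_iff_vec_prod_zero[OF Sc] by blast
    from Spos[OF v(1,2)] v(1) show False unfolding v(3) by simp
  qed
  then have "S \<in> Units (ring_mat TYPE(real) p ())"
    by (rule det_non_zero_imp_unit[OF Sc])
  then obtain \<Theta>' where "mat_inverse S = Some \<Theta>'"
    using mat_inverse(1)[OF Sc] by fastforce
  from mat_inverse(2)[OF Sc this] this
  have \<Theta>: "S * \<Theta> = 1\<^sub>m p" "\<Theta> * S = 1\<^sub>m p" and c: "\<Theta> \<in> carrier_mat p p"
    by (auto simp: \<Theta>_def)
  show "\<Theta> \<in> carrier_mat p p" by (rule c)
  have "Matrix.transpose_mat \<Theta> * S = 1\<^sub>m p"
    using transpose_mult[OF Sc c] St \<Theta>(1) by simp
  then have "Matrix.transpose_mat \<Theta> = Matrix.transpose_mat \<Theta> * (S * \<Theta>)"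
    using \<Theta>(1) c by simp
  also have "\<dots> = (Matrix.transpose_mat \<Theta> * S) * \<Theta>"
    using c Sc by (intro assoc_mult_mat[symmetric]) auto
  also have "\<dots> = \<Theta>" using \<open>Matrix.transpose_mat \<Theta> * S = 1\<^sub>m p\<close> c by simp
  finally show "Matrix.transpose_mat \<Theta> = \<Theta>" .
  fix v :: "real Matrix.vec" assume v: "v \<in> carrier_vec p" "v \<noteq> 0\<^sub>v p"
  let ?u = "\<Theta> *\<^sub>v v"
  have u: "?u \<in> carrier_vec p" using c v by simp
  have Su: "S *\<^sub>v ?u = v"
    using assoc_mult_mat_vec[OF Sc c v(1)] \<Theta>(1) v by simp
  moreover have "S *\<^sub>v 0\<^sub>v p = 0\<^sub>v p" using Sc by (intro eq_vecI) auto
  ultimately have "?u \<noteq> 0\<^sub>v p" using v(2) by metis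
  from Spos[OF u this] have "?u \<bullet> v > 0" unfolding Su .
  then show "v \<bullet> ?u > 0" using comm_scalar_prod[OF u v(1)] by simp
qed

text \<open>
  The norming constant of \<^term>\<open>mvn_density\<close> need not be evaluated: the image is proportional to
  the standard Gaussian measure, and both are probability measures.
\<close>

lemma mvn_whitening:
  assumes "prob_space M" and X: "mvn_distributed M p X \<mu> S"
    and \<mu>: "\<mu> \<in> carrier_vec p" and S: "positive_definite p S"
    and B: "\<And>r. r < p \<Longrightarrow> B r r > 0"
    and sq: "\<And>u. (\<Sum>i<p. \<Sum>j<p. u i * u j * the (mat_inverse S) $$ (i, j)) = (\<Sum>r<p. (\<Sum>l\<le>r. B r l * u l)\<^sup>2)"
  shows "distr M (PiM {..<p} (\<lambda>_. lborel)) (\<lambda>\<omega>. \<lambda>r\<in>{..<p}. \<Sum>l\<le>r. B r l * (X \<omega> l - vec_index \<mu> l)) = std_gauss {..<p}"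
proof -
  interpret prob_space M by fact
  let ?L = "PiM {..<p} (\<lambda>_. lborel :: real measure)"
  let ?T = "\<lambda>x. \<lambda>r\<in>{..<p}. \<Sum>l\<le>r. B r l * (x l - vec_index \<mu> l)"
  let ?\<Theta> = "the (mat_inverse S)"
  have \<Theta>: "?\<Theta> \<in> carrier_mat p p" using positive_definite_inverse[OF S] by simp
  define c0 where "c0 = 1 / sqrt ((2 * pi) ^ p * Determinant.det S)"
  have dist: "distributed M ?L X (\<lambda>x. ennreal (mvn_density p \<mu> S x))"
    using X by (simp add: mvn_distributed_def)
  have Xm[measurable]: "X \<in> M \<rightarrow>\<^sub>M ?L" using dist by (simp add: distributed_def)
  have Tm[measurable]: "?T \<in> ?L \<rightarrow>\<^sub>M ?L"
    by (intro measurable_restrict) (auto intro!: borel_measurable_sum)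
  have dens: "mvn_density p \<mu> S x = exp (- (\<Sum>r<p. (?T x r)\<^sup>2) / 2) * c0" for x
  proof -
    let ?d = "Matrix.vec p x - \<mu>"
    have d: "vec_index ?d i = x i - vec_index \<mu> i" if "i < p" for i using that \<mu> by simp
    have "?d \<bullet> (?\<Theta> *\<^sub>v ?d) = (\<Sum>i<p. \<Sum>j<p. vec_index ?d i * vec_index ?d j * ?\<Theta> $$ (i, j))"
      using \<Theta> \<mu> by (simp add: scalar_prod_def lessThan_atLeast0 sum_distrib_left mult_ac)
    also have "\<dots> = (\<Sum>r<p. (\<Sum>l\<le>r. B r l * vec_index ?d l)\<^sup>2)" by (rule sq)
    also have "\<dots> = (\<Sum>r<p. (?T x r)\<^sup>2)"
    proof (rule sum.cong[OF refl])
      fix r assume "r \<in> {..<p}"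
      then have "(\<Sum>l\<le>r. B r l * vec_index ?d l) = (\<Sum>l\<le>r. B r l * (x l - vec_index \<mu> l))"
        by (intro sum.cong refl) (simp only: d atMost_iff lessThan_iff le_less_trans)
      with \<open>r \<in> {..<p}\<close> show "(\<Sum>l\<le>r. B r l * vec_index ?d l)\<^sup>2 = (?T x r)\<^sup>2" by simp
    qed
    finally show ?thesis by (simp add: mvn_density_def c0_def)
  qed
  have Bnz: "B r r \<noteq> 0" if "r < p" for r using B[OF that] by simp
  let ?b = "\<Prod>r<p. ennreal \<bar>B r r\<bar>"
  have b: "?b \<noteq> 0" "?b \<noteq> \<infinity>"
  proof -
    have eq: "?b = ennreal (\<Prod>r<p. \<bar>B r r\<bar>)" by (simp add: prod_ennreal)
    have "(\<Prod>r<p. \<bar>B r r\<bar>) > 0" using B by (intro prod_pos) force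
    then show "?b \<noteq> 0" unfolding eq ennreal_eq_0_iff by linarith
    show "?b \<noteq> \<infinity>" unfolding eq by simp
  qed
  define G where "G = ennreal ((1 / sqrt (2 * pi)) ^ p)"
  have G: "G \<noteq> 0" "G \<noteq> \<infinity>" by (auto simp: G_def)
  \<comment> \<open>Both measures of \<open>A\<close> are multiples of the same Gaussian integral
    over \<open>A\<close>; the triangular substitution relates them, with Jacobian
    \<open>?b\<close>.\<close>
  have main: "?b * G * emeasure (distr M ?L (\<lambda>\<omega>. ?T (X \<omega>))) A = ennreal c0 * emeasure (std_gauss {..<p}) A"
    if A: "A \<in> sets ?L" for A
  proof -
    note [measurable] = A
    let ?F = "\<lambda>y. indicator A y * ennreal (exp (- (\<Sum>r<p. (y r)\<^sup>2) / 2))"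
    have Fm: "?F \<in> borel_measurable ?L" by measurable
    have "emeasure (distr M ?L (\<lambda>\<omega>. ?T (X \<omega>))) A = (\<integral>\<^sup>+\<omega>. indicator A (?T (X \<omega>)) \<partial>M)"
      using A by (simp add: nn_integral_distr[OF measurable_compose[OF Xm Tm], of "indicator A", symmetric])
    also have "\<dots> = (\<integral>\<^sup>+x. ennreal (mvn_density p \<mu> S x) * indicator A (?T x) \<partial>?L)"
      by (rule distributed_nn_integral[OF dist, symmetric]) measurable
    also have "\<dots> = (\<integral>\<^sup>+x. ennreal c0 * ?F (?T x) \<partial>?L)"
      unfolding dens by (intro nn_integral_cong) (simp add: ennreal_mult' ennreal_mult'' mult_ac)
    also have "\<dots> = ennreal c0 * (\<integral>\<^sup>+x. ?F (?T x) \<partial>?L)"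
      by (intro nn_integral_cmult measurable_compose[OF Tm Fm])
    finally have 1: "emeasure (distr M ?L (\<lambda>\<omega>. ?T (X \<omega>))) A = ennreal c0 * (\<integral>\<^sup>+x. ?F (?T x) \<partial>?L)" .
    let ?s = "\<lambda>r z. (\<Sum>l<r. B r l * (z l - vec_index \<mu> l)) - B r r * vec_index \<mu> r"
    have T: "?T z = (\<lambda>r\<in>{..<p}. ?s r (restrict z {..<r}) + B r r * z r)" for z
      by (auto simp: fun_eq_iff lessThan_Suc_atMost[symmetric] algebra_simps)
    have "?b * (\<integral>\<^sup>+z. ?F (\<lambda>r\<in>{..<p}. ?s r (restrict z {..<r}) + B r r * z r) \<partial>?L) = (\<integral>\<^sup>+z. ?F z \<partial>?L)"
      by (rule nn_integral_PiM_triangular[where s = ?s, OF Bnz _ Fm]) auto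
    then have 2: "?b * (\<integral>\<^sup>+z. ?F (?T z) \<partial>?L) = (\<integral>\<^sup>+z. ?F z \<partial>?L)"
      unfolding T .
    have "emeasure (std_gauss {..<p}) A = (\<integral>\<^sup>+x. (\<Prod>k<p. ennreal (std_normal_density (x k))) * indicator A x \<partial>?L)"
      unfolding std_gauss_eq_density[OF finite_lessThan] by (intro emeasure_density) measurable
    also have "\<dots> = (\<integral>\<^sup>+x. G * ?F x \<partial>?L)"
      unfolding prod_std_normal_density[OF finite_lessThan] G_def
      by (intro nn_integral_cong) (simp add: mult_ac)
    also have "\<dots> = G * (\<integral>\<^sup>+x. ?F x \<partial>?L)" by (intro nn_integral_cmult Fm)
    finally show ?thesis unfolding 1 2[symmetric] by (simp only: mult_ac)
  qed
  have spL: "space ?L \<in> sets ?L" by simp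
  interpret Y: prob_space "distr M ?L (\<lambda>\<omega>. ?T (X \<omega>))" by (rule prob_space_distr) measurable
  interpret N: prob_space "std_gauss {..<p}" by (rule prob_space_std_gauss)
  \<comment> \<open>Evaluation at the whole space identifies \<open>c0\<close> without computing the
    determinant of \<open>S\<close>.\<close>
  have "?b * G = ennreal c0"
    using main[OF spL] Y.emeasure_space_1 N.emeasure_space_1 by (simp add: space_std_gauss)
  then have eq: "?b * G * emeasure (distr M ?L (\<lambda>\<omega>. ?T (X \<omega>))) A = ?b * G * emeasure (std_gauss {..<p}) A"
    if "A \<in> sets ?L" for A
    using main[OF that] by simp
  have "?b * G \<noteq> 0" using b(1) G(1) by (rule no_zero_divisors)
  moreover have "?b * G \<noteq> \<infinity>" using b(2) G(2) unfolding infinity_ennreal_def ennreal_mult_eq_top_iff by blast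
  ultimately have "emeasure (distr M ?L (\<lambda>\<omega>. ?T (X \<omega>))) A = emeasure (std_gauss {..<p}) A"
    if "A \<in> sets ?L" for A
    using eq[OF that] unfolding ennreal_mult_cancel_left infinity_ennreal_def by blast
  then show ?thesis by (intro measure_eqI) (auto simp: sets_std_gauss)
qed

text \<open>Independent standard Gaussian vectors form one long standard Gaussian vector. The
  bijection is left free so that observations split into rows and rows split into observations can
  be flattened to the same index set.\<close>

lemma flatten_std_gauss:
  fixes S :: "'s set" and I :: "'i set" and J :: "'j set"
  assumes "prob_space P" and I: "finite I" "I \<noteq> {}" and J: "finite J" and S: "finite S"
    and h: "bij_betw h S (I \<times> J)"
    and ind: "prob_space.indep_vars P (\<lambda>_. PiM J (\<lambda>_. lborel)) W I"
    and law: "\<And>i. i \<in> I \<Longrightarrow> distr P (PiM J (\<lambda>_. lborel)) (W i) = std_gauss J"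
  shows "distr P (PiM S (\<lambda>_. lborel)) (\<lambda>\<omega>. \<lambda>s\<in>S. W (fst (h s)) \<omega> (snd (h s))) = std_gauss S"
proof -
  interpret prob_space P by fact
  let ?N = "density lborel (\<lambda>x. ennreal (std_normal_density x))"
  interpret N: prob_space ?N by (rule prob_space_normal_density) simp
  interpret PN: product_sigma_finite "\<lambda>_. ?N" by standard
  have Wm: "W i \<in> P \<rightarrow>\<^sub>M PiM J (\<lambda>_. lborel)" if "i \<in> I" for i
    using ind that by (auto simp: indep_vars_def)
  have hs: "fst (h s) \<in> I" "snd (h s) \<in> J" if "s \<in> S" for s
    using bij_betwE[OF h] that by (auto simp: mem_Times_iff)
  let ?Z = "\<lambda>\<omega>. \<lambda>s\<in>S. W (fst (h s)) \<omega> (snd (h s))"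
  have Zm[measurable]: "?Z \<in> P \<rightarrow>\<^sub>M PiM S (\<lambda>_. lborel)"
  proof (rule measurable_restrict)
    fix s assume s: "s \<in> S"
    show "(\<lambda>\<omega>. W (fst (h s)) \<omega> (snd (h s))) \<in> P \<rightarrow>\<^sub>M lborel"
      using measurable_compose[OF Wm[OF hs(1)[OF s]] measurable_component_singleton[OF hs(2)[OF s]]] .
  qed
  show ?thesis
    unfolding std_gauss_def
  proof (rule PN.PiM_eqI[OF S])
    show "sets (distr P (PiM S (\<lambda>_. lborel)) ?Z) = sets (PiM S (\<lambda>_. ?N))"
      by (simp add: sets_std_gauss[unfolded std_gauss_def])
    fix A :: "'s \<Rightarrow> real set" assume A: "\<And>s. s \<in> S \<Longrightarrow> A s \<in> sets ?N"
    let ?g = "inv_into S h"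
    have g: "?g ij \<in> S" "h (?g ij) = ij" if "ij \<in> I \<times> J" for ij
      using bij_betw_inv_into[OF h] bij_betw_inv_into_right[OF h that] that by (auto dest: bij_betwE)
    have gh: "?g (h s) = s" if "s \<in> S" for s using bij_betw_inv_into_left[OF h that] .
    have Am: "A (?g (i, j)) \<in> sets lborel" if "i \<in> I" "j \<in> J" for i j using A g that by simp
    let ?E = "\<lambda>i. Pi\<^sub>E J (\<lambda>j. A (?g (i, j)))"
    have Em: "?E i \<in> sets (PiM J (\<lambda>_. lborel))" if "i \<in> I" for i
      using that J Am by (intro sets_PiM_I_finite) auto
    have SA: "Pi\<^sub>E S A \<in> sets (PiM S (\<lambda>_. lborel))"
      using A S by (intro sets_PiM_I_finite) auto
    have Wext: "W i \<omega> \<in> extensional J" if "i \<in> I" "\<omega> \<in> space P" for i \<omega>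
      using measurable_space[OF Wm[OF that(1)] that(2)] by (auto simp: space_PiM PiE_def)
    have "?Z -` Pi\<^sub>E S A \<inter> space P = (\<Inter>i\<in>I. W i -` ?E i \<inter> space P)"
    proof (intro Set.set_eqI iffI)
      fix \<omega> assume \<omega>: "\<omega> \<in> ?Z -` Pi\<^sub>E S A \<inter> space P"
      show "\<omega> \<in> (\<Inter>i\<in>I. W i -` ?E i \<inter> space P)"
      proof (rule INT_I)
        fix i assume i: "i \<in> I"
        have "W i \<omega> j \<in> A (?g (i, j))" if "j \<in> J" for j
        proof -
          have "?Z \<omega> (?g (i, j)) \<in> A (?g (i, j))" using \<omega> g(1)[of "(i, j)"] i that by (auto simp: PiE_iff)
          then show ?thesis using g[of "(i, j)"] i that by simp
        qed
        then show "\<omega> \<in> W i -` ?E i \<inter> space P" using \<omega> Wext[OF i] by (auto simp: PiE_iff)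
      qed
    next
      fix \<omega> assume \<omega>: "\<omega> \<in> (\<Inter>i\<in>I. W i -` ?E i \<inter> space P)"
      have "W (fst (h s)) \<omega> (snd (h s)) \<in> A s" if "s \<in> S" for s
      proof -
        have "\<omega> \<in> W (fst (h s)) -` ?E (fst (h s)) \<inter> space P" using \<omega> hs(1)[OF that] by (rule INT_D)
        then have "W (fst (h s)) \<omega> (snd (h s)) \<in> A (?g (fst (h s), snd (h s)))"
          using hs(2)[OF that] by (auto simp: PiE_iff)
        then show ?thesis using gh[OF that] by simp
      qed
      moreover have "\<omega> \<in> space P" using \<omega> I(2) by auto
      ultimately show "\<omega> \<in> ?Z -` Pi\<^sub>E S A \<inter> space P" by (auto simp: PiE_iff)
    qed
    then have "emeasure (distr P (PiM S (\<lambda>_. lborel)) ?Z) (Pi\<^sub>E S A)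
        = ennreal (prob (\<Inter>i\<in>I. W i -` ?E i \<inter> space P))"
      using SA by (simp add: emeasure_distr emeasure_eq_measure)
    also have "prob (\<Inter>i\<in>I. W i -` ?E i \<inter> space P) = (\<Prod>i\<in>I. prob (W i -` ?E i \<inter> space P))"
      using I Em by (intro indep_varsD_finite[OF ind]) auto
    also have "ennreal \<dots> = (\<Prod>i\<in>I. emeasure P (W i -` ?E i \<inter> space P))"
      by (simp add: prod_ennreal emeasure_eq_measure)
    also have "\<dots> = (\<Prod>i\<in>I. emeasure (std_gauss J) (?E i))"
      by (intro prod.cong refl, subst law[symmetric]) (auto simp: emeasure_distr Wm Em)
    also have "\<dots> = (\<Prod>i\<in>I. \<Prod>j\<in>J. emeasure ?N (A (?g (i, j))))"
      unfolding std_gauss_def using J Am by (intro prod.cong refl PN.emeasure_PiM) auto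
    also have "\<dots> = (\<Prod>ij\<in>I \<times> J. emeasure ?N (A (?g ij)))"
      by (simp add: prod.cartesian_product case_prod_beta)
    also have "\<dots> = (\<Prod>s\<in>S. emeasure ?N (A s))"
      by (subst prod.reindex_bij_betw[OF h, symmetric]) (auto simp: gh)
    finally show "emeasure (distr P (PiM S (\<lambda>_. lborel)) ?Z) (Pi\<^sub>E S A) = (\<Prod>s\<in>S. emeasure ?N (A s))" .
  qed
qed

text \<open>Transposition of the data matrix: independence is given across observations, while
  elimination works on rows. Both families flatten to the same law on \<open>K \<times> R\<close>,
  and the single map \<open>?c\<close> recovers the rows.\<close>

lemma distr_rows_std_gauss:
  fixes K :: "'k set" and R :: "'r set"
  assumes "prob_space P" and K: "finite K" "K \<noteq> {}" and R: "finite R" "R \<noteq> {}"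
    and ind: "prob_space.indep_vars P (\<lambda>_. PiM R (\<lambda>_. lborel)) Y K"
    and law: "\<And>k. k \<in> K \<Longrightarrow> distr P (PiM R (\<lambda>_. lborel)) (Y k) = std_gauss R"
  shows "distr P (PiM R (\<lambda>_. std_gauss K)) (\<lambda>\<omega>. \<lambda>r\<in>R. \<lambda>k\<in>K. Y k \<omega> r) = PiM R (\<lambda>_. std_gauss K)"
proof -
  interpret prob_space P by fact
  let ?S = "K \<times> R"
  let ?Q = "PiM R (\<lambda>_. std_gauss K)"
  interpret Q: prob_space ?Q by (intro prob_space_PiM prob_space_std_gauss)
  let ?Z = "\<lambda>\<omega>. \<lambda>s\<in>?S. Y (fst (id s)) \<omega> (snd (id s))"
  let ?flat = "\<lambda>y. \<lambda>s\<in>?S. y (fst (prod.swap s)) (snd (prod.swap s))"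
  let ?c = "\<lambda>z. \<lambda>r\<in>R. \<lambda>k\<in>K. z (k, r)"
  have fin: "finite ?S" using K R by simp
  have Ym: "Y k \<in> P \<rightarrow>\<^sub>M PiM R (\<lambda>_. lborel)" if "k \<in> K" for k
    using ind that by (auto simp: indep_vars_def)
  have Z: "distr P (PiM ?S (\<lambda>_. lborel)) ?Z = std_gauss ?S"
    by (rule flatten_std_gauss[OF prob_space_axioms K R(1) fin bij_betw_id ind law])
  have Zm: "?Z \<in> P \<rightarrow>\<^sub>M PiM ?S (\<lambda>_. lborel)"
  proof (rule measurable_restrict)
    fix s assume s: "s \<in> ?S"
    then show "(\<lambda>\<omega>. Y (fst (id s)) \<omega> (snd (id s))) \<in> P \<rightarrow>\<^sub>M lborel"
      using measurable_compose[OF Ym[of "fst s"] measurable_component_singleton[of "snd s" R]] by auto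
  qed
  have comp: "(\<lambda>y. y r) \<in> ?Q \<rightarrow>\<^sub>M PiM K (\<lambda>_. lborel)" if "r \<in> R" for r
    using measurable_component_singleton[OF that, of "\<lambda>_. std_gauss K"]
    by (simp cong: measurable_cong_sets add: sets_std_gauss)
  have claw: "distr ?Q (PiM K (\<lambda>_. lborel)) (\<lambda>y. y r) = std_gauss K" if "r \<in> R" for r
  proof -
    have "distr ?Q (std_gauss K) (\<lambda>y. y r) = std_gauss K"
      using that R(1) prob_space_std_gauss by (intro distr_PiM_component) auto
    then show ?thesis by (simp cong: distr_cong add: sets_std_gauss)
  qed
  \<comment> \<open>Under the product measure the coordinate projections are independent, so the
    target law is an instance of the flattening lemma too.\<close>
  have cind: "Q.indep_vars (\<lambda>_. PiM K (\<lambda>_. lborel)) (\<lambda>r y. y r) R"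
  proof (subst Q.indep_vars_iff_distr_eq_PiM'[OF R(2) comp])
    have "distr ?Q (PiM R (\<lambda>_. PiM K (\<lambda>_. lborel))) (\<lambda>y. \<lambda>r\<in>R. y r) = distr ?Q ?Q (\<lambda>y. y)"
      by (intro distr_cong sets_PiM_cong refl)
         (auto simp: sets_std_gauss space_PiM PiE_def extensional_def restrict_def fun_eq_iff)
    also have "\<dots> = ?Q" by (rule distr_id2) simp
    also have "\<dots> = PiM R (\<lambda>r. distr ?Q (PiM K (\<lambda>_. lborel)) (\<lambda>y. y r))"
      by (intro PiM_cong refl claw[symmetric])
    finally show "distr ?Q (PiM R (\<lambda>_. PiM K (\<lambda>_. lborel))) (\<lambda>y. \<lambda>r\<in>R. y r)
        = PiM R (\<lambda>r. distr ?Q (PiM K (\<lambda>_. lborel)) (\<lambda>y. y r))" .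
  qed simp
  have swap: "bij_betw prod.swap ?S (R \<times> K)"
    by (rule bij_betw_byWitness[where f'=prod.swap]) auto
  have F: "distr ?Q (PiM ?S (\<lambda>_. lborel)) ?flat = std_gauss ?S"
    by (rule flatten_std_gauss[OF Q.prob_space_axioms R K(1) fin swap cind claw])
  have Fm: "?flat \<in> ?Q \<rightarrow>\<^sub>M PiM ?S (\<lambda>_. lborel)"
  proof (rule measurable_restrict)
    fix s assume s: "s \<in> ?S"
    then show "(\<lambda>y. y (fst (prod.swap s)) (snd (prod.swap s))) \<in> ?Q \<rightarrow>\<^sub>M lborel"
      using measurable_compose[OF comp[of "snd s"] measurable_component_singleton[of "fst s" K]] by auto
  qed
  have cm: "?c \<in> PiM ?S (\<lambda>_. lborel) \<rightarrow>\<^sub>M ?Q"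
  proof (rule measurable_restrict)
    fix r assume r: "r \<in> R"
    have "(\<lambda>z. \<lambda>k\<in>K. z (k, r)) \<in> PiM ?S (\<lambda>_. lborel) \<rightarrow>\<^sub>M PiM K (\<lambda>_. lborel :: real measure)"
      using r by (intro measurable_restrict measurable_component_singleton) auto
    then show "(\<lambda>z. \<lambda>k\<in>K. z (k, r)) \<in> PiM ?S (\<lambda>_. lborel) \<rightarrow>\<^sub>M std_gauss K"
      by (simp cong: measurable_cong_sets add: sets_std_gauss)
  qed
  have "distr P ?Q (\<lambda>\<omega>. \<lambda>r\<in>R. \<lambda>k\<in>K. Y k \<omega> r) = distr (distr P (PiM ?S (\<lambda>_. lborel)) ?Z) ?Q ?c"
    by (subst distr_distr[OF cm Zm]) (intro distr_cong refl, auto simp: fun_eq_iff)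
  also have "\<dots> = distr (distr ?Q (PiM ?S (\<lambda>_. lborel)) ?flat) ?Q ?c" unfolding Z F ..
  also have "\<dots> = distr ?Q ?Q (\<lambda>y. y)"
    by (subst distr_distr[OF cm Fm], intro distr_cong refl)
       (auto simp: fun_eq_iff space_PiM space_std_gauss PiE_def extensional_def Pi_iff restrict_def)
  also have "\<dots> = ?Q" by (rule distr_id2) simp
  finally show ?thesis .
qed

section \<open>Within-group and pooled forms\<close>

definition observations :: "nat \<Rightarrow> (nat \<Rightarrow> nat) \<Rightarrow> (nat \<times> nat) set" where
  "observations q N = (SIGMA j:{1..q}. {1..N j})"

definition group_form :: "(nat \<Rightarrow> nat) \<Rightarrow> nat \<Rightarrow> (nat \<times> nat \<Rightarrow> real) \<Rightarrow> (nat \<times> nat \<Rightarrow> real) \<Rightarrow> real" where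
  "group_form N j u v = (\<Sum>k=1..N j. (u (j, k) - (\<Sum>l=1..N j. u (j, l)) / real (N j)) *
     (v (j, k) - (\<Sum>l=1..N j. v (j, l)) / real (N j)))"

definition pooled_form :: "nat \<Rightarrow> (nat \<Rightarrow> nat) \<Rightarrow> (nat \<times> nat \<Rightarrow> real) \<Rightarrow> (nat \<times> nat \<Rightarrow> real) \<Rightarrow> real" where
  "pooled_form q N u v = (\<Sum>j=1..q. group_form N j u v)"

lemma finite_observations [simp]: "finite (observations q N)"
  by (simp add: observations_def)

lemma card_observations: "card (observations q N) = (\<Sum>j=1..q. N j)"
  by (simp add: observations_def card_SigmaI)

lemma sum_observations: "(\<Sum>\<kappa>\<in>observations q N. f \<kappa>) = (\<Sum>j=1..q. \<Sum>k=1..N j. f (j, k))"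
  unfolding observations_def by (subst sum.Sigma) auto

lemma group_form_eq:
  assumes "N j \<ge> 1"
  shows "group_form N j u v = (\<Sum>k=1..N j. u (j, k) * v (j, k))
    - (\<Sum>k=1..N j. u (j, k)) * (\<Sum>k=1..N j. v (j, k)) / real (N j)"
proof -
  let ?a = "(\<Sum>l=1..N j. u (j, l)) / real (N j)" and ?b = "(\<Sum>l=1..N j. v (j, l)) / real (N j)"
  have "group_form N j u v = (\<Sum>k=1..N j. u (j, k) * v (j, k) - ?b * u (j, k) - ?a * v (j, k) + ?a * ?b)"
    unfolding group_form_def by (intro sum.cong refl) (simp add: algebra_simps)
  also have "\<dots> = (\<Sum>k=1..N j. u (j, k) * v (j, k)) - ?b * (\<Sum>k=1..N j. u (j, k))
      - ?a * (\<Sum>k=1..N j. v (j, k)) + real (N j) * (?a * ?b)"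
    by (simp add: sum.distrib sum_subtractf sum_distrib_left)
  also have "real (N j) * (?a * ?b) = ?a * (\<Sum>k=1..N j. v (j, k))" using assms by simp
  finally show ?thesis by simp
qed

lemma sum_if_group:
  fixes f :: "nat \<Rightarrow> nat \<Rightarrow> real"
  assumes "j \<in> {1..q}"
  shows "(\<Sum>i=1..q. \<Sum>k=1..N i. if i = j then f i k else 0) = (\<Sum>k=1..N j. f j k)"
proof -
  have "(\<Sum>i=1..q. \<Sum>k=1..N i. if i = j then f i k else 0) = (\<Sum>i=1..q. if i = j then (\<Sum>k=1..N j. f j k) else 0)"
    by (intro sum.cong refl) auto
  also have "\<dots> = (\<Sum>k=1..N j. f j k)" using assms by (subst sum.delta) auto
  finally show ?thesis .
qed

text \<open>Centering within groups is the orthogonal projection off the \<open>q\<close> group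
  indicators, which are pairwise orthogonal; hence the loss of \<open>q\<close> dimensions.\<close>

lemma pooled_form_rep:
  assumes N: "\<And>j. j \<in> {1..q} \<Longrightarrow> N j \<ge> 1"
  shows "psd_form (observations q N) (pooled_form q N)"
    and "\<exists>J. card J + q = (\<Sum>j=1..q. N j) \<and>
      gauss_rep (observations q N) (std_gauss (observations q N)) (pooled_form q N) J"
proof -
  let ?K = "observations q N"
  define w where "w j = (\<lambda>\<kappa> :: nat \<times> nat. if fst \<kappa> = j then 1 else 0 :: real)" for j
  have sw: "std_form ?K u (w j) = (\<Sum>k=1..N j. u (j, k))" if "j \<in> {1..q}" for u j
    using sum_if_group[OF that, of "\<lambda>i k. u (i, k)" N]
    by (simp add: std_form_def sum_observations w_def if_distrib cong: if_cong)
  have ww: "std_form ?K (w j) (w j) = real (N j)" if "j \<in> {1..q}" for j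
    unfolding sw[OF that] by (simp add: w_def)
  have "proj_form (std_form ?K) w {1..q} u v = pooled_form q N u v" for u v
  proof -
    have "proj_form (std_form ?K) w {1..q} u v
        = std_form ?K u v - (\<Sum>j=1..q. (\<Sum>k=1..N j. u (j, k)) * (\<Sum>k=1..N j. v (j, k)) / real (N j))"
      unfolding proj_form_def by (intro arg_cong2[where f=minus] refl sum.cong) (simp only: ww, simp only: sw)
    also have "\<dots> = pooled_form q N u v"
      unfolding pooled_form_def std_form_def sum_observations sum_subtractf[symmetric]
      using N by (intro sum.cong refl) (simp add: group_form_eq)
    finally show ?thesis .
  qed
  then have eq: "proj_form (std_form ?K) w {1..q} = pooled_form q N" by blast
  have "psd_form ?K (proj_form (std_form ?K) w {1..q}) \<and>
    (\<exists>J'. card J' + card {1..q} = card ?K \<and> gauss_rep ?K (std_gauss ?K) (proj_form (std_form ?K) w {1..q}) J')"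
  proof (rule proj_form_rep)
    show "psd_form ?K (std_form ?K)" by (rule psd_form_std_form) simp
    show "gauss_rep ?K (std_gauss ?K) (std_form ?K) ?K" by (rule gauss_rep_std_form) simp
    show "std_form ?K (w l) (w l) > 0" if "l \<in> {1..q}" for l
      using N[OF that] ww[OF that] by simp
    show "std_form ?K (w l) (w l') = 0" if "l \<in> {1..q}" "l' \<in> {1..q}" "l \<noteq> l'" for l l'
      unfolding sw[OF that(2)] using that by (simp add: w_def)
  qed simp
  then show "psd_form ?K (pooled_form q N)"
    "\<exists>J. card J + q = (\<Sum>j=1..q. N j) \<and> gauss_rep ?K (std_gauss ?K) (pooled_form q N) J"
    unfolding eq card_observations by auto
qed

text \<open>The group form is placed on the set of all observations, so that it refers to the same
  Gaussian measure as the pooled form. Besides the indicator of group \<open>j\<close>, the unit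
  vectors of all other observations are projected off, which leaves rank
  \<open>N j - 1\<close>.\<close>

lemma group_form_rep:
  assumes N: "\<And>j. j \<in> {1..q} \<Longrightarrow> N j \<ge> 1" and j: "j \<in> {1..q}"
  shows "psd_form (observations q N) (group_form N j)"
    and "\<exists>J. card J + 1 = N j \<and>
      gauss_rep (observations q N) (std_gauss (observations q N)) (group_form N j) J"
proof -
  let ?K = "observations q N"
  define L where "L = {\<kappa>\<in>?K. fst \<kappa> \<noteq> j}"
  text \<open>\<open>(j, 0)\<close> is not an observation; it labels the indicator of group \<open>j\<close>.\<close>
  define w where "w \<kappa> = (if \<kappa> = (j, 0) then (\<lambda>\<kappa>'. if fst \<kappa>' = j then 1 else 0 :: real)
      else (\<lambda>\<kappa>'. if \<kappa>' = \<kappa> then 1 else 0))" for \<kappa> :: "nat \<times> nat"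
  have L: "finite L" "(j, 0) \<notin> L" "L \<subseteq> ?K" by (auto simp: L_def observations_def)
  have K: "?K = L \<union> {j} \<times> {1..N j}" and disj: "L \<inter> {j} \<times> {1..N j} = {}"
    using j by (auto simp: L_def observations_def)
  have cK: "card ?K = card L + N j"
    by (subst K) (use card_Un_disjoint[OF L(1) _ disj] in simp)
  have sK: "sum f ?K = sum f L + (\<Sum>k=1..N j. f (j, k))" for f :: "nat \<times> nat \<Rightarrow> real"
  proof -
    have "sum f ({j} \<times> {1..N j}) = (\<Sum>k=1..N j. f (j, k))"
      by (rule sum.reindex_bij_witness[of _ "\<lambda>k. (j, k)" snd]) auto
    then show ?thesis by (subst K) (use sum.union_disjoint[OF L(1) _ disj, of f] in simp)
  qed
  have s0: "std_form ?K u (w (j, 0)) = (\<Sum>k=1..N j. u (j, k))" for u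
    unfolding std_form_def sK by (simp add: w_def) (simp add: L_def)
  have sL: "std_form ?K u (w \<kappa>) = u \<kappa>" if "\<kappa> \<in> L" for u \<kappa>
  proof -
    have "\<kappa> \<noteq> (j, 0)" "\<kappa> \<in> ?K" using that L by auto
    then show ?thesis by (simp add: std_form_def w_def if_distrib cong: if_cong)
  qed
  have w0: "w (j, 0) (j, k) = 1" for k by (simp add: w_def)
  have wL: "w \<kappa> \<kappa> = 1" if "\<kappa> \<in> L" for \<kappa> using that L by (auto simp: w_def)
  have "proj_form (std_form ?K) w (insert (j, 0) L) u v = group_form N j u v" for u v
  proof -
    have "proj_form (std_form ?K) w (insert (j, 0) L) u v = std_form ?K u v
        - ((\<Sum>k=1..N j. u (j, k)) * (\<Sum>k=1..N j. v (j, k)) / real (N j) + (\<Sum>\<kappa>\<in>L. u \<kappa> * v \<kappa>))"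
      unfolding proj_form_def using L by (simp add: s0 w0 sL wL)
    also have "\<dots> = group_form N j u v"
      unfolding std_form_def sK using N[OF j] by (simp add: group_form_eq)
    finally show ?thesis .
  qed
  then have eq: "proj_form (std_form ?K) w (insert (j, 0) L) = group_form N j" by blast
  have "psd_form ?K (proj_form (std_form ?K) w (insert (j, 0) L)) \<and>
    (\<exists>J'. card J' + card (insert (j, 0) L) = card ?K \<and>
      gauss_rep ?K (std_gauss ?K) (proj_form (std_form ?K) w (insert (j, 0) L)) J')"
  proof (rule proj_form_rep)
    show "psd_form ?K (std_form ?K)" by (rule psd_form_std_form) simp
    show "gauss_rep ?K (std_gauss ?K) (std_form ?K) ?K" by (rule gauss_rep_std_form) simp
    show "std_form ?K (w l) (w l) > 0" if "l \<in> insert (j, 0) L" for l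
      using that N[OF j] by (auto simp: s0 w0 sL wL)
    have d: "w \<kappa> (j, k) = 0" if "\<kappa> \<in> L" for \<kappa> k
      using that L by (auto simp: w_def L_def)
    have d': "w (j, 0) \<kappa> = 0" if "\<kappa> \<in> L" for \<kappa>
      using that by (auto simp: w_def L_def)
    have d'': "w \<kappa> \<kappa>' = 0" if "\<kappa> \<in> L" "\<kappa>' \<in> L" "\<kappa> \<noteq> \<kappa>'" for \<kappa> \<kappa>'
      using that L by (auto simp: w_def)
    show "std_form ?K (w l) (w l') = 0" if "l \<in> insert (j, 0) L" "l' \<in> insert (j, 0) L" "l \<noteq> l'" for l l'
      using that by (auto simp: s0 sL d d' d'')
  qed (use L in simp)
  then show "psd_form ?K (group_form N j)"
    "\<exists>J. card J + 1 = N j \<and> gauss_rep ?K (std_gauss ?K) (group_form N j) J"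
    unfolding eq using L cK by auto
qed

lemma scatter_mat_eq_Gram:
  "scatter_mat p (N j) (x j) = Matrix.mat p p (\<lambda>(r, s). group_form N j (\<lambda>\<kappa>. x (fst \<kappa>) (snd \<kappa>) r) (\<lambda>\<kappa>. x (fst \<kappa>) (snd \<kappa>) s))"
  by (simp add: scatter_mat_def group_form_def sample_mean_def)

lemma pooled_scatter_mat_eq_Gram:
  "pooled_scatter_mat p q N x = Matrix.mat p p (\<lambda>(r, s). pooled_form q N (\<lambda>\<kappa>. x (fst \<kappa>) (snd \<kappa>) r) (\<lambda>\<kappa>. x (fst \<kappa>) (snd \<kappa>) s))"
  unfolding pooled_scatter_mat_def pooled_form_def
  by (rule eq_matI) (auto simp: scatter_mat_eq_Gram)

lemma emeasure_chi_square_positive: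
  assumes A: "A \<in> sets borel"
  shows "emeasure (chi_square k) (A \<inter> {0<..}) = emeasure (chi_square k) A"
proof -
  note [measurable] = A
  show ?thesis
    unfolding chi_square_def
    by (subst (1 2) emeasure_density) (auto intro!: nn_integral_cong simp: indicator_def)
qed

section \<open>The characteristic function of the log-likelihood ratio\<close>

context
  fixes K :: "'k set" and \<beta> :: "('k \<Rightarrow> real) \<Rightarrow> ('k \<Rightarrow> real) \<Rightarrow> real" and \<gamma> :: "('k \<Rightarrow> real) measure"
    and J :: "'k set" and p :: nat and T :: "(nat \<Rightarrow> 'k \<Rightarrow> real) \<Rightarrow> real"
  assumes psd: "psd_form K \<beta>" and rep: "gauss_rep K \<gamma> \<beta> J" and J: "p \<le> card J"
    and prob: "prob_space \<gamma>" and sets: "sets \<gamma> = sets (PiM K (\<lambda>_. lborel))"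
    and T[measurable]: "T \<in> borel_measurable (PiM {..<p} (\<lambda>_. \<gamma>))"
    and inv: "\<And>y v w c i. i < p \<Longrightarrow> c > 0 \<Longrightarrow>
      row_form \<beta> y i (\<lambda>k. v k - c * w k) (\<lambda>k. v k - c * w k) = 0 \<Longrightarrow> T (y(i := v)) = T (y(i := w))"
begin

interpretation psd_form K \<beta> by (rule psd)
interpretation P: prob_space "PiM {..<p} (\<lambda>_. \<gamma>)" by (intro prob_space_PiM prob)

lemma borel_measurable_row_component:
  assumes "l < p" "k \<in> K"
  shows "(\<lambda>y. y l k) \<in> borel_measurable (PiM {..<p} (\<lambda>_. \<gamma>))"
proof -
  have "(\<lambda>u. u k) \<in> borel_measurable (PiM K (\<lambda>_. lborel :: real measure))"
    using assms(2) by measurable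
  then have "(\<lambda>u. u k) \<in> borel_measurable \<gamma>" by (simp cong: measurable_cong_sets add: sets)
  from measurable_compose[OF measurable_component_singleton[of l "{..<p}" "\<lambda>_. \<gamma>"] this] assms(1)
  show ?thesis by simp
qed

lemma measurable_pivot_PiM: "i < p \<Longrightarrow> (\<lambda>y. pivot \<beta> y i) \<in> borel_measurable (PiM {..<p} (\<lambda>_. \<gamma>))"
  by (intro borel_measurable_pivot borel_measurable_row_component) auto

text \<open>Indicators in the role of \<open>H\<close> and the \<open>h i\<close> turn the integral
  identity into one for events. Positivity is built in because the \<open>h i\<close> must vanish at
  nonpositive arguments; it is removed once the pivots are known to be almost surely
  positive.\<close>

lemma emeasure_statistic_pivots_pos:
  assumes A[measurable]: "A \<in> sets borel" and B: "\<And>i. i < p \<Longrightarrow> B i \<in> sets borel"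
  shows "emeasure (PiM {..<p} (\<lambda>_. \<gamma>)) {y \<in> space (PiM {..<p} (\<lambda>_. \<gamma>)). T y \<in> A \<and> (\<forall>i<p. pivot \<beta> y i \<in> B i \<and> pivot \<beta> y i > 0)}
    = emeasure (PiM {..<p} (\<lambda>_. \<gamma>)) {y \<in> space (PiM {..<p} (\<lambda>_. \<gamma>)). T y \<in> A} *
      (\<Prod>i<p. emeasure (chi_square (card J - i)) (B i))"
proof -
  let ?P = "PiM {..<p} (\<lambda>_. \<gamma>)"
  have TA: "{y \<in> space ?P. T y \<in> A} \<in> sets ?P" by measurable
  have Ei: "{y \<in> space ?P. pivot \<beta> y i \<in> B i \<and> pivot \<beta> y i > 0} \<in> sets ?P" if i: "i < p" for i
  proof -
    note [measurable] = measurable_pivot_PiM[OF i] B[OF i]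
    show ?thesis by measurable
  qed
  have FA: "{y \<in> space ?P. \<forall>i\<in>{..<p}. pivot \<beta> y i \<in> B i \<and> pivot \<beta> y i > 0} \<in> sets ?P"
    by (rule sets.sets_Collect_finite_All) (simp_all add: Ei)
  have "{y \<in> space ?P. T y \<in> A \<and> (\<forall>i<p. pivot \<beta> y i \<in> B i \<and> pivot \<beta> y i > 0)}
      = {y \<in> space ?P. T y \<in> A \<and> (\<forall>i\<in>{..<p}. pivot \<beta> y i \<in> B i \<and> pivot \<beta> y i > 0)}" by auto
  also have "\<dots> \<in> sets ?P"
    by (rule sets.sets_Collect_conj[OF FA TA])
  finally have S: "{y \<in> space ?P. T y \<in> A \<and> (\<forall>i<p. pivot \<beta> y i \<in> B i \<and> pivot \<beta> y i > 0)} \<in> sets ?P" .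
  have S': "{y \<in> space ?P. T y \<in> A} \<in> sets ?P" by measurable
  have "emeasure ?P {y \<in> space ?P. T y \<in> A \<and> (\<forall>i<p. pivot \<beta> y i \<in> B i \<and> pivot \<beta> y i > 0)}
      = (\<integral>\<^sup>+y. indicator A (T y) * (\<Prod>i<p. indicator (B i \<inter> {0<..}) (pivot \<beta> y i)) \<partial>?P)"
    unfolding nn_integral_indicator[OF S, symmetric]
    by (intro nn_integral_cong) (auto simp: indicator_def)
  also have "\<dots> = (\<integral>\<^sup>+y. indicator A (T y) \<partial>?P) * (\<Prod>i<p. \<integral>\<^sup>+x. indicator (B i \<inter> {0<..}) x \<partial>chi_square (card J - i))"
  proof (rule pivots_chi_square[OF psd rep J prob sets])
    show "(\<lambda>y. indicator A (T y)) \<in> borel_measurable ?P" by measurable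
    show "indicator A (T y) \<le> (1::ennreal)" for y by (simp add: indicator_def)
    show "indicator (B i \<inter> {0<..}) \<in> borel_measurable borel" if "i < p" for i
      using B[OF that] by (intro borel_measurable_indicator) auto
    show "indicator A (T (y(i := v))) = (indicator A (T (y(i := w))) :: ennreal)"
      if "i < p" "c > 0" "row_form \<beta> y i (\<lambda>k. v k - c * w k) (\<lambda>k. v k - c * w k) = 0" for y v w c i
      using inv[OF that] by simp
  qed (simp add: indicator_def)
  also have "(\<integral>\<^sup>+y. indicator A (T y) \<partial>?P) = emeasure ?P {y \<in> space ?P. T y \<in> A}"
    unfolding nn_integral_indicator[OF S', symmetric] by (intro nn_integral_cong) (auto simp: indicator_def)
  also have "(\<Prod>i<p. \<integral>\<^sup>+x. indicator (B i \<inter> {0<..}) x \<partial>chi_square (card J - i)) = (\<Prod>i<p. emeasure (chi_square (card J - i)) (B i))"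
    using B by (intro prod.cong refl) (auto simp: emeasure_chi_square_positive)
  finally show ?thesis .
qed

lemma emeasure_chi_square_UNIV: "i < p \<Longrightarrow> emeasure (chi_square (card J - i)) UNIV = 1"
  using prob_space.emeasure_space_1[OF prob_space_chi_square, of "card J - i"] J by simp

text \<open>With \<open>UNIV\<close> as every target set, the event that all pivots are positive has
  a product of total masses as its probability, which is 1.\<close>

lemma AE_pivots_pos: "AE y in PiM {..<p} (\<lambda>_. \<gamma>). \<forall>i<p. pivot \<beta> y i > 0"
proof -
  let ?P = "PiM {..<p} (\<lambda>_. \<gamma>)"
  have Ei: "{y \<in> space ?P. pivot \<beta> y i > 0} \<in> sets ?P" if i: "i < p" for i
  proof -
    note [measurable] = measurable_pivot_PiM[OF i]
    show ?thesis by measurable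
  qed
  have "emeasure ?P {y \<in> space ?P. \<forall>i<p. pivot \<beta> y i > 0} = 1"
    using emeasure_statistic_pivots_pos[of UNIV "\<lambda>_. UNIV"] P.emeasure_space_1
    by (simp add: emeasure_chi_square_UNIV)
  moreover have "{y \<in> space ?P. \<forall>i<p. pivot \<beta> y i > 0} = {y \<in> space ?P. \<forall>i\<in>{..<p}. pivot \<beta> y i > 0}"
    by auto
  ultimately have 1: "P.prob {y \<in> space ?P. \<forall>i\<in>{..<p}. pivot \<beta> y i > 0} = 1"
    by (simp only: P.emeasure_eq_measure ennreal_eq_1)
  have "{y \<in> space ?P. \<forall>i\<in>{..<p}. pivot \<beta> y i > 0} \<in> sets ?P"
    by (rule sets.sets_Collect_finite_All) (simp_all add: Ei)
  from P.prob_Collect_eq_1[OF this] 1 have "AE y in ?P. \<forall>i\<in>{..<p}. pivot \<beta> y i > 0"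
    by (rule iffD1)
  then show ?thesis by eventually_elim simp
qed

lemma prob_statistic_pivots:
  assumes A[measurable]: "A \<in> sets borel" and B: "\<And>i. i < p \<Longrightarrow> B i \<in> sets borel"
  shows "emeasure (PiM {..<p} (\<lambda>_. \<gamma>)) {y \<in> space (PiM {..<p} (\<lambda>_. \<gamma>)). T y \<in> A \<and> (\<forall>i\<in>{..<p}. pivot \<beta> y i \<in> B i)}
    = emeasure (PiM {..<p} (\<lambda>_. \<gamma>)) {y \<in> space (PiM {..<p} (\<lambda>_. \<gamma>)). T y \<in> A} *
      (\<Prod>i<p. emeasure (chi_square (card J - i)) (B i))"
proof -
  let ?P = "PiM {..<p} (\<lambda>_. \<gamma>)"
  have TA: "{y \<in> space ?P. T y \<in> A} \<in> sets ?P" by measurable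
  have Ei: "{y \<in> space ?P. pivot \<beta> y i \<in> B i} \<in> sets ?P"
      "{y \<in> space ?P. pivot \<beta> y i \<in> B i \<and> pivot \<beta> y i > 0} \<in> sets ?P" if i: "i < p" for i
  proof -
    note [measurable] = measurable_pivot_PiM[OF i] B[OF i]
    show "{y \<in> space ?P. pivot \<beta> y i \<in> B i} \<in> sets ?P"
      "{y \<in> space ?P. pivot \<beta> y i \<in> B i \<and> pivot \<beta> y i > 0} \<in> sets ?P" by measurable
  qed
  have FA: "{y \<in> space ?P. \<forall>i\<in>{..<p}. pivot \<beta> y i \<in> B i} \<in> sets ?P"
      "{y \<in> space ?P. \<forall>i\<in>{..<p}. pivot \<beta> y i \<in> B i \<and> pivot \<beta> y i > 0} \<in> sets ?P"
    by (rule sets.sets_Collect_finite_All; simp add: Ei)+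
  have "emeasure ?P {y \<in> space ?P. T y \<in> A \<and> (\<forall>i\<in>{..<p}. pivot \<beta> y i \<in> B i)}
      = emeasure ?P {y \<in> space ?P. T y \<in> A \<and> (\<forall>i\<in>{..<p}. pivot \<beta> y i \<in> B i \<and> pivot \<beta> y i > 0)}"
  proof (rule emeasure_eq_AE)
    show "AE y in ?P. (y \<in> {y \<in> space ?P. T y \<in> A \<and> (\<forall>i\<in>{..<p}. pivot \<beta> y i \<in> B i)})
        = (y \<in> {y \<in> space ?P. T y \<in> A \<and> (\<forall>i\<in>{..<p}. pivot \<beta> y i \<in> B i \<and> pivot \<beta> y i > 0)})"
      using AE_pivots_pos by eventually_elim auto
    show "{y \<in> space ?P. T y \<in> A \<and> (\<forall>i\<in>{..<p}. pivot \<beta> y i \<in> B i)} \<in> sets ?P"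
      "{y \<in> space ?P. T y \<in> A \<and> (\<forall>i\<in>{..<p}. pivot \<beta> y i \<in> B i \<and> pivot \<beta> y i > 0)} \<in> sets ?P"
      by (rule sets.sets_Collect_conj[OF FA(1) TA], rule sets.sets_Collect_conj[OF FA(2) TA])
  qed
  also have "\<dots> = emeasure ?P {y \<in> space ?P. T y \<in> A \<and> (\<forall>i<p. pivot \<beta> y i \<in> B i \<and> pivot \<beta> y i > 0)}"
    by (intro arg_cong[where f="emeasure ?P"]) auto
  also have "\<dots> = emeasure ?P {y \<in> space ?P. T y \<in> A} * (\<Prod>i<p. emeasure (chi_square (card J - i)) (B i))"
    by (rule emeasure_statistic_pivots_pos[OF assms])
  finally show ?thesis .
qed

lemma emeasure_pivot:
  assumes i: "i < p" and B: "B \<in> sets borel"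
  shows "emeasure (PiM {..<p} (\<lambda>_. \<gamma>)) {y \<in> space (PiM {..<p} (\<lambda>_. \<gamma>)). pivot \<beta> y i \<in> B} = emeasure (chi_square (card J - i)) B"
proof -
  let ?P = "PiM {..<p} (\<lambda>_. \<gamma>)" and ?B = "\<lambda>l. if l = i then B else UNIV"
  have "emeasure ?P {y \<in> space ?P. pivot \<beta> y i \<in> B}
      = emeasure ?P {y \<in> space ?P. T y \<in> UNIV \<and> (\<forall>l\<in>{..<p}. pivot \<beta> y l \<in> ?B l)}"
    using i by (intro arg_cong[where f="emeasure ?P"]) auto
  also have "\<dots> = (\<Prod>l<p. emeasure (chi_square (card J - l)) (?B l))"
    using B P.emeasure_space_1 by (subst prob_statistic_pivots) auto
  also have "\<dots> = (\<Prod>l<p. if l = i then emeasure (chi_square (card J - i)) B else 1)"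
    by (intro prod.cong refl) (auto simp: emeasure_chi_square_UNIV)
  also have "\<dots> = emeasure (chi_square (card J - i)) B" using i by (subst prod.delta) auto
  finally show ?thesis .
qed

lemma distr_pivot:
  assumes i: "i < p"
  shows "distr (PiM {..<p} (\<lambda>_. \<gamma>)) borel (\<lambda>y. pivot \<beta> y i) = chi_square (card J - i)"
proof (rule measure_eqI)
  fix B assume B: "B \<in> sets (distr (PiM {..<p} (\<lambda>_. \<gamma>)) borel (\<lambda>y. pivot \<beta> y i))"
  have "(\<lambda>y. pivot \<beta> y i) -` B \<inter> space (PiM {..<p} (\<lambda>_. \<gamma>)) = {y \<in> space (PiM {..<p} (\<lambda>_. \<gamma>)). pivot \<beta> y i \<in> B}"
    by auto
  then show "emeasure (distr (PiM {..<p} (\<lambda>_. \<gamma>)) borel (\<lambda>y. pivot \<beta> y i)) B = emeasure (chi_square (card J - i)) B"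
    using emeasure_pivot[OF i, of B] B by (simp add: emeasure_distr measurable_pivot_PiM[OF i])
qed simp

text \<open>Pivots are numbered below \<open>p\<close>, so index \<open>p\<close> is free to carry
  the statistic \<open>T\<close>.\<close>

lemma indep_vars_statistic_pivots:
  "P.indep_vars (\<lambda>_. borel) (\<lambda>i y. if i = p then T y else pivot \<beta> y i) {..p}"
proof -
  let ?P = "PiM {..<p} (\<lambda>_. \<gamma>)" and ?X = "\<lambda>i y. if i = p then T y else pivot \<beta> y i"
  have E: "{y \<in> space ?P. T y \<in> A} \<in> sets ?P" if [measurable]: "A \<in> sets borel" for A by measurable
  have "\<forall>A\<in>(\<Pi> i\<in>{..p}. sets borel). P.prob (\<Inter>j\<in>{..p}. ?X j -` A j \<inter> space ?P)
      = (\<Prod>j\<in>{..p}. P.prob (?X j -` A j \<inter> space ?P))"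
  proof
    fix A :: "nat \<Rightarrow> real set" assume A: "A \<in> (\<Pi> i\<in>{..p}. sets borel)"
    have ins: "{..p} = insert p {..<p}" by auto
    have "(\<Inter>j\<in>{..p}. ?X j -` A j \<inter> space ?P) = {y \<in> space ?P. T y \<in> A p \<and> (\<forall>i\<in>{..<p}. pivot \<beta> y i \<in> A i)}"
      unfolding ins by auto
    then have "emeasure ?P (\<Inter>j\<in>{..p}. ?X j -` A j \<inter> space ?P)
        = emeasure ?P {y \<in> space ?P. T y \<in> A p} * (\<Prod>i<p. emeasure (chi_square (card J - i)) (A i))"
      using A by (simp add: prob_statistic_pivots Pi_iff)
    also have "{y \<in> space ?P. T y \<in> A p} = ?X p -` A p \<inter> space ?P" by auto
    also have "(\<Prod>i<p. emeasure (chi_square (card J - i)) (A i)) = (\<Prod>i<p. emeasure ?P (?X i -` A i \<inter> space ?P))"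
    proof (intro prod.cong refl)
      fix i assume i: "i \<in> {..<p}"
      then have "?X i -` A i \<inter> space ?P = {y \<in> space ?P. pivot \<beta> y i \<in> A i}" by auto
      then show "emeasure (chi_square (card J - i)) (A i) = emeasure ?P (?X i -` A i \<inter> space ?P)"
        using emeasure_pivot[of i "A i"] i A by (simp add: Pi_iff)
    qed
    finally have "emeasure ?P (\<Inter>j\<in>{..p}. ?X j -` A j \<inter> space ?P) = (\<Prod>j\<in>{..p}. emeasure ?P (?X j -` A j \<inter> space ?P))"
      unfolding ins by simp
    then show "P.prob (\<Inter>j\<in>{..p}. ?X j -` A j \<inter> space ?P) = (\<Prod>j\<in>{..p}. P.prob (?X j -` A j \<inter> space ?P))"
      by (simp add: P.emeasure_eq_measure prod_ennreal prod_nonneg)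
  qed
  moreover have "?X i \<in> borel_measurable ?P" if "i \<in> {..p}" for i
    using that measurable_pivot_PiM[of i] T by (cases "i = p") auto
  ultimately show ?thesis
    by (subst P.indep_vars_finite[where E = "\<lambda>_. sets borel"])
       (auto simp: sets.sigma_sets_eq[of borel, simplified] Int_stable_def)
qed

text \<open>Applied twice: with the log-ratio as \<open>T\<close> for the pooled form, and with a
  constant \<open>T\<close> to obtain the law of the pivots of one group.\<close>

lemma char_statistic_pivots:
  "char (distr (PiM {..<p} (\<lambda>_. \<gamma>)) borel (\<lambda>y. T y + a * (\<Sum>i<p. ln (pivot \<beta> y i)))) t
    = char (distr (PiM {..<p} (\<lambda>_. \<gamma>)) borel T) t * (\<Prod>i<p. ln_chi_square_char (card J - i) (t * a))"
proof -
  let ?P = "PiM {..<p} (\<lambda>_. \<gamma>)" and ?X = "\<lambda>i y. if i = p then T y else pivot \<beta> y i"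
  let ?f = "\<lambda>i x. if i = p then x else a * ln x"
  have ind: "P.indep_vars (\<lambda>_. borel) (\<lambda>i y. ?f i (?X i y)) {..p}"
    by (rule P.indep_vars_compose2[OF indep_vars_statistic_pivots]) simp
  have ins: "{..p} = insert p {..<p}" by auto
  have "char (distr ?P borel (\<lambda>y. \<Sum>i\<in>{..p}. ?f i (?X i y))) t = (\<Prod>i\<in>{..p}. char (distr ?P borel (\<lambda>y. ?f i (?X i y))) t)"
    by (rule P.char_distr_sum[OF ind])
  also have "(\<lambda>y. \<Sum>i\<in>{..p}. ?f i (?X i y)) = (\<lambda>y. T y + a * (\<Sum>i<p. ln (pivot \<beta> y i)))"
    unfolding ins by (auto simp: fun_eq_iff sum_distrib_left intro!: sum.cong)
  also have "(\<Prod>i\<in>{..p}. char (distr ?P borel (\<lambda>y. ?f i (?X i y))) t)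
      = char (distr ?P borel T) t * (\<Prod>i<p. char (distr ?P borel (\<lambda>y. a * ln (pivot \<beta> y i))) t)"
    unfolding ins by (subst prod.insert) (auto intro!: prod.cong)
  also have "(\<Prod>i<p. char (distr ?P borel (\<lambda>y. a * ln (pivot \<beta> y i))) t) = (\<Prod>i<p. ln_chi_square_char (card J - i) (t * a))"
  proof (intro prod.cong refl)
    fix i assume i: "i \<in> {..<p}"
    have m: "(\<lambda>y. pivot \<beta> y i) \<in> ?P \<rightarrow>\<^sub>M borel" using i by (simp add: measurable_pivot_PiM)
    have "char (distr ?P borel (\<lambda>y. a * ln (pivot \<beta> y i))) t = (CLINT y|?P. iexp (t * (a * ln (pivot \<beta> y i))))"
      unfolding char_def using m by (subst integral_distr) auto
    also have "\<dots> = (CLINT x|distr ?P borel (\<lambda>y. pivot \<beta> y i). iexp (t * (a * ln x)))"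
      by (subst integral_distr[OF m]) auto
    also have "\<dots> = (CLINT x|chi_square (card J - i). iexp (t * a * ln x))"
      using i by (simp add: distr_pivot mult.assoc)
    also have "\<dots> = ln_chi_square_char (card J - i) (t * a)"
      unfolding ln_chi_square_char_def char_def by (subst integral_distr) auto
    finally show "char (distr ?P borel (\<lambda>y. a * ln (pivot \<beta> y i))) t = ln_chi_square_char (card J - i) (t * a)" .
  qed
  finally show ?thesis .
qed

end

section \<open>Pivots under changes of the rows\<close>

lemma (in psd_form) pivot_local:
  assumes "\<And>l k. l \<le> i \<Longrightarrow> k \<in> K \<Longrightarrow> y' l k = y l k"
  shows "pivot \<beta> y' i = pivot \<beta> y i"
proof -
  have "pivot \<beta> y' i = (1::real)\<^sup>2 * pivot \<beta> y i"
  proof (rule pivot_triangular[where c = "\<lambda>_. 1"])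
    fix l assume l: "l \<le> i"
    interpret R: psd_form K "row_form \<beta> y l" by (rule psd_form_row_form)
    have "row_form \<beta> y l (\<lambda>k. y' l k - 1 * y l k) (\<lambda>k. y' l k - 1 * y l k) = row_form \<beta> y l (\<lambda>k. 0) (\<lambda>k. 0)"
      using assms[OF l] by (intro R.local_both) simp
    then show "row_form \<beta> y l (\<lambda>k. y' l k - 1 * y l k) (\<lambda>k. y' l k - 1 * y l k) = 0"
      using R.zero_left by simp
  qed simp
  then show ?thesis by simp
qed

text \<open>Both versions of row \<open>i\<close> give the same span of the rows up to
  \<open>i\<close>, modulo null vectors; so later pivots agree and only pivot \<open>i\<close> picks
  up a square.\<close>

lemma (in psd_form) pivot_update_null:
  assumes c: "c \<noteq> 0" and null: "row_form \<beta> y i (\<lambda>k. v k - c * w k) (\<lambda>k. v k - c * w k) = 0"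
  shows "pivot \<beta> (y(i := v)) l = (if l = i then c\<^sup>2 else 1) * pivot \<beta> (y(i := w)) l"
proof -
  have "pivot \<beta> (y(i := v)) l = (if l = i then c else 1)\<^sup>2 * pivot \<beta> (y(i := w)) l"
  proof (rule pivot_triangular[where c = "\<lambda>l. if l = i then c else 1"])
    fix m
    interpret R: psd_form K "row_form \<beta> (y(i := w)) m" by (rule psd_form_row_form)
    have "row_form \<beta> (y(i := w)) i = row_form \<beta> y i" by (rule row_form_cong) simp
    then show "row_form \<beta> (y(i := w)) m (\<lambda>k. (y(i := v)) m k - (if m = i then c else 1) * (y(i := w)) m k)
        (\<lambda>k. (y(i := v)) m k - (if m = i then c else 1) * (y(i := w)) m k) = 0"
      using null R.zero_left by (cases "m = i") auto
  qed (use c in simp)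
  then show ?thesis by simp
qed

text \<open>Here on the observations of group \<open>j\<close> alone, unlike in
  \<open>group_form_rep\<close>. This locality shows that the pivots of different groups are
  functions of disjoint parts of the data.\<close>

lemma psd_form_group_form: "psd_form ({j} \<times> {1..N j}) (group_form N j)"
proof
  show "group_form N j (\<lambda>k. c * u k + v k) w = c * group_form N j u w + group_form N j v w" for c u v w
    unfolding group_form_def sum_distrib_left sum.distrib[symmetric]
    by (intro sum.cong refl) (simp add: sum.distrib sum_distrib_left[symmetric] add_divide_distrib algebra_simps)
  show "group_form N j u v = group_form N j v u" for u v
    unfolding group_form_def by (intro sum.cong refl) simp
  show "group_form N j u u \<ge> 0" for u
    unfolding group_form_def by (intro sum_nonneg) simp
  show "group_form N j u w = group_form N j v w" if "\<And>k. k \<in> {j} \<times> {1..N j} \<Longrightarrow> u k = v k" for u v w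
  proof -
    have e: "u (j, k) = v (j, k)" if "k \<in> {1..N j}" for k using that by (intro \<open>\<And>k. k \<in> {j} \<times> {1..N j} \<Longrightarrow> u k = v k\<close>) simp
    have "(\<Sum>l=1..N j. u (j, l)) = (\<Sum>l=1..N j. v (j, l))" by (intro sum.cong refl e)
    then show ?thesis unfolding group_form_def by (intro sum.cong refl arg_cong2[where f="(*)"] arg_cong2[where f=minus] e) simp_all
  qed
qed simp

text \<open>Set to 0 on the null set where a pivot vanishes, so that the invariance below holds everywhere.\<close>

definition log_ratio :: "nat \<Rightarrow> nat \<Rightarrow> (nat \<Rightarrow> nat) \<Rightarrow> (nat \<Rightarrow> nat \<times> nat \<Rightarrow> real) \<Rightarrow> real" where
  "log_ratio p q N y =
     (if \<forall>i\<in>{..<p}. pivot (pooled_form q N) y i > 0 \<and> (\<forall>j\<in>{1..q}. pivot (group_form N j) y i > 0)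
      then (\<Sum>j=1..q. real (N j - 1) / 2 * (\<Sum>i<p. ln (pivot (group_form N j) y i)))
        - real (\<Sum>j=1..q. N j - 1) / 2 * (\<Sum>i<p. ln (pivot (pooled_form q N) y i))
      else 0)"

section \<open>The log-ratio of pivots for standard Gaussian data\<close>

context
  fixes p q :: nat and N :: "nat \<Rightarrow> nat"
  assumes p1: "p \<ge> 1" and q1: "q \<ge> 1" and N: "\<And>j. j \<in> {1..q} \<Longrightarrow> p < N j"
begin

lemma group_size_ge_1: "j \<in> {1..q} \<Longrightarrow> N j \<ge> 1"
  using N[of j] by simp

lemma pooled_psd: "psd_form (observations q N) (pooled_form q N)"
  by (rule pooled_form_rep(1)) (rule group_size_ge_1)

lemma pooled_rank: "\<exists>J. card J + q = (\<Sum>j=1..q. N j) \<and>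
    gauss_rep (observations q N) (std_gauss (observations q N)) (pooled_form q N) J"
  by (rule pooled_form_rep(2)) (rule group_size_ge_1)

lemma group_psd: "j \<in> {1..q} \<Longrightarrow> psd_form (observations q N) (group_form N j)"
  by (rule group_form_rep(1)[where q = q]) (rule group_size_ge_1)

lemma group_rank: "j \<in> {1..q} \<Longrightarrow> \<exists>J. card J + 1 = N j \<and>
    gauss_rep (observations q N) (std_gauss (observations q N)) (group_form N j) J"
  by (rule group_form_rep(2)[where q = q]) (rule group_size_ge_1)

lemma observations_nonempty: "observations q N \<noteq> {}"
proof -
  have "(1, 1) \<in> observations q N" using q1 group_size_ge_1[of 1] by (auto simp: observations_def)
  then show ?thesis by auto
qed

lemma sum_degrees: "(\<Sum>j=1..q. N j - 1) + q = (\<Sum>j=1..q. N j)"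
proof -
  have "(\<Sum>j=1..q. N j) = (\<Sum>j=1..q. (N j - 1) + 1)" using group_size_ge_1 by (intro sum.cong refl) force
  also have "\<dots> = (\<Sum>j=1..q. N j - 1) + q" unfolding sum.distrib by simp
  finally show ?thesis by simp
qed

text \<open>The pooled form is a sum of nonnegative terms. Its null space thus lies in that of every
  group form, the direction that invariance of the log-ratio requires.\<close>

lemma group_null:
  assumes "pooled_form q N u u = 0" and "j \<in> {1..q}"
  shows "group_form N j u u = 0"
proof -
  have "\<forall>j\<in>{1..q}. group_form N j u u = 0"
    using assms(1) unfolding pooled_form_def
    by (subst (asm) sum_nonneg_eq_0_iff) (auto intro: psd_form.nonneg[OF psd_form_group_form])
  then show ?thesis using assms(2) by blast
qed

text \<open>A row operation multiplies pivot \<open>i\<close> of every form by the same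
  \<open>c\<^sup>2\<close>; the group weights sum to the pooled weight, so its logarithm cancels.
  For the group forms, the null vector is first rewritten as a combination of rows plus a pooled
  null vector.\<close>

lemma log_ratio_invariant:
  assumes "i < p" and c: "c > 0"
    and null: "row_form (pooled_form q N) y i (\<lambda>k. v k - c * w k) (\<lambda>k. v k - c * w k) = 0"
  shows "log_ratio p q N (y(i := v)) = log_ratio p q N (y(i := w))"
proof -
  interpret P: psd_form "observations q N" "pooled_form q N" by (rule pooled_psd)
  have pp: "pivot (pooled_form q N) (y(i := v)) l = (if l = i then c\<^sup>2 else 1) * pivot (pooled_form q N) (y(i := w)) l" for l
    using c by (intro P.pivot_update_null null) simp
  obtain a \<nu> where \<nu>: "pooled_form q N \<nu> \<nu> = 0" "(\<lambda>k. v k - c * w k) = (\<lambda>k. (\<Sum>l<i. a l * y l k) + \<nu> k)"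
    by (rule P.row_form_null_cases[OF null])
  have pg: "pivot (group_form N j) (y(i := v)) l = (if l = i then c\<^sup>2 else 1) * pivot (group_form N j) (y(i := w)) l"
    if j: "j \<in> {1..q}" for j l
  proof -
    interpret G: psd_form "{j} \<times> {1..N j}" "group_form N j" by (rule psd_form_group_form)
    have "row_form (group_form N j) y i (\<lambda>k. v k - c * w k) (\<lambda>k. v k - c * w k) = 0"
      unfolding \<nu>(2) by (rule G.row_form_combination_null[OF group_null[OF \<nu>(1) j]])
    then show ?thesis using c by (intro G.pivot_update_null) simp
  qed
  let ?pos = "\<lambda>y. \<forall>i\<in>{..<p}. pivot (pooled_form q N) y i > 0 \<and> (\<forall>j\<in>{1..q}. pivot (group_form N j) y i > 0)"
  have pos: "?pos (y(i := v)) \<longleftrightarrow> ?pos (y(i := w))"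
    using c by (intro ball_cong refl conj_cong) (auto simp: pp pg zero_less_mult_iff)
  have lnsum: "(\<Sum>l<p. ln ((if l = i then c\<^sup>2 else 1) * f l)) = ln (c\<^sup>2) + (\<Sum>l<p. ln (f l))"
    if "\<And>l. l < p \<Longrightarrow> f l > 0" for f :: "nat \<Rightarrow> real"
  proof -
    have nz: "f l \<noteq> 0" if "l < p" for l using \<open>\<And>l. l < p \<Longrightarrow> f l > 0\<close>[OF that] by simp
    have "(\<Sum>l<p. ln ((if l = i then c\<^sup>2 else 1) * f l)) = (\<Sum>l<p. (if l = i then ln (c\<^sup>2) else 0) + ln (f l))"
      using c nz[OF assms(1)] by (intro sum.cong refl) (auto simp: ln_mult)
    also have "\<dots> = ln (c\<^sup>2) + (\<Sum>l<p. ln (f l))"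
      unfolding sum.distrib using assms(1) by simp
    finally show ?thesis .
  qed
  show ?thesis
  proof (cases "?pos (y(i := w))")
    case True
    have "log_ratio p q N (y(i := v))
        = (\<Sum>j=1..q. real (N j - 1) / 2 * (\<Sum>l<p. ln (pivot (group_form N j) (y(i := v)) l)))
        - real (\<Sum>j=1..q. N j - 1) / 2 * (\<Sum>l<p. ln (pivot (pooled_form q N) (y(i := v)) l))"
      unfolding log_ratio_def if_P[OF iffD2[OF pos True]] ..
    also have "(\<Sum>l<p. ln (pivot (pooled_form q N) (y(i := v)) l)) = ln (c\<^sup>2) + (\<Sum>l<p. ln (pivot (pooled_form q N) (y(i := w)) l))"
      unfolding pp using True by (intro lnsum) auto
    also have "(\<Sum>j=1..q. real (N j - 1) / 2 * (\<Sum>l<p. ln (pivot (group_form N j) (y(i := v)) l)))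
        = (\<Sum>j=1..q. real (N j - 1) / 2 * (ln (c\<^sup>2) + (\<Sum>l<p. ln (pivot (group_form N j) (y(i := w)) l))))"
    proof (intro sum.cong refl arg_cong2[where f="(*)"])
      fix j assume j: "j \<in> {1..q}"
      show "(\<Sum>l<p. ln (pivot (group_form N j) (y(i := v)) l)) = ln (c\<^sup>2) + (\<Sum>l<p. ln (pivot (group_form N j) (y(i := w)) l))"
        unfolding pg[OF j] using True j by (intro lnsum) auto
    qed
    also have "\<dots> = real (\<Sum>j=1..q. N j - 1) / 2 * ln (c\<^sup>2)
        + (\<Sum>j=1..q. real (N j - 1) / 2 * (\<Sum>l<p. ln (pivot (group_form N j) (y(i := w)) l)))"
      by (simp add: distrib_left sum.distrib sum_distrib_right sum_divide_distrib)
    finally have V: "log_ratio p q N (y(i := v)) = real (\<Sum>j=1..q. N j - 1) / 2 * ln (c\<^sup>2)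
        + (\<Sum>j=1..q. real (N j - 1) / 2 * (\<Sum>l<p. ln (pivot (group_form N j) (y(i := w)) l)))
        - real (\<Sum>j=1..q. N j - 1) / 2 * (ln (c\<^sup>2) + (\<Sum>l<p. ln (pivot (pooled_form q N) (y(i := w)) l)))" .
    have W: "log_ratio p q N (y(i := w))
        = (\<Sum>j=1..q. real (N j - 1) / 2 * (\<Sum>l<p. ln (pivot (group_form N j) (y(i := w)) l)))
        - real (\<Sum>j=1..q. N j - 1) / 2 * (\<Sum>l<p. ln (pivot (pooled_form q N) (y(i := w)) l))"
      unfolding log_ratio_def if_P[OF True] ..
    show ?thesis unfolding V W distrib_left by linarith
  next
    case False
    then have "\<not> ?pos (y(i := v))" using pos by blast
    then show ?thesis unfolding log_ratio_def if_not_P[OF False] by (rule if_not_P)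
  qed
qed

lemma measurable_pivot_rows:
  assumes "psd_form K' \<beta>" "K' \<subseteq> observations q N" "i < p"
  shows "(\<lambda>y. pivot \<beta> y i) \<in> borel_measurable (PiM {..<p} (\<lambda>_. std_gauss (observations q N)))"
proof (rule psd_form.borel_measurable_pivot[OF assms(1)])
  fix l k assume lk: "l \<le> i" "k \<in> K'"
  have "k \<in> observations q N" using assms(2) lk by blast
  then have "(\<lambda>u. u k) \<in> borel_measurable (PiM (observations q N) (\<lambda>_. lborel :: real measure))"
    by measurable
  then have "(\<lambda>u. u k) \<in> borel_measurable (std_gauss (observations q N))"
    by (simp cong: measurable_cong_sets add: sets_std_gauss)
  from measurable_compose[OF measurable_component_singleton[of l "{..<p}"] this] lk assms(3)
  show "(\<lambda>y. y l k) \<in> borel_measurable (PiM {..<p} (\<lambda>_. std_gauss (observations q N)))" by simp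
qed

lemma group_subset: "j \<in> {1..q} \<Longrightarrow> {j} \<times> {1..N j} \<subseteq> observations q N"
  by (auto simp: observations_def)

lemma measurable_pivots:
  assumes "i < p"
  shows "(\<lambda>y. pivot (pooled_form q N) y i) \<in> borel_measurable (PiM {..<p} (\<lambda>_. std_gauss (observations q N)))"
    and "j \<in> {1..q} \<Longrightarrow> (\<lambda>y. pivot (group_form N j) y i) \<in> borel_measurable (PiM {..<p} (\<lambda>_. std_gauss (observations q N)))"
  by (rule measurable_pivot_rows[OF pooled_psd subset_refl assms],
      rule measurable_pivot_rows[OF psd_form_group_form group_subset assms])

lemma measurable_log_ratio:
  "log_ratio p q N \<in> borel_measurable (PiM {..<p} (\<lambda>_. std_gauss (observations q N)))"
proof -
  let ?P = "PiM {..<p} (\<lambda>_. std_gauss (observations q N))"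
  have S: "{y \<in> space ?P. pivot (pooled_form q N) y i > 0 \<and> (\<forall>j\<in>{1..q}. pivot (group_form N j) y i > 0)} \<in> sets ?P"
    if i: "i < p" for i
  proof -
    have 1: "{y \<in> space ?P. \<forall>j\<in>{1..q}. pivot (group_form N j) y i > 0} \<in> sets ?P"
    proof (rule sets.sets_Collect_finite_All)
      fix j assume j: "j \<in> {1..q}"
      note [measurable] = measurable_pivots(2)[OF i j]
      show "{y \<in> space ?P. pivot (group_form N j) y i > 0} \<in> sets ?P" by measurable
    qed simp
    note [measurable] = measurable_pivots(1)[OF i]
    have 2: "{y \<in> space ?P. pivot (pooled_form q N) y i > 0} \<in> sets ?P" by measurable
    show ?thesis by (rule sets.sets_Collect_conj[OF 1 2])
  qed
  have "{y \<in> space ?P. \<forall>i\<in>{..<p}. pivot (pooled_form q N) y i > 0 \<and> (\<forall>j\<in>{1..q}. pivot (group_form N j) y i > 0)} \<in> sets ?P"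
    by (rule sets.sets_Collect_finite_All) (rule S, simp_all)
  then show ?thesis
    unfolding log_ratio_def
    by (intro measurable_If borel_measurable_diff borel_measurable_sum borel_measurable_times
        borel_measurable_const borel_measurable_ln measurable_pivots) auto
qed

lemma AE_all_pivots_pos:
  "AE y in PiM {..<p} (\<lambda>_. std_gauss (observations q N)).
    \<forall>i\<in>{..<p}. pivot (pooled_form q N) y i > 0 \<and> (\<forall>j\<in>{1..q}. pivot (group_form N j) y i > 0)"
proof -
  let ?K = "observations q N"
  have pq: "p + q \<le> (\<Sum>j=1..q. N j)"
  proof -
    have "p \<le> N 1 - 1" using N[of 1] q1 by simp
    also have "\<dots> \<le> (\<Sum>j=1..q. N j - 1)" using q1 by (intro member_le_sum) auto
    finally show ?thesis using sum_degrees by simp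
  qed
  obtain J where J: "card J + q = (\<Sum>j=1..q. N j)" "gauss_rep ?K (std_gauss ?K) (pooled_form q N) J"
    using pooled_rank by blast
  have 1: "AE y in PiM {..<p} (\<lambda>_. std_gauss ?K). \<forall>i<p. pivot (pooled_form q N) y i > 0"
    by (rule AE_pivots_pos[where T = "\<lambda>_. 0", OF pooled_psd J(2) _ prob_space_std_gauss sets_std_gauss])
       (use pq J in auto)
  have 2: "AE y in PiM {..<p} (\<lambda>_. std_gauss ?K). \<forall>i<p. pivot (group_form N j) y i > 0" if j: "j \<in> {1..q}" for j
  proof -
    obtain J where J: "card J + 1 = N j" "gauss_rep ?K (std_gauss ?K) (group_form N j) J"
      using group_rank[OF j] by blast
    show ?thesis
      by (rule AE_pivots_pos[where T = "\<lambda>_. 0", OF group_psd[OF j] J(2) _ prob_space_std_gauss sets_std_gauss])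
         (use N[OF j] J in auto)
  qed
  have "AE y in PiM {..<p} (\<lambda>_. std_gauss ?K). \<forall>j\<in>{1..q}. \<forall>i<p. pivot (group_form N j) y i > 0"
    by (rule AE_finite_allI) (use 2 in auto)
  with 1 show ?thesis by eventually_elim auto
qed

text \<open>
  Basu's theorem turns the characteristic function of the ratio into a quotient: the sum over the
  groups of independent statistics is the log-ratio plus an independent pooled statistic.
\<close>

lemma char_log_ratio:
  fixes Y :: "nat \<times> nat \<Rightarrow> 'a \<Rightarrow> nat \<Rightarrow> real"
  assumes "prob_space M"
    and ind: "prob_space.indep_vars M (\<lambda>_. PiM {..<p} (\<lambda>_. lborel)) Y (observations q N)"
    and law: "\<And>\<kappa>. \<kappa> \<in> observations q N \<Longrightarrow> distr M (PiM {..<p} (\<lambda>_. lborel)) (Y \<kappa>) = std_gauss {..<p}"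
  defines "yrows \<equiv> \<lambda>\<omega>. \<lambda>r\<in>{..<p}. \<lambda>\<kappa>\<in>observations q N. Y \<kappa> \<omega> r"
  shows "AE \<omega> in M. \<forall>i\<in>{..<p}. pivot (pooled_form q N) (yrows \<omega>) i > 0 \<and> (\<forall>j\<in>{1..q}. pivot (group_form N j) (yrows \<omega>) i > 0)"
    and "(\<lambda>\<omega>. log_ratio p q N (yrows \<omega>)) \<in> borel_measurable M"
    and "char (distr M borel (\<lambda>\<omega>. log_ratio p q N (yrows \<omega>))) t *
        (\<Prod>i<p. ln_chi_square_char ((\<Sum>j=1..q. N j - 1) - i) (t * (real (\<Sum>j=1..q. N j - 1) / 2)))
      = (\<Prod>j=1..q. \<Prod>i<p. ln_chi_square_char (N j - 1 - i) (t * (real (N j - 1) / 2)))"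
proof -
  interpret prob_space M by fact
  let ?K = "observations q N" and ?P = "PiM {..<p} (\<lambda>_. std_gauss (observations q N))"
  let ?m = "\<Sum>j=1..q. N j - 1"
  interpret P: prob_space ?P by (intro prob_space_PiM prob_space_std_gauss)
  have Ym: "Y \<kappa> \<in> M \<rightarrow>\<^sub>M PiM {..<p} (\<lambda>_. lborel)" if "\<kappa> \<in> ?K" for \<kappa>
    using ind that by (auto simp: indep_vars_def)
  have "0 \<in> {..<p}" using p1 by simp
  then have Rne: "{..<p} \<noteq> {}" by blast
  have dist: "distr M ?P yrows = ?P"
    unfolding yrows_def
    by (rule distr_rows_std_gauss[OF prob_space_axioms finite_observations observations_nonempty finite_lessThan Rne ind law])
  have rm[measurable]: "yrows \<in> M \<rightarrow>\<^sub>M ?P"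
    unfolding yrows_def
  proof (rule measurable_restrict)
    fix r assume r: "r \<in> {..<p}"
    have "(\<lambda>\<omega>. \<lambda>\<kappa>\<in>?K. Y \<kappa> \<omega> r) \<in> M \<rightarrow>\<^sub>M PiM ?K (\<lambda>_. lborel)"
      using r by (intro measurable_restrict measurable_compose[OF Ym measurable_component_singleton]) auto
    then show "(\<lambda>\<omega>. \<lambda>\<kappa>\<in>?K. Y \<kappa> \<omega> r) \<in> M \<rightarrow>\<^sub>M std_gauss ?K"
      by (simp cong: measurable_cong_sets add: sets_std_gauss)
  qed
  have push: "distr M borel (\<lambda>\<omega>. f (yrows \<omega>)) = distr ?P borel f" if "f \<in> borel_measurable ?P" for f :: "_ \<Rightarrow> real"
    using distr_distr[OF that rm] unfolding dist by (simp add: comp_def)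
  have "AE y in distr M ?P yrows. \<forall>i\<in>{..<p}. pivot (pooled_form q N) y i > 0 \<and> (\<forall>j\<in>{1..q}. pivot (group_form N j) y i > 0)"
    unfolding dist by (rule AE_all_pivots_pos)
  then show AEpos: "AE \<omega> in M. \<forall>i\<in>{..<p}. pivot (pooled_form q N) (yrows \<omega>) i > 0 \<and> (\<forall>j\<in>{1..q}. pivot (group_form N j) (yrows \<omega>) i > 0)"
    by (rule AE_distrD[OF rm])
  show lm: "(\<lambda>\<omega>. log_ratio p q N (yrows \<omega>)) \<in> borel_measurable M"
    by (rule measurable_compose[OF rm measurable_log_ratio])
  obtain J where J: "card J + q = (\<Sum>j=1..q. N j)" "gauss_rep ?K (std_gauss ?K) (pooled_form q N) J"
    using pooled_rank by blast
  have cJ: "card J = ?m" using J(1) sum_degrees by simp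
  have pm: "p \<le> ?m"
  proof -
    have "p \<le> N 1 - 1" using N[of 1] q1 by simp
    also have "\<dots> \<le> ?m" using q1 by (intro member_le_sum) auto
    finally show ?thesis .
  qed
  let ?U = "\<lambda>y. \<Sum>i<p. ln (pivot (pooled_form q N) y i)"
  let ?G = "\<lambda>j y. \<Sum>i<p. ln (pivot (group_form N j) y i)"
  have 1: "char (distr ?P borel (\<lambda>y. log_ratio p q N y + real ?m / 2 * ?U y)) t
      = char (distr ?P borel (log_ratio p q N)) t * (\<Prod>i<p. ln_chi_square_char (?m - i) (t * (real ?m / 2)))"
    unfolding cJ[symmetric]
    by (rule char_statistic_pivots[OF pooled_psd J(2) _ prob_space_std_gauss sets_std_gauss
        measurable_log_ratio log_ratio_invariant]) (use pm cJ in auto)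
  have Um: "(\<lambda>y. log_ratio p q N y + real ?m / 2 * ?U y) \<in> borel_measurable ?P"
    by (intro borel_measurable_add measurable_log_ratio borel_measurable_times borel_measurable_const
        borel_measurable_sum borel_measurable_ln measurable_pivots) auto
  have Gm: "(\<lambda>y. real (N j - 1) / 2 * ?G j y) \<in> borel_measurable ?P" if "j \<in> {1..q}" for j
    using that by (intro borel_measurable_times borel_measurable_const
        borel_measurable_sum borel_measurable_ln measurable_pivots) auto
  \<comment> \<open>The statistic 0 is trivially invariant, which leaves only the group
    pivots.\<close>
  have 2: "char (distr M borel (\<lambda>\<omega>. real (N j - 1) / 2 * ?G j (yrows \<omega>))) t
      = (\<Prod>i<p. ln_chi_square_char (N j - 1 - i) (t * (real (N j - 1) / 2)))" if j: "j \<in> {1..q}" for j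
  proof -
    obtain J where J: "card J + 1 = N j" "gauss_rep ?K (std_gauss ?K) (group_form N j) J"
      using group_rank[OF j] by blast
    have cJ: "card J = N j - 1" using J(1) by simp
    have "char (distr ?P borel (\<lambda>y. 0 + real (N j - 1) / 2 * ?G j y)) t
        = char (distr ?P borel (\<lambda>_. 0)) t * (\<Prod>i<p. ln_chi_square_char (card J - i) (t * (real (N j - 1) / 2)))"
      by (rule char_statistic_pivots[OF group_psd[OF j] J(2) _ prob_space_std_gauss sets_std_gauss])
         (use N[OF j] J in auto)
    also have "char (distr ?P borel (\<lambda>_. 0)) t = 1"
      unfolding char_def by (subst integral_distr) (simp_all add: P.prob_space)
    finally show ?thesis
      using push[OF Gm[OF j]] by (simp add: cJ)
  qed
  \<comment> \<open>Groups occupy disjoint blocks of observations. Each group statistic is first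
    written as a function of its block \<open>\<eta>\<close>, with row and observation indices
    exchanged, and then identified with the pivots of \<open>yrows\<close>.\<close>
  have "indep_vars (\<lambda>j. PiM ({j} \<times> {1..N j}) (\<lambda>_. PiM {..<p} (\<lambda>_. lborel))) (\<lambda>j \<omega>. restrict (\<lambda>\<kappa>. Y \<kappa> \<omega>) ({j} \<times> {1..N j})) {1..q}"
    by (rule indep_vars_restrict[OF ind]) (auto simp: observations_def disjoint_family_on_def)
  then have "indep_vars (\<lambda>_. borel) (\<lambda>j \<omega>. (\<lambda>\<eta>. real (N j - 1) / 2 * ?G j (\<lambda>r \<kappa>. \<eta> \<kappa> r))
      (restrict (\<lambda>\<kappa>. Y \<kappa> \<omega>) ({j} \<times> {1..N j}))) {1..q}"
  proof (rule indep_vars_compose2)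
    fix j assume j: "j \<in> {1..q}"
    let ?E = "PiM ({j} \<times> {1..N j}) (\<lambda>_. PiM {..<p} (\<lambda>_. lborel :: real measure))"
    have "(\<lambda>\<eta>. pivot (group_form N j) (\<lambda>r \<kappa>. \<eta> \<kappa> r) i) \<in> borel_measurable ?E" if i: "i < p" for i
    proof (rule psd_form.borel_measurable_pivot[OF psd_form_group_form])
      fix l k assume lk: "l \<le> i" "k \<in> {j} \<times> {1..N j}"
      have "l \<in> {..<p}" using lk i by simp
      then have "(\<lambda>u. u l) \<in> borel_measurable (PiM {..<p} (\<lambda>_. lborel :: real measure))" by measurable
      from measurable_compose[OF measurable_component_singleton[OF lk(2)] this]
      show "(\<lambda>\<eta>. \<eta> k l) \<in> borel_measurable ?E" .
    qed
    then show "(\<lambda>\<eta>. real (N j - 1) / 2 * ?G j (\<lambda>r \<kappa>. \<eta> \<kappa> r)) \<in> borel_measurable ?E"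
      by (intro borel_measurable_times borel_measurable_const borel_measurable_sum borel_measurable_ln) auto
  qed
  also have "?this \<longleftrightarrow> indep_vars (\<lambda>_. borel) (\<lambda>j \<omega>. real (N j - 1) / 2 * ?G j (yrows \<omega>)) {1..q}"
  proof (intro indep_vars_cong refl ext)
    fix j \<omega> assume j: "j \<in> {1..q}"
    interpret G: psd_form "{j} \<times> {1..N j}" "group_form N j" by (rule psd_form_group_form)
    have "pivot (group_form N j) (\<lambda>r \<kappa>. restrict (\<lambda>\<kappa>. Y \<kappa> \<omega>) ({j} \<times> {1..N j}) \<kappa> r) i = pivot (group_form N j) (yrows \<omega>) i"
      if i: "i < p" for i
    proof (rule G.pivot_local)
      fix l k assume "l \<le> i" "k \<in> {j} \<times> {1..N j}"
      then show "restrict (\<lambda>\<kappa>. Y \<kappa> \<omega>) ({j} \<times> {1..N j}) k l = yrows \<omega> l k"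
        using i group_subset[OF j] by (auto simp: yrows_def)
    qed
    then show "real (N j - 1) / 2 * ?G j (\<lambda>r \<kappa>. restrict (\<lambda>\<kappa>. Y \<kappa> \<omega>) ({j} \<times> {1..N j}) \<kappa> r)
        = real (N j - 1) / 2 * ?G j (yrows \<omega>)"
      by simp
  qed
  finally have "indep_vars (\<lambda>_. borel) (\<lambda>j \<omega>. real (N j - 1) / 2 * ?G j (yrows \<omega>)) {1..q}" .
  note sum_char = char_distr_sum[OF this, of t]
  have 3: "char (distr M borel (\<lambda>\<omega>. \<Sum>j=1..q. real (N j - 1) / 2 * ?G j (yrows \<omega>))) t
      = (\<Prod>j=1..q. \<Prod>i<p. ln_chi_square_char (N j - 1 - i) (t * (real (N j - 1) / 2)))"
    unfolding sum_char by (intro prod.cong refl 2)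
  \<comment> \<open>Only almost sure equality: where a pivot vanishes, the default 0 of
    \<open>log_ratio\<close> intervenes.\<close>
  have E: "distr M borel (\<lambda>\<omega>. \<Sum>j=1..q. real (N j - 1) / 2 * ?G j (yrows \<omega>))
      = distr M borel (\<lambda>\<omega>. log_ratio p q N (yrows \<omega>) + real ?m / 2 * ?U (yrows \<omega>))"
  proof (rule distr_cong_AE)
    show "AE \<omega> in M. (\<Sum>j=1..q. real (N j - 1) / 2 * ?G j (yrows \<omega>)) = log_ratio p q N (yrows \<omega>) + real ?m / 2 * ?U (yrows \<omega>)"
      using AEpos by eventually_elim (simp add: log_ratio_def)
    show "(\<lambda>\<omega>. \<Sum>j=1..q. real (N j - 1) / 2 * ?G j (yrows \<omega>)) \<in> borel_measurable M"
      by (intro borel_measurable_sum measurable_compose[OF rm Gm]) auto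
    show "(\<lambda>\<omega>. log_ratio p q N (yrows \<omega>) + real ?m / 2 * ?U (yrows \<omega>)) \<in> borel_measurable M"
      by (rule measurable_compose[OF rm Um])
  qed simp_all
  show "char (distr M borel (\<lambda>\<omega>. log_ratio p q N (yrows \<omega>))) t *
        (\<Prod>i<p. ln_chi_square_char (?m - i) (t * (real ?m / 2)))
      = (\<Prod>j=1..q. \<Prod>i<p. ln_chi_square_char (N j - 1 - i) (t * (real (N j - 1) / 2)))"
    unfolding push[OF measurable_log_ratio] 1[symmetric] push[OF Um, symmetric] E[symmetric] by (rule 3)
qed

end

section \<open>The modified likelihood ratio\<close>

text \<open>By the Leibniz formula the determinant is a polynomial in the entries.\<close>

lemma borel_measurable_det:
  fixes A :: "'a \<Rightarrow> nat \<Rightarrow> nat \<Rightarrow> real"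
  assumes "\<And>r s. r < p \<Longrightarrow> s < p \<Longrightarrow> (\<lambda>\<omega>. A \<omega> r s) \<in> borel_measurable M"
  shows "(\<lambda>\<omega>. Determinant.det (Matrix.mat p p (\<lambda>(r, s). A \<omega> r s))) \<in> borel_measurable M"
proof -
  have "Determinant.det (Matrix.mat p p (\<lambda>(r, s). A \<omega> r s))
      = (\<Sum>\<pi>\<in>{\<pi>. \<pi> permutes {0..<p}}. signof \<pi> * (\<Prod>i=0..<p. A \<omega> i (\<pi> i)))" for \<omega>
  proof -
    have "(\<Prod>i=0..<p. Matrix.mat p p (\<lambda>(r, s). A \<omega> r s) $$ (i, \<pi> i)) = (\<Prod>i=0..<p. A \<omega> i (\<pi> i))"
      if "\<pi> permutes {0..<p}" for \<pi>
      using permutes_in_image[OF that] by (intro prod.cong refl) auto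
    then show ?thesis by (subst det_def'[of _ p]) (auto intro!: sum.cong)
  qed
  moreover have "(\<lambda>\<omega>. A \<omega> i (\<pi> i)) \<in> borel_measurable M" if "\<pi> permutes {0..<p}" "i \<in> {0..<p}" for \<pi> i
    using permutes_in_image[OF that(1), of i] that(2) by (intro assms) auto
  ultimately show ?thesis by (auto intro!: borel_measurable_sum borel_measurable_times borel_measurable_prod)
qed

definition data_rows :: "(nat \<Rightarrow> nat \<Rightarrow> nat \<Rightarrow> real) \<Rightarrow> nat \<Rightarrow> nat \<times> nat \<Rightarrow> real" where
  "data_rows x r \<kappa> = x (fst \<kappa>) (snd \<kappa>) r"

lemma data_rows_eq: "data_rows x r = (\<lambda>\<kappa>. x (fst \<kappa>) (snd \<kappa>) r)"
  by (simp add: data_rows_def fun_eq_iff)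

lemma scatter_mat_data_rows:
  "scatter_mat p (N j) (x j) = Matrix.mat p p (\<lambda>(r, s). group_form N j (data_rows x r) (data_rows x s))"
  by (simp only: scatter_mat_eq_Gram data_rows_eq)

lemma pooled_scatter_mat_data_rows:
  "pooled_scatter_mat p q N x = Matrix.mat p p (\<lambda>(r, s). pooled_form q N (data_rows x r) (data_rows x s))"
  by (simp only: pooled_scatter_mat_eq_Gram data_rows_eq)

context
  fixes p q :: nat and N :: "nat \<Rightarrow> nat"
  assumes p1: "p \<ge> 1" and q1: "q \<ge> 1" and N: "\<And>j. j \<in> {1..q} \<Longrightarrow> p < N j"
begin

lemma real_degrees:
  "j \<in> {1..q} \<Longrightarrow> real (N j - 1) = real (N j) - 1"
  "real (\<Sum>j=1..q. N j - 1) = real (\<Sum>j=1..q. N j) - real q"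
proof -
  show "real (N j - 1) = real (N j) - 1" if "j \<in> {1..q}" using N[OF that] by simp
  show "real (\<Sum>j=1..q. N j - 1) = real (\<Sum>j=1..q. N j) - real q"
    using arg_cong[where f = real, OF sum_degrees[where p = p and q = q and N = N, OF p1 q1 N]]
    by (simp del: of_nat_sum)
qed

lemma degrees_pos: "j \<in> {1..q} \<Longrightarrow> 0 < real (N j - 1)" "0 < real (\<Sum>j=1..q. N j - 1)" "p \<le> (\<Sum>j=1..q. N j - 1)"
proof -
  show *: "0 < real (N j - 1)" if "j \<in> {1..q}" for j using N[OF that] p1 by simp
  have "p \<le> N 1 - 1" using N[of 1] q1 by simp
  also have "\<dots> \<le> (\<Sum>j=1..q. N j - 1)" using q1 by (intro member_le_sum) auto
  finally show "p \<le> (\<Sum>j=1..q. N j - 1)" .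
  then show "0 < real (\<Sum>j=1..q. N j - 1)" using p1 by linarith
qed

text \<open>\<open>log_LR_centering\<close> belongs to the determinants of the scatter matrices
  themselves; the difference accounts for dividing each matrix by its degrees of freedom.\<close>

lemma LR_centering_eq:
  "LR_centering p q N = log_LR_centering p q (\<lambda>j. N j - 1)
    - ((\<Sum>j=1..q. real (N j - 1) / 2 * (real p * ln (real (N j - 1))))
      - real (\<Sum>j=1..q. N j - 1) / 2 * (real p * ln (real (\<Sum>j=1..q. N j - 1))))"
proof -
  let ?m = "\<Sum>j=1..q. N j - 1"
  have 1: "(\<Sum>j=1..q. (real (N j) - 1) / 2 *
         ((real (N j) - 3/2) * ln ((real (N j) - 2) / (real (N j) - real p - 2))
          - real p * ln ((real (N j) - 1) / (real (N j) - real p - 2))))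
    = (\<Sum>j=1..q. real (N j - 1) / 2 * group_centering p (N j - 1))"
  proof (intro sum.cong refl)
    fix j assume j: "j \<in> {1..q}"
    have e: "real (N j) - 3/2 = real (N j - 1) - 1/2" "real (N j) - 2 = real (N j - 1) - 1"
      "real (N j) - real p - 2 = real (N j - 1) - real p - 1"
      unfolding real_degrees(1)[OF j] by linarith+
    show "(real (N j) - 1) / 2 * ((real (N j) - 3/2) * ln ((real (N j) - 2) / (real (N j) - real p - 2))
          - real p * ln ((real (N j) - 1) / (real (N j) - real p - 2)))
        = real (N j - 1) / 2 * group_centering p (N j - 1)"
      unfolding group_centering_def e real_degrees(1)[OF j, symmetric] ..
  qed
  have 2: "(\<Sum>j=1..q. real (N j - 1) / 2 * (group_centering p (N j - 1) + real p * ln (real (N j - 1))))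
      = (\<Sum>j=1..q. real (N j - 1) / 2 * group_centering p (N j - 1))
        + (\<Sum>j=1..q. real (N j - 1) / 2 * (real p * ln (real (N j - 1))))"
    by (simp only: distrib_left sum.distrib)
  have 3: "a - b * c * d = (a + s) - b * (c * d + u) - (s - b * u)" for a b c d s u :: real
    by (simp add: algebra_simps)
  show ?thesis
    unfolding LR_centering_def log_LR_centering_def Let_def 1 2 real_degrees(2)[symmetric] by (rule 3)
qed

text \<open>Scaling a matrix of size \<open>p\<close> by \<open>1 / m\<close> scales its determinant
  by \<open>(1 / m) ^ p\<close>, the source of the terms \<open>p * ln m\<close>; the rest of each
  determinant is a product of pivots.\<close>

lemma ln_modified_LR:
  assumes pos: "\<And>i. i < p \<Longrightarrow> pivot (pooled_form q N) (data_rows x) i > 0"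
    and gpos: "\<And>i j. i < p \<Longrightarrow> j \<in> {1..q} \<Longrightarrow> pivot (group_form N j) (data_rows x) i > 0"
  shows "ln (modified_LR p q N x)
    = (\<Sum>j=1..q. real (N j - 1) / 2 * (\<Sum>i<p. ln (pivot (group_form N j) (data_rows x) i)))
      - real (\<Sum>j=1..q. N j - 1) / 2 * (\<Sum>i<p. ln (pivot (pooled_form q N) (data_rows x) i))
      - ((\<Sum>j=1..q. real (N j - 1) / 2 * (real p * ln (real (N j - 1))))
      - real (\<Sum>j=1..q. N j - 1) / 2 * (real p * ln (real (\<Sum>j=1..q. N j - 1))))"
proof -
  let ?m = "\<Sum>j=1..q. N j - 1"
  interpret P: psd_form "observations q N" "pooled_form q N" by (rule pooled_psd[where p = p and q = q and N = N, OF p1 q1 N])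
  define D where "D = (1 / real ?m) ^ p * (\<Prod>i<p. pivot (pooled_form q N) (data_rows x) i)"
  define d where "d j = (1 / real (N j - 1)) ^ p * (\<Prod>i<p. pivot (group_form N j) (data_rows x) i)" for j
  have D: "Determinant.det ((1 / (real (\<Sum>j=1..q. N j) - real q)) \<cdot>\<^sub>m pooled_scatter_mat p q N x) = D"
    unfolding real_degrees(2)[symmetric] D_def
    by (simp add: pooled_scatter_mat_data_rows P.det_Gram[OF pos] del: of_nat_sum)
  have d: "Determinant.det ((1 / (real (N j) - 1)) \<cdot>\<^sub>m scatter_mat p (N j) (x j)) = d j" if j: "j \<in> {1..q}" for j
  proof -
    interpret G: psd_form "{j} \<times> {1..N j}" "group_form N j" by (rule psd_form_group_form)
    show ?thesis
      unfolding real_degrees(1)[OF j, symmetric] d_def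
      by (simp add: scatter_mat_data_rows G.det_Gram[OF gpos[OF _ j]])
  qed
  have Dpos: "D > 0"
    unfolding D_def using degrees_pos(2) pos by (intro mult_pos_pos zero_less_power prod_pos) auto
  have dpos: "d j > 0" if j: "j \<in> {1..q}" for j
    unfolding d_def using degrees_pos(1)[OF j] gpos[OF _ j] by (intro mult_pos_pos zero_less_power prod_pos) auto
  have lnD: "ln D = (\<Sum>i<p. ln (pivot (pooled_form q N) (data_rows x) i)) - real p * ln (real ?m)"
  proof -
    have "ln D = ln ((1 / real ?m) ^ p) + ln (\<Prod>i<p. pivot (pooled_form q N) (data_rows x) i)"
      unfolding D_def using degrees_pos(2) pos
      by (intro ln_mult_pos zero_less_power prod_pos) auto
    also have "ln (\<Prod>i<p. pivot (pooled_form q N) (data_rows x) i) = (\<Sum>i<p. ln (pivot (pooled_form q N) (data_rows x) i))"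
      using pos by (intro ln_prod) force+
    also have "ln ((1 / real ?m) ^ p) = - (real p * ln (real ?m))"
      using degrees_pos(2) by (simp add: ln_realpow ln_div del: of_nat_sum)
    finally show ?thesis by simp
  qed
  have lnd: "ln (d j) = (\<Sum>i<p. ln (pivot (group_form N j) (data_rows x) i)) - real p * ln (real (N j - 1))"
    if j: "j \<in> {1..q}" for j
  proof -
    have "ln (d j) = ln ((1 / real (N j - 1)) ^ p) + ln (\<Prod>i<p. pivot (group_form N j) (data_rows x) i)"
      unfolding d_def using degrees_pos(1)[OF j] gpos[OF _ j]
      by (intro ln_mult_pos zero_less_power prod_pos) auto
    also have "ln (\<Prod>i<p. pivot (group_form N j) (data_rows x) i) = (\<Sum>i<p. ln (pivot (group_form N j) (data_rows x) i))"
      using gpos[OF _ j] by (intro ln_prod) force+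
    also have "ln ((1 / real (N j - 1)) ^ p) = - (real p * ln (real (N j - 1)))"
      using degrees_pos(1)[OF j] by (simp add: ln_realpow ln_div)
    finally show ?thesis by simp
  qed
  have "modified_LR p q N x = (\<Prod>j=1..q. d j powr (real (N j - 1) / 2)) / D powr (real ?m / 2)"
  proof -
    have "(\<Prod>j=1..q. Determinant.det ((1 / (real (N j) - 1)) \<cdot>\<^sub>m scatter_mat p (N j) (x j)) powr ((real (N j) - 1) / 2))
        = (\<Prod>j=1..q. d j powr (real (N j - 1) / 2))"
      by (rule prod.cong[OF refl]) (simp only: d real_degrees(1))
    then show ?thesis unfolding modified_LR_def Let_def D real_degrees(2) by (simp only:)
  qed
  also have "ln \<dots> = ln (\<Prod>j=1..q. d j powr (real (N j - 1) / 2)) - ln (D powr (real ?m / 2))"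
    using Dpos dpos by (intro ln_divide_pos prod_pos) force+
  also have "ln (\<Prod>j=1..q. d j powr (real (N j - 1) / 2)) = (\<Sum>j=1..q. ln (d j powr (real (N j - 1) / 2)))"
    using dpos by (intro ln_prod) force+
  also have "\<dots> = (\<Sum>j=1..q. real (N j - 1) / 2 * ((\<Sum>i<p. ln (pivot (group_form N j) (data_rows x) i)) - real p * ln (real (N j - 1))))"
    using dpos by (intro sum.cong refl) (auto simp: ln_powr lnd)
  also have "ln (D powr (real ?m / 2)) = real ?m / 2 * ((\<Sum>i<p. ln (pivot (pooled_form q N) (data_rows x) i)) - real p * ln (real ?m))"
    using Dpos by (simp only: ln_powr lnD)
  finally show ?thesis
    unfolding right_diff_distrib sum_subtractf by linarith
qed

text \<open>Whitened row \<open>l\<close> is \<open>B l l\<close> times raw row \<open>l\<close>,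
  plus earlier raw rows, plus a term depending on the group only. Elimination annihilates the
  earlier rows and centering the group term, so the unknown means disappear.\<close>

lemma pivot_whitened:
  assumes B: "\<And>r. r < p \<Longrightarrow> B r r > 0" and i: "i < p" and psd: "psd_form K \<beta>" and K: "K \<subseteq> observations q N"
    and null: "\<And>\<nu>. \<beta> (\<lambda>\<kappa>. \<nu> (fst \<kappa>)) (\<lambda>\<kappa>. \<nu> (fst \<kappa>)) = 0"
  shows "pivot \<beta> (\<lambda>r\<in>{..<p}. \<lambda>\<kappa>\<in>observations q N. \<Sum>l\<le>r. B r l * (x (fst \<kappa>) (snd \<kappa>) l - c (fst \<kappa>) l)) i
    = (B i i)\<^sup>2 * pivot \<beta> (data_rows x) i"
proof -
  interpret psd_form K \<beta> by fact
  let ?y = "\<lambda>r\<in>{..<p}. \<lambda>\<kappa>\<in>observations q N. \<Sum>l\<le>r. B r l * (x (fst \<kappa>) (snd \<kappa>) l - c (fst \<kappa>) l)"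
  show ?thesis
  proof (rule pivot_triangular[where c = "\<lambda>r. B r r"])
    show "B l l \<noteq> 0" if "l \<le> i" for l using B[of l] i that by simp
    fix l assume l: "l \<le> i"
    let ?\<nu> = "\<lambda>j. - (\<Sum>m\<le>l. B l m * c j m)"
    interpret R: psd_form K "row_form \<beta> (data_rows x) l" by (rule psd_form_row_form)
    have "row_form \<beta> (data_rows x) l (\<lambda>\<kappa>. ?y l \<kappa> - B l l * data_rows x l \<kappa>) (\<lambda>\<kappa>. ?y l \<kappa> - B l l * data_rows x l \<kappa>)
        = row_form \<beta> (data_rows x) l (\<lambda>\<kappa>. (\<Sum>m<l. B l m * data_rows x m \<kappa>) + ?\<nu> (fst \<kappa>)) (\<lambda>\<kappa>. (\<Sum>m<l. B l m * data_rows x m \<kappa>) + ?\<nu> (fst \<kappa>))"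
    proof (rule R.local_both)
      fix \<kappa> assume \<kappa>: "\<kappa> \<in> K"
      then have "?y l \<kappa> = (\<Sum>m\<le>l. B l m * (data_rows x m \<kappa> - c (fst \<kappa>) m))"
        using K l i by (auto simp: data_rows_def)
      also have "\<dots> = (\<Sum>m\<le>l. B l m * data_rows x m \<kappa>) + ?\<nu> (fst \<kappa>)"
        by (simp add: right_diff_distrib sum_subtractf)
      also have "(\<Sum>m\<le>l. B l m * data_rows x m \<kappa>) = (\<Sum>m<l. B l m * data_rows x m \<kappa>) + B l l * data_rows x l \<kappa>"
        by (simp add: lessThan_Suc_atMost[symmetric])
      finally have y: "?y l \<kappa> = (\<Sum>m<l. B l m * data_rows x m \<kappa>) + B l l * data_rows x l \<kappa> + ?\<nu> (fst \<kappa>)" .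
      show "?y l \<kappa> - B l l * data_rows x l \<kappa> = (\<Sum>m<l. B l m * data_rows x m \<kappa>) + ?\<nu> (fst \<kappa>)"
        unfolding y by simp
    qed
    also have "\<dots> = 0" by (rule row_form_combination_null[OF null])
    finally show "row_form \<beta> (data_rows x) l (\<lambda>\<kappa>. ?y l \<kappa> - B l l * data_rows x l \<kappa>) (\<lambda>\<kappa>. ?y l \<kappa> - B l l * data_rows x l \<kappa>) = 0" .
  qed
qed

lemma group_form_constant:
  "j \<in> {1..q} \<Longrightarrow> group_form N j (\<lambda>\<kappa>. \<nu> (fst \<kappa>)) (\<lambda>\<kappa>. \<nu> (fst \<kappa>)) = 0"
  using N[of j] by (simp add: group_form_def)

text \<open>Under the null hypothesis one factor \<open>B\<close> whitens all groups. The squares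
  \<open>(B i i)\<^sup>2\<close> are then common to all forms, and their logarithms cancel because
  the weights balance, so means and covariance leave no trace in the law.\<close>

lemma char_normalized_LR:
  fixes X :: "nat \<Rightarrow> nat \<Rightarrow> 'a \<Rightarrow> nat \<Rightarrow> real"
  assumes "prob_space M"
    and \<mu>: "\<And>j. j \<in> {1..q} \<Longrightarrow> \<mu> j \<in> carrier_vec p" and S: "positive_definite p S"
    and X: "\<And>j i. j \<in> {1..q} \<Longrightarrow> i \<in> {1..N j} \<Longrightarrow> mvn_distributed M p (X j i) (\<mu> j) S"
    and ind: "prob_space.indep_vars M (\<lambda>_. PiM {..<p} (\<lambda>_. lborel)) (\<lambda>(j, i). X j i) (SIGMA j:{1..q}. {1..N j})"
    and w: "w \<noteq> 0"
  shows "(\<lambda>\<omega>. (ln (modified_LR p q N (\<lambda>j i. X j i \<omega>)) - LR_centering p q N) / w) \<in> borel_measurable M"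
    and "char (distr M borel (\<lambda>\<omega>. (ln (modified_LR p q N (\<lambda>j i. X j i \<omega>)) - LR_centering p q N) / w)) t
      = log_LR_char p q (\<lambda>j. N j - 1) w t"
proof -
  interpret prob_space M by fact
  let ?K = "observations q N" and ?\<Theta> = "the (mat_inverse S)" and ?m = "\<Sum>j=1..q. N j - 1"
  let ?L = "PiM {..<p} (\<lambda>_. lborel :: real measure)"
  note \<Theta> = positive_definite_inverse[OF S]
  let ?\<beta> = "\<lambda>u v. \<Sum>i<p. \<Sum>j<p. u i * v j * ?\<Theta> $$ (i, j)"
  have \<Theta>s: "?\<Theta> $$ (i, j) = ?\<Theta> $$ (j, i)" if "i < p" "j < p" for i j
  proof -
    have "?\<Theta> $$ (i, j) = Matrix.transpose_mat ?\<Theta> $$ (j, i)" using \<Theta>(1) that by simp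
    then show ?thesis using \<Theta>(2) by simp
  qed
  have quad: "?\<beta> u u = Matrix.vec p u \<bullet> (?\<Theta> *\<^sub>v Matrix.vec p u)" for u
    using \<Theta>(1) by (simp add: scalar_prod_def lessThan_atLeast0 sum_distrib_left mult_ac)
  have pos: "?\<beta> u u > 0" if "k < p" "u k \<noteq> 0" for u k
    unfolding quad
  proof (rule \<Theta>(3))
    show "Matrix.vec p u \<noteq> 0\<^sub>v p"
    proof
      assume "Matrix.vec p u = 0\<^sub>v p"
      then have "vec_index (Matrix.vec p u) k = vec_index (0\<^sub>v p) k" by simp
      then show False using that by simp
    qed
  qed simp
  have psd: "psd_form {..<p} ?\<beta>"
  proof
    show "?\<beta> u v = ?\<beta> v u" for u v
      by (subst sum.swap) (auto intro!: sum.cong simp: \<Theta>s)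
    show "?\<beta> (\<lambda>k. c * u k + v k) x = c * ?\<beta> u x + ?\<beta> v x" for c u v x
      by (simp add: sum_distrib_left sum.distrib[symmetric] algebra_simps)
    show "?\<beta> u u \<ge> 0" for u
    proof (cases "\<exists>k<p. u k \<noteq> 0")
      case True
      then obtain k where "k < p" "u k \<noteq> 0" by blast
      then show ?thesis using pos[of k u] by simp
    next
      case False
      then show ?thesis by simp
    qed
    show "?\<beta> u x = ?\<beta> v x" if "\<And>k. k \<in> {..<p} \<Longrightarrow> u k = v k" for u v x
      using that by (intro sum.cong refl) auto
  qed simp
  obtain B where B: "\<And>r. r < p \<Longrightarrow> B r r > 0" and sq: "\<And>u. ?\<beta> u u = (\<Sum>r<p. (\<Sum>l\<le>r. B r l * u l)\<^sup>2)"
  proof (rule lower_triangular_square_root[OF psd])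
    show "?\<beta> u u > 0" if "k < p" "u k \<noteq> 0" for u k using that by (rule pos)
  qed (rule that)
  define T where "T \<kappa> x = (\<lambda>r\<in>{..<p}. \<Sum>l\<le>r. B r l * (x l - vec_index (\<mu> (fst \<kappa>)) l))"
    for \<kappa> :: "nat \<times> nat" and x :: "nat \<Rightarrow> real"
  define Y where "Y \<kappa> \<omega> = T \<kappa> (X (fst \<kappa>) (snd \<kappa>) \<omega>)" for \<kappa> \<omega>
  define yrows where "yrows \<omega> = (\<lambda>r\<in>{..<p}. \<lambda>\<kappa>\<in>?K. Y \<kappa> \<omega> r)" for \<omega>
  define x where "x \<omega> = (\<lambda>j i. X j i \<omega>)" for \<omega>
  have Tm: "T \<kappa> \<in> ?L \<rightarrow>\<^sub>M ?L" for \<kappa>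
    unfolding T_def by (intro measurable_restrict) (auto intro!: borel_measurable_sum)
  have ind': "indep_vars (\<lambda>_. ?L) Y ?K"
  proof -
    have "indep_vars (\<lambda>_. ?L) (\<lambda>\<kappa> \<omega>. T \<kappa> ((\<lambda>(j, i). X j i) \<kappa> \<omega>)) (SIGMA j:{1..q}. {1..N j})"
      by (rule indep_vars_compose2[OF ind Tm])
    then show ?thesis unfolding Y_def observations_def by (simp add: case_prod_beta)
  qed
  have law: "distr M ?L (Y \<kappa>) = std_gauss {..<p}" if "\<kappa> \<in> ?K" for \<kappa>
  proof -
    have \<kappa>: "fst \<kappa> \<in> {1..q}" "snd \<kappa> \<in> {1..N (fst \<kappa>)}" using that by (auto simp: observations_def)
    show ?thesis
      unfolding Y_def T_def
      by (rule mvn_whitening[OF prob_space_axioms X[OF \<kappa>] \<mu>[OF \<kappa>(1)] S B sq])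
  qed
  have AEy: "AE \<omega> in M. \<forall>i\<in>{..<p}. pivot (pooled_form q N) (yrows \<omega>) i > 0 \<and> (\<forall>j\<in>{1..q}. pivot (group_form N j) (yrows \<omega>) i > 0)"
    unfolding yrows_def by (rule char_log_ratio(1)[where p = p and q = q and N = N, OF p1 q1 N prob_space_axioms ind' law])
  have lm: "(\<lambda>\<omega>. log_ratio p q N (yrows \<omega>)) \<in> borel_measurable M"
    unfolding yrows_def by (rule char_log_ratio(2)[where p = p and q = q and N = N, OF p1 q1 N prob_space_axioms ind' law])
  have ch: "char (distr M borel (\<lambda>\<omega>. log_ratio p q N (yrows \<omega>))) t *
        (\<Prod>i<p. ln_chi_square_char (?m - i) (t * (real ?m / 2)))
      = (\<Prod>j=1..q. \<Prod>i<p. ln_chi_square_char (N j - 1 - i) (t * (real (N j - 1) / 2)))" for t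
    unfolding yrows_def
    by (rule char_log_ratio(3)[where p = p and q = q and N = N, OF p1 q1 N prob_space_axioms ind' law])
  have yx: "yrows \<omega> = (\<lambda>r\<in>{..<p}. \<lambda>\<kappa>\<in>?K. \<Sum>l\<le>r. B r l * (x \<omega> (fst \<kappa>) (snd \<kappa>) l - vec_index (\<mu> (fst \<kappa>)) l))" for \<omega>
    unfolding yrows_def Y_def T_def x_def by (auto simp: fun_eq_iff)
  have pg: "pivot (group_form N j) (yrows \<omega>) i = (B i i)\<^sup>2 * pivot (group_form N j) (data_rows (x \<omega>)) i"
    if "i < p" "j \<in> {1..q}" for i j \<omega>
    unfolding yx using that
    by (intro pivot_whitened[OF B _ psd_form_group_form group_subset[where p = p and q = q and N = N, OF p1 q1 N]] group_form_constant)
  have pp: "pivot (pooled_form q N) (yrows \<omega>) i = (B i i)\<^sup>2 * pivot (pooled_form q N) (data_rows (x \<omega>)) i"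
    if "i < p" for i \<omega>
    unfolding yx using that
    by (intro pivot_whitened[OF B _ pooled_psd[where p = p and q = q and N = N, OF p1 q1 N] subset_refl])
       (auto simp: pooled_form_def group_form_constant)
  let ?c = "log_LR_centering p q (\<lambda>j. N j - 1)"
  have AEW: "AE \<omega> in M. (ln (modified_LR p q N (x \<omega>)) - LR_centering p q N) / w = (log_ratio p q N (yrows \<omega>) - ?c) / w"
    using AEy
  proof eventually_elim
    case (elim \<omega>)
    have xp: "pivot (pooled_form q N) (data_rows (x \<omega>)) i > 0" if "i < p" for i
    proof -
      have "pivot (pooled_form q N) (yrows \<omega>) i > 0" using elim that by blast
      then have "(B i i)\<^sup>2 * pivot (pooled_form q N) (data_rows (x \<omega>)) i > 0" unfolding pp[OF that] .
      then show ?thesis using B[OF that] by (auto simp: zero_less_mult_iff)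
    qed
    have xg: "pivot (group_form N j) (data_rows (x \<omega>)) i > 0" if "i < p" "j \<in> {1..q}" for i j
    proof -
      have "pivot (group_form N j) (yrows \<omega>) i > 0" using elim that by blast
      then have "(B i i)\<^sup>2 * pivot (group_form N j) (data_rows (x \<omega>)) i > 0" unfolding pg[OF that] .
      then show ?thesis using B[OF that(1)] by (auto simp: zero_less_mult_iff)
    qed
    let ?b = "\<Sum>i<p. ln ((B i i)\<^sup>2)"
    have lp: "(\<Sum>i<p. ln (pivot (pooled_form q N) (yrows \<omega>) i)) = ?b + (\<Sum>i<p. ln (pivot (pooled_form q N) (data_rows (x \<omega>)) i))"
      unfolding sum.distrib[symmetric]
    proof (rule sum.cong[OF refl])
      fix i assume "i \<in> {..<p}"
      then have i: "i < p" by simp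
      show "ln (pivot (pooled_form q N) (yrows \<omega>) i) = ln ((B i i)\<^sup>2) + ln (pivot (pooled_form q N) (data_rows (x \<omega>)) i)"
        unfolding pp[OF i] using B[OF i] xp[OF i] by (intro ln_mult_pos) auto
    qed
    have lg: "(\<Sum>i<p. ln (pivot (group_form N j) (yrows \<omega>) i)) = ?b + (\<Sum>i<p. ln (pivot (group_form N j) (data_rows (x \<omega>)) i))"
      if j: "j \<in> {1..q}" for j
      unfolding sum.distrib[symmetric]
    proof (rule sum.cong[OF refl])
      fix i assume "i \<in> {..<p}"
      then have i: "i < p" by simp
      show "ln (pivot (group_form N j) (yrows \<omega>) i) = ln ((B i i)\<^sup>2) + ln (pivot (group_form N j) (data_rows (x \<omega>)) i)"
        unfolding pg[OF i j] using B[OF i] xg[OF i j] by (intro ln_mult_pos) auto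
    qed
    have "log_ratio p q N (yrows \<omega>) = (\<Sum>j=1..q. real (N j - 1) / 2 * (\<Sum>i<p. ln (pivot (group_form N j) (yrows \<omega>) i)))
        - real ?m / 2 * (\<Sum>i<p. ln (pivot (pooled_form q N) (yrows \<omega>) i))"
      unfolding log_ratio_def if_P[OF elim] ..
    also have "(\<Sum>j=1..q. real (N j - 1) / 2 * (\<Sum>i<p. ln (pivot (group_form N j) (yrows \<omega>) i)))
        = (\<Sum>j=1..q. real (N j - 1) / 2 * ?b + real (N j - 1) / 2 * (\<Sum>i<p. ln (pivot (group_form N j) (data_rows (x \<omega>)) i)))"
      by (intro sum.cong refl) (simp only: lg distrib_left)
    also have "\<dots> = real ?m / 2 * ?b + (\<Sum>j=1..q. real (N j - 1) / 2 * (\<Sum>i<p. ln (pivot (group_form N j) (data_rows (x \<omega>)) i)))"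
      unfolding sum.distrib by (simp add: sum_distrib_right sum_divide_distrib)
    finally have "log_ratio p q N (yrows \<omega>) = (\<Sum>j=1..q. real (N j - 1) / 2 * (\<Sum>i<p. ln (pivot (group_form N j) (data_rows (x \<omega>)) i)))
        - real ?m / 2 * (\<Sum>i<p. ln (pivot (pooled_form q N) (data_rows (x \<omega>)) i))"
      unfolding lp distrib_left by linarith
    moreover have "ln (modified_LR p q N (x \<omega>))
        = (\<Sum>j=1..q. real (N j - 1) / 2 * (\<Sum>i<p. ln (pivot (group_form N j) (data_rows (x \<omega>)) i)))
          - real ?m / 2 * (\<Sum>i<p. ln (pivot (pooled_form q N) (data_rows (x \<omega>)) i))
          - ((\<Sum>j=1..q. real (N j - 1) / 2 * (real p * ln (real (N j - 1))))
            - real ?m / 2 * (real p * ln (real ?m)))"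
      by (rule ln_modified_LR) (fact xp, fact xg)
    ultimately have "ln (modified_LR p q N (x \<omega>)) - LR_centering p q N = log_ratio p q N (yrows \<omega>) - ?c"
      unfolding LR_centering_eq by (simp only: diff_diff_eq2 diff_add_cancel)
    then show ?case by simp
  qed
  \<comment> \<open>Almost sure equality with a measurable function does not give measurability on
    an incomplete space, so it is derived from the determinants themselves.\<close>
  show Wm: "(\<lambda>\<omega>. (ln (modified_LR p q N (\<lambda>j i. X j i \<omega>)) - LR_centering p q N) / w) \<in> borel_measurable M"
  proof -
    have xm: "(\<lambda>\<omega>. X j i \<omega> r) \<in> borel_measurable M" if "j \<in> {1..q}" "i \<in> {1..N j}" "r < p" for j i r
    proof -
      have "X j i \<in> M \<rightarrow>\<^sub>M ?L" using X[OF that(1,2)] by (simp add: mvn_distributed_def distributed_def)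
      from measurable_compose[OF this measurable_component_singleton[of r "{..<p}"]] that(3) show ?thesis by simp
    qed
    have gm: "(\<lambda>\<omega>. group_form N j (data_rows (x \<omega>) r) (data_rows (x \<omega>) s)) \<in> borel_measurable M"
      if "j \<in> {1..q}" "r < p" "s < p" for j r s
      unfolding group_form_def data_rows_def x_def fst_conv snd_conv using that
      by (intro borel_measurable_sum borel_measurable_times borel_measurable_diff borel_measurable_divide xm
          borel_measurable_const) auto
    have d1: "(\<lambda>\<omega>. Determinant.det ((1 / (real (N j) - 1)) \<cdot>\<^sub>m scatter_mat p (N j) (x \<omega> j))) \<in> borel_measurable M"
      if "j \<in> {1..q}" for j
    proof -
      have "(\<lambda>\<omega>. Determinant.det (Matrix.mat p p (\<lambda>(r, s). group_form N j (data_rows (x \<omega>) r) (data_rows (x \<omega>) s)))) \<in> borel_measurable M"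
        using that by (intro borel_measurable_det gm)
      then show ?thesis by (simp add: scatter_mat_data_rows)
    qed
    have d2: "(\<lambda>\<omega>. Determinant.det ((1 / (real (\<Sum>j=1..q. N j) - real q)) \<cdot>\<^sub>m pooled_scatter_mat p q N (x \<omega>))) \<in> borel_measurable M"
    proof -
      have "(\<lambda>\<omega>. Determinant.det (Matrix.mat p p (\<lambda>(r, s). pooled_form q N (data_rows (x \<omega>) r) (data_rows (x \<omega>) s)))) \<in> borel_measurable M"
        unfolding pooled_form_def by (intro borel_measurable_det borel_measurable_sum gm)
      then show ?thesis by (simp add: pooled_scatter_mat_data_rows)
    qed
    have "(\<lambda>\<omega>. ln (modified_LR p q N (x \<omega>))) \<in> borel_measurable M"
      unfolding modified_LR_def Let_def
      by (intro borel_measurable_ln borel_measurable_divide borel_measurable_prod powr_real_measurable d1 d2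
          borel_measurable_const)
    then show ?thesis unfolding x_def by measurable
  qed
  have "distr M borel (\<lambda>\<omega>. (ln (modified_LR p q N (\<lambda>j i. X j i \<omega>)) - LR_centering p q N) / w)
      = distr M borel (\<lambda>\<omega>. (log_ratio p q N (yrows \<omega>) - ?c) / w)"
    using AEW Wm lm unfolding x_def by (intro distr_cong_AE) auto
  also have "char \<dots> t = (CLINT \<omega>|M. iexp (t * ((log_ratio p q N (yrows \<omega>) - ?c) / w)))"
    unfolding char_def using lm by (subst integral_distr) auto
  also have "\<dots> = (CLINT \<omega>|M. exp (- \<i> * of_real (t * ?c / w)) * iexp (t / w * log_ratio p q N (yrows \<omega>)))"
    by (intro Bochner_Integration.integral_cong refl)
       (simp add: exp_add[symmetric] diff_divide_distrib right_diff_distrib)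
  also have "\<dots> = exp (- \<i> * of_real (t * ?c / w)) * char (distr M borel (\<lambda>\<omega>. log_ratio p q N (yrows \<omega>))) (t / w)"
    unfolding char_def using lm by (subst integral_distr) auto
  also have "char (distr M borel (\<lambda>\<omega>. log_ratio p q N (yrows \<omega>))) (t / w)
      = (\<Prod>j=1..q. \<Prod>i<p. ln_chi_square_char (N j - 1 - i) (t * real (N j - 1) / (2 * w)))
        / (\<Prod>i<p. ln_chi_square_char (?m - i) (t * real ?m / (2 * w)))"
  proof -
    have e: "t / w * (real k / 2) = t * real k / (2 * w)" for k by simp
    \<comment> \<open>Each factor is an exponential, so the characteristic functions may be
      divided.\<close>
    have "(\<Prod>i<p. ln_chi_square_char (?m - i) (t * real ?m / (2 * w))) \<noteq> 0"
    proof -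
      have "ln_chi_square_char (?m - i) \<tau> \<noteq> 0" if "i < p" for i \<tau>
        using that degrees_pos(3) by (subst ln_chi_square_char_expansion(1)) auto
      then show ?thesis by simp
    qed
    then show ?thesis
      using ch[of "t / w"] unfolding e by (simp add: nonzero_eq_divide_eq del: of_nat_sum prod_zero_iff)
  qed
  finally show "char (distr M borel (\<lambda>\<omega>. (ln (modified_LR p q N (\<lambda>j i. X j i \<omega>)) - LR_centering p q N) / w)) t
      = log_LR_char p q (\<lambda>j. N j - 1) w t"
    unfolding log_LR_char_def Let_def by simp
qed

end

section \<open>The limit theorem\<close>

lemma char_normal_distribution:
  assumes \<sigma>: "\<sigma> > 0"
  shows "char (density lborel (\<lambda>x. ennreal (normal_density 0 \<sigma> x))) t = exp (of_real (- (t\<^sup>2 * \<sigma>\<^sup>2 / 2)))"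
proof -
  interpret S: prob_space std_normal_distribution by (rule prob_space_normal_density) simp
  have "distributed std_normal_distribution lborel (\<lambda>x. x) std_normal_density"
    by (simp add: distributed_def distr_id2)
  from S.normal_density_affine[OF this, of \<sigma> 0] \<sigma>
  have "density lborel (\<lambda>x. ennreal (normal_density 0 \<sigma> x)) = distr std_normal_distribution lborel (\<lambda>x. \<sigma> * x)"
    by (simp add: distributed_def)
  also have "char \<dots> t = char std_normal_distribution (t * \<sigma>)"
    unfolding char_def by (subst integral_distr) (auto simp: mult.assoc)
  finally show ?thesis
    unfolding exp_of_real by (simp add: char_std_normal_distribution power_mult_distrib)
qed

theorem theorem3p1:
  fixes M :: "nat \<Rightarrow> 'a measure"
    and p q :: "nat \<Rightarrow> nat"
    and N :: "nat \<Rightarrow> nat \<Rightarrow> nat"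
    and X :: "nat \<Rightarrow> nat \<Rightarrow> nat \<Rightarrow> 'a \<Rightarrow> nat \<Rightarrow> real"
    and \<mu> :: "nat \<Rightarrow> nat \<Rightarrow> real Matrix.vec"
    and S :: "nat \<Rightarrow> nat \<Rightarrow> real Matrix.mat"
    and \<sigma> :: real
  assumes prob: "\<And>n. n \<ge> 1 \<Longrightarrow> prob_space (M n)"
    and p_pos: "\<And>n. n \<ge> 1 \<Longrightarrow> p n \<ge> 1"
    and q_pos: "\<And>n. n \<ge> 1 \<Longrightarrow> q n \<ge> 1"
    and N_pos: "\<And>n j. n \<ge> 1 \<Longrightarrow> j \<in> {1..q n} \<Longrightarrow> N n j \<ge> 1"
    and total: "\<And>n. n \<ge> 1 \<Longrightarrow> (\<Sum>j=1..q n. N n j) = n"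
    and mu_dim: "\<And>n j. n \<ge> 1 \<Longrightarrow> j \<in> {1..q n} \<Longrightarrow> \<mu> n j \<in> carrier_vec (p n)"
    and S_pd: "\<And>n j. n \<ge> 1 \<Longrightarrow> j \<in> {1..q n} \<Longrightarrow> positive_definite (p n) (S n j)"
    and normal: "\<And>n j i. n \<ge> 1 \<Longrightarrow> j \<in> {1..q n} \<Longrightarrow> i \<in> {1..N n j} \<Longrightarrow>
                   mvn_distributed (M n) (p n) (X n j i) (\<mu> n j) (S n j)"
    and indep: "\<And>n. n \<ge> 1 \<Longrightarrow>
                  prob_space.indep_vars (M n) (\<lambda>_. \<Pi>\<^sub>M r\<in>{..<p n}. lborel)
                    (\<lambda>(j, i). X n j i) (SIGMA j:{1..q n}. {1..N n j})"
    and p_less: "\<And>n j. n \<ge> 1 \<Longrightarrow> j \<in> {1..q n} \<Longrightarrow> N n j + 1 > p n"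
    and p_lim: "filterlim p at_top sequentially"
    and q_small: "(\<lambda>n. real (q n)) \<in> o(\<lambda>n. sqrt (real (p n) * (real n - real (q n))))"
    and p_small: "(\<lambda>n. real (p n)) \<in> o(\<lambda>n. real n - real (q n))"
    and ratio: "limsup (\<lambda>n. SUP j\<in>{1..q n}. ereal (real (p n) / (real (N n j) - 1))) < 1"
    and sigma_pos: "\<sigma> > 0"
    and variance: "(\<lambda>n. LR_variance (p n) (q n) (N n)) \<longlonglongrightarrow> \<sigma>\<^sup>2"
    and H0: "\<And>n j k. n \<ge> 1 \<Longrightarrow> j \<in> {1..q n} \<Longrightarrow> k \<in> {1..q n} \<Longrightarrow> S n j = S n k"
  shows "weak_conv_m
           (\<lambda>n. distr (M n) borel
              (\<lambda>\<omega>. (ln (modified_LR (p n) (q n) (N n) (\<lambda>j i. X n j i \<omega>))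
                      - LR_centering (p n) (q n) (N n))
                    / sqrt (real (p n) * (real n - real (q n)))))
           (density lborel (\<lambda>x. ennreal (normal_density 0 \<sigma> x)))"
proof -
  \<comment> \<open>Everything is now expressed in degrees of freedom: \<open>m n j\<close> for a
    group and \<open>K n\<close>, which is \<open>n - q n\<close>, for the pooled matrix.\<close>
  define m where "m n j = N n j - 1" for n j
  define K where "K n = (\<Sum>j=1..q n. m n j)" for n
  define w where "w n = sqrt (real (p n) * real (K n))" for n
  have mr: "real (m n j) = real (N n j) - 1" if "n \<ge> 1" "j \<in> {1..q n}" for n j
    using N_pos[OF that] by (simp add: m_def)
  have Kr: "real (K n) = real n - real (q n)" if n: "n \<ge> 1" for n
  proof -
    have "real (K n) = (\<Sum>j=1..q n. real (N n j) - 1)"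
      unfolding K_def of_nat_sum using n by (intro sum.cong refl mr)
    also have "\<dots> = real (\<Sum>j=1..q n. N n j) - real (q n)" by (simp add: sum_subtractf)
    finally show ?thesis unfolding total[OF n] .
  qed
  have wr: "sqrt (real (p n) * (real n - real (q n))) = w n" if "n \<ge> 1" for n
    unfolding w_def Kr[OF that] ..
  have ev1: "eventually (\<lambda>n. n \<ge> (1::nat)) sequentially" by (rule eventually_ge_at_top)
  \<comment> \<open>A real number strictly between the limsup and 1; \<open>1 - c\<close> becomes
    the relative gap \<open>\<epsilon>\<close>.\<close>
  obtain c where c: "limsup (\<lambda>n. SUP j\<in>{1..q n}. ereal (real (p n) / (real (N n j) - 1))) < ereal c" "c < 1"
    using ereal_dense2[OF ratio] by auto
  have ev: "eventually (\<lambda>n. \<forall>j\<in>{1..q n}. p n < m n j \<and> (1 - c) * real (m n j) \<le> real (m n j) - real (p n)) sequentially"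
    using Limsup_lessD[OF c(1)] ev1 filterlim_at_top[THEN iffD1, OF p_lim, rule_format, of 2]
  proof eventually_elim
    case (elim n)
    show ?case
    proof
      fix j assume j: "j \<in> {1..q n}"
      \<comment> \<open>\<open>p n \<ge> 2\<close> and \<open>N n j + 1 > p n\<close> force
        \<open>N n j \<ge> 2\<close>, so the ratio has a positive denominator and really bounds
        \<open>p n\<close> by \<open>c * m n j\<close>.\<close>
      have m0: "real (m n j) > 0"
        using p_less[OF elim(2) j] elim(3) mr[OF elim(2) j] by linarith
      have "ereal (real (p n) / (real (N n j) - 1)) \<le> (SUP j\<in>{1..q n}. ereal (real (p n) / (real (N n j) - 1)))"
        using j by (rule SUP_upper)
      from le_less_trans[OF this elim(1)] have "real (p n) / real (m n j) < c"
        unfolding mr[OF elim(2) j] by simp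
      then have l: "real (p n) < c * real (m n j)" using m0 by (simp add: divide_less_eq)
      also have "\<dots> < 1 * real (m n j)" using c(2) m0 by (rule mult_strict_right_mono)
      finally show "p n < m n j \<and> (1 - c) * real (m n j) \<le> real (m n j) - real (p n)"
        using l by (simp add: left_diff_distrib)
    qed
  qed
  have lim: "(\<lambda>n. log_LR_char (p n) (q n) (m n) (w n) t) \<longlonglongrightarrow> exp (of_real (- (t\<^sup>2 * \<sigma>\<^sup>2 / 2)))" for t
  proof (rule log_LR_char_tendsto[OF K_def w_def p_lim _ _ ev])
    show "eventually (\<lambda>n. q n \<ge> 1) sequentially" using ev1 by eventually_elim (rule q_pos)
    show "1 - c > 0" using c(2) by simp
    show "(\<lambda>n. real (q n) / w n) \<longlonglongrightarrow> 0"
    proof (rule Lim_transform_eventually[OF smalloD_tendsto[OF q_small]])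
      show "eventually (\<lambda>n. real (q n) / sqrt (real (p n) * (real n - real (q n))) = real (q n) / w n) sequentially"
        using ev1 by eventually_elim (simp only: wr)
    qed
    show "(\<lambda>n. real (p n) / real (K n)) \<longlonglongrightarrow> 0"
    proof (rule Lim_transform_eventually[OF smalloD_tendsto[OF p_small]])
      show "eventually (\<lambda>n. real (p n) / (real n - real (q n)) = real (p n) / real (K n)) sequentially"
        using ev1 by eventually_elim (simp only: Kr)
    qed
    show "(\<lambda>n. 1/2 * (\<Sum>j=1..q n. (real (m n j))\<^sup>2 / (real (p n) * real (K n)) *
        ln (real (m n j) / (real (m n j) - real (p n)))) - 1/2) \<longlonglongrightarrow> \<sigma>\<^sup>2"
    proof (rule Lim_transform_eventually[OF variance])
      show "eventually (\<lambda>n. LR_variance (p n) (q n) (N n) =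
          1/2 * (\<Sum>j=1..q n. (real (m n j))\<^sup>2 / (real (p n) * real (K n)) *
            ln (real (m n j) / (real (m n j) - real (p n)))) - 1/2) sequentially"
        using ev1
      proof eventually_elim
        case (elim n)
        have "(\<Sum>j=1..q n. (real (N n j) - 1)\<^sup>2 / (real (p n) * (real n - real (q n)))
               * ln ((real (N n j) - 1) / (real (N n j) - real (p n) - 1)))
          = (\<Sum>j=1..q n. (real (m n j))\<^sup>2 / (real (p n) * real (K n)) *
            ln (real (m n j) / (real (m n j) - real (p n))))"
          by (rule sum.cong[OF refl]) (simp add: mr[OF elim] Kr[OF elim] algebra_simps)
        then show ?case unfolding LR_variance_def Let_def total[OF elim] by simp
      qed
    qed
  qed
  define W where "W n \<omega> = (ln (modified_LR (p n) (q n) (N n) (\<lambda>j i. X n j i \<omega>)) - LR_centering (p n) (q n) (N n)) / w n" for n \<omega>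
  \<comment> \<open>Only from \<open>n0\<close> on is every group known to be large enough for the
    formula for the characteristic function. Levy's theorem asks for a probability law at every
    index, so the sequence is shifted by \<open>n0\<close>.\<close>
  obtain n0 where n0: "n0 \<ge> 1" and n0_m: "\<And>n j. n \<ge> n0 \<Longrightarrow> j \<in> {1..q n} \<Longrightarrow> p n < m n j"
    using eventually_conj[OF ev1 ev] unfolding eventually_sequentially by (metis le_refl nle_le)
  have fin: "W n \<in> borel_measurable (M n)" "char (distr (M n) borel (W n)) t = log_LR_char (p n) (q n) (m n) (w n) t"
    if n: "n \<ge> n0" for n t
  proof -
    have n1: "n \<ge> 1" using n n0 by simp
    note p1 = p_pos[OF n1] and q1 = q_pos[OF n1]
    have pN: "p n < N n j" if "j \<in> {1..q n}" for j using n0_m[OF n that] by (simp add: m_def)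
    have "m n 1 \<le> K n" unfolding K_def using q1 by (intro member_le_sum) auto
    moreover have "p n < m n 1" using q1 by (intro n0_m[OF n]) simp
    ultimately have w0: "w n \<noteq> 0" using p1 unfolding w_def by simp
    \<comment> \<open>The null hypothesis enters here: group 1 supplies the common covariance
      matrix.\<close>
    have Xn: "mvn_distributed (M n) (p n) (X n j i) (\<mu> n j) (S n 1)" if "j \<in> {1..q n}" "i \<in> {1..N n j}" for j i
    proof -
      have "S n j = S n 1" using q1 by (intro H0[OF n1 that(1)]) simp
      then show ?thesis using normal[OF n1 that] by simp
    qed
    have S1: "positive_definite (p n) (S n 1)" using q1 by (intro S_pd[OF n1]) simp
    note C = char_normalized_LR[where p = "p n" and q = "q n" and N = "N n", OF p1 q1 pN prob[OF n1] mu_dim[OF n1] S1 Xn indep[OF n1] w0]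
    show "W n \<in> borel_measurable (M n)" unfolding W_def by (rule C(1))
    show "char (distr (M n) borel (W n)) t = log_LR_char (p n) (q n) (m n) (w n) t"
      unfolding W_def m_def by (rule C(2))
  qed
  let ?\<Phi> = "density lborel (\<lambda>x. ennreal (normal_density 0 \<sigma> x))"
  interpret \<Phi>: prob_space ?\<Phi> by (rule prob_space_normal_density[OF sigma_pos])
  have \<Phi>: "real_distribution ?\<Phi>" by unfold_locales auto
  have "weak_conv_m (\<lambda>n. distr (M (n + n0)) borel (W (n + n0))) ?\<Phi>"
  proof (rule levy_continuity[OF _ \<Phi>])
    fix n
    have "n + n0 \<ge> 1" using n0 by simp
    then interpret prob_space "M (n + n0)" by (rule prob)
    show "real_distribution (distr (M (n + n0)) borel (W (n + n0)))"
      by (rule real_distribution_distr) (rule fin, simp)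
  next
    fix t
    have "(\<lambda>n. log_LR_char (p (n + n0)) (q (n + n0)) (m (n + n0)) (w (n + n0)) t)
        \<longlonglongrightarrow> exp (of_real (- (t\<^sup>2 * \<sigma>\<^sup>2 / 2)))"
      by (rule LIMSEQ_ignore_initial_segment[OF lim])
    then show "(\<lambda>n. char (distr (M (n + n0)) borel (W (n + n0))) t) \<longlonglongrightarrow> char ?\<Phi> t"
      by (simp only: fin(2) le_add2 char_normal_distribution[OF sigma_pos])
  qed
  moreover have "distr (M (n + n0)) borel (\<lambda>\<omega>. (ln (modified_LR (p (n + n0)) (q (n + n0)) (N (n + n0)) (\<lambda>j i. X (n + n0) j i \<omega>))
      - LR_centering (p (n + n0)) (q (n + n0)) (N (n + n0))) / sqrt (real (p (n + n0)) * (real (n + n0) - real (q (n + n0)))))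
    = distr (M (n + n0)) borel (W (n + n0))" for n
  proof -
    have "n + n0 \<ge> 1" using n0 by simp
    from wr[OF this] show ?thesis unfolding W_def by (simp only:)
  qed
  ultimately have "weak_conv_m (\<lambda>n. distr (M (n + n0)) borel (\<lambda>\<omega>. (ln (modified_LR (p (n + n0)) (q (n + n0)) (N (n + n0)) (\<lambda>j i. X (n + n0) j i \<omega>))
      - LR_centering (p (n + n0)) (q (n + n0)) (N (n + n0))) / sqrt (real (p (n + n0)) * (real (n + n0) - real (q (n + n0)))))) ?\<Phi>"
    by (simp only:)
  then show ?thesis
    unfolding weak_conv_m_def weak_conv_def by (blast intro: LIMSEQ_offset[where k = n0])
qed

end
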